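(* Fix an integer $d\ge1$. There is a constant $C$ such that the following holds for all $n\ge 2$, all integers $k\ge 1$, and every set $S$ of $n$ distinct sites in the plane. Assign random parametric points in $[0,1]^d$ to the sites according to the sampling model, and let $\langle s_1,\dots,s_n\rangle$ be the resulting volume ordering of $S$. Let $S_i=\{s_1,\dots,s_i\}$, and let $\mathrm{env}_i=\mathrm{env}_k(s_i,S_i)$. Then the expected complexity of the planar arrangement determined by the overlay of the polygons $\mathrm{env}_1,\dots,\mathrm{env}_n$ (and therefore the expected complexity of the $k$-th order proxy diagram of $S$) is at most $C\,k^4 n\log n$.
   Context: Sampling model: the site locations are fixed. The parametric points of the sites are independent. For each site, the $j$-th coordinate of its parametric point is drawn from a continuous (atomless) distribution $\mathcal{D}_j$ on $[0,1]$, independently over $j=1,\dots,d$. All sampled values are assumed distinct. Volume ordering: the point volume of $p\in[0,1]^d$ is $p_1p_2\cdots p_d$. The volume ordering of $S$ lists the sites by increasing point volume of their parametric points. Nearest neighbours: for a finite set of sites $T$ and $x\in\mathbb{R}^2$, let $\mathsf{d}_k(x,T)$ be the $k$-th smallest value in the multiset $\{\|x-s\|: s\in T\}$, and let $\mathsf{N}_k(x,T)=\{s\in T:\|x-s\|\le \mathsf{d}_k(x,T)\}$ (with $\mathsf{N}_k(x,T)=T$ if $|T|<k$). Environment: the $k$ environment of $s\in T$ is $\mathrm{env}_k(s,T)=\{x\in\mathbb{R}^2: s\in \mathsf{N}_k(x,T)\}$. It is a (possibly unbounded) polygon that is star-shaped with respect to $s$. Proxy diagram: the $k$-th proxy set of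 $x$ is $\Phi_k(x,S)=\bigcup_{i=1}^n \mathsf{N}_k(x,S_i)$. The $k$-th order proxy diagram is the decomposition of the plane into the classes of points having the same $k$-th proxy set. It is the arrangement given by the overlay of $\mathrm{env}_1,\dots,\mathrm{env}_n$. The complexity of a planar arrangement is its total number of vertices, edges and faces. *)

theory Defs
  imports "HOL-Probability.Probability"
begin

section \<open>Sampling model and volume ordering\<close>

definition continuous_distribution_01 :: "real measure \<Rightarrow> bool" where
  "continuous_distribution_01 D \<longleftrightarrow>
     real_distribution D \<and> (\<forall>x. emeasure D {x} = 0) \<and> (AE x in D. x \<in> {0..1})"

text \<open>A sample \<open>p\<close> maps every site \<open>s\<close> to its parametric point \<open>p s\<close>, whose coordinates are
  \<open>p s 1, \<dots>, p s d\<close>.  The product measure encodes the independence both of the points and of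
  their coordinates.\<close>

definition sampling_model ::
  "nat \<Rightarrow> (nat \<Rightarrow> real measure) \<Rightarrow> 'a set \<Rightarrow> ('a \<Rightarrow> nat \<Rightarrow> real) measure" where
  "sampling_model d D S = PiM S (\<lambda>s. PiM {1..d} D)"

definition point_volume :: "nat \<Rightarrow> (nat \<Rightarrow> real) \<Rightarrow> real" where
  "point_volume d q = (\<Prod>j=1..d. q j)"

text \<open>The list is determined uniquely when the point volumes are pairwise distinct, which is almost
  surely the case; its value on the null set where two volumes agree is irrelevant.\<close>

definition volume_ordering :: "nat \<Rightarrow> ('a \<Rightarrow> nat \<Rightarrow> real) \<Rightarrow> 'a set \<Rightarrow> 'a list" where
  "volume_ordering d p S =
     (THE xs. set xs = S \<and> sorted_wrt (\<lambda>s t. point_volume d (p s) < point_volume d (p t)) xs)"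


section \<open>Nearest neighbours, environments and proxy sets\<close>

definition kth_dist :: "nat \<Rightarrow> real^2 \<Rightarrow> (real^2) set \<Rightarrow> real" where
  "kth_dist k x T =
     sorted_list_of_multiset (image_mset (\<lambda>s. norm (x - s)) (mset_set T)) ! (k - 1)"

definition nearest :: "nat \<Rightarrow> real^2 \<Rightarrow> (real^2) set \<Rightarrow> (real^2) set" where
  "nearest k x T = (if card T < k then T else {s \<in> T. norm (x - s) \<le> kth_dist k x T})"

definition environment :: "nat \<Rightarrow> real^2 \<Rightarrow> (real^2) set \<Rightarrow> (real^2) set" where
  "environment k s T = {x. s \<in> nearest k x T}"

text \<open>In the following, \<open>xs\<close> lists the sites \<open>s\<^sub>1, \<dots>, s\<^sub>n\<close>: the site \<open>s\<^sub>i\<close> is \<open>xs ! (i - 1)\<close>, and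
  \<open>S\<^sub>i\<close> is \<open>set (take i xs)\<close>.\<close>

definition env :: "nat \<Rightarrow> (real^2) list \<Rightarrow> nat \<Rightarrow> (real^2) set" where
  "env k xs i = environment k (xs ! (i - 1)) (set (take i xs))"

definition proxy_set :: "nat \<Rightarrow> real^2 \<Rightarrow> (real^2) list \<Rightarrow> (real^2) set" where
  "proxy_set k x xs = (\<Union>i\<in>{1..length xs}. nearest k x (set (take i xs)))"


section \<open>Complexity of planar arrangements\<close>

text \<open>An arrangement is given by the union \<open>B\<close> of all the boundary curves, here always piecewise
  straight.  Its faces are the connected components of the complement of \<open>B\<close>.  Its vertices are the
  points where \<open>B\<close> is not locally a straight line: the corners of the curves, and the points where
  two curves cross, touch, or begin to overlap.  Its edges are what the vertices leave of \<open>B\<close>, split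
  into connected components; an edge may be a segment, a ray or an entire line, and overlapping
  pieces of different curves form one edge.\<close>

definition locally_straight :: "(real^2) set \<Rightarrow> real^2 \<Rightarrow> bool" where
  "locally_straight B p \<longleftrightarrow>
     (\<exists>v r. v \<noteq> 0 \<and> r > 0 \<and> B \<inter> ball p r = range (\<lambda>t::real. p + t *\<^sub>R v) \<inter> ball p r)"

definition arr_vertices :: "(real^2) set \<Rightarrow> (real^2) set" where
  "arr_vertices B = {p \<in> B. \<not> locally_straight B p}"

definition arr_edges :: "(real^2) set \<Rightarrow> (real^2) set set" where
  "arr_edges B = components (B - arr_vertices B)"

definition arr_faces :: "(real^2) set \<Rightarrow> (real^2) set set" where
  "arr_faces B = components (- B)"

text \<open>Counting with \<open>count_space\<close> makes the complexity of an infinite arrangement \<open>\<infinity>\<close>, where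
  \<open>card\<close> would give 0.\<close>

definition arr_complexity :: "(real^2) set \<Rightarrow> ennreal" where
  "arr_complexity B =
     emeasure (count_space UNIV) (arr_vertices B) +
     emeasure (count_space UNIV) (arr_edges B) +
     emeasure (count_space UNIV) (arr_faces B)"

definition overlay_complexity :: "nat \<Rightarrow> (real^2) list \<Rightarrow> ennreal" where
  "overlay_complexity k xs = arr_complexity (\<Union>i\<in>{1..length xs}. frontier (env k xs i))"

text \<open>The curves of the proxy diagram are the boundaries of the classes of points with the same
  proxy set \<open>A\<close>.\<close>

definition proxy_diagram_complexity :: "nat \<Rightarrow> (real^2) list \<Rightarrow> ennreal" where
  "proxy_diagram_complexity k xs = arr_complexity (\<Union>A. frontier {x. proxy_set k x xs = A})"

end

theory Submission
  imports Defs
begin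

text \<open>The sample orders the sites uniformly at random, so everything reduces to an average over the
  permutations of \<open>S\<close>.  The boundary of an environment is a polygonal curve that each ray from its
  site meets at most once.  Hence edges and faces of the overlay are bounded by the incidences between
  vertices and boundaries, and a vertex arises either from a shallow circle through three sites or
  from two crossing bisectors, each shallow for its own site.

  Colouring the sites at random with \<open>8 k\<close> colours and keeping one or two colour classes (the
  Clarkson--Shor technique) turns shallow into empty, at the price of a factor of order \<open>k^3\<close> for
  three sites and \<open>k^4\<close> for four.  For \<open>k = 1\<close> every crossing of two Voronoi diagrams is the extreme
  point, in a fixed generic direction, of exactly one cell of their overlay.  If the cells of \<open>u\<close> and
  \<open>v\<close> overlap, then \<open>u\<close> and \<open>v\<close> are Delaunay neighbours once one of them is added to the sites
  of the other, so by exchangeability the overlay of random samples of \<open>i\<close> and \<open>l\<close> sites has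
  \<open>O(i + l)\<close> cells on average.  Backwards analysis divides this by \<open>i l\<close>, and summing over \<open>i\<close>
  and \<open>l\<close> yields \<open>O(n log n)\<close>.\<close>

section \<open>Voronoi vertices and Delaunay pairs\<close>

text \<open>The sites are fixed by an adversary and general position is not assumed, so many sites
  may be cocircular and many bisectors may pass through one point. This shapes the definitions:
  Delaunay pairs and crossings demand that all further sites be strictly farther, which keeps their
  number linear. Extra ties at a crossing are coloured away, or the crossing is moved to an earlier
  site of the same circle that has only two ties. The exponents count the sites that must receive a
  prescribed colour, each with probability \<open>1 / (8 * k)\<close>. At most \<open>2 * k\<close>
  further sites can spoil a crossing, and they must avoid two colours; among \<open>8 * k\<close>
  colours this succeeds with probability at least 1/2. The dimension and the distributions enter
  only through exchangeability and the absence of ties, so the constant does not depend on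
  \<open>d\<close>.\<close>

lemma inner2: "x \<bullet> y = x$1 * y$1 + x$2 * y$2" for x y :: "real^2"
  by (simp add: inner_vec_def UNIV_2)

lemma eq2_iff: "x = y \<longleftrightarrow> x$1 = y$1 \<and> x$2 = y$2" for x y :: "'a^2"
  by (simp add: vec_eq_iff forall_2)

definition cross2 :: "real^2 \<Rightarrow> real^2 \<Rightarrow> real" where
  "cross2 a b = a$1 * b$2 - a$2 * b$1"

definition perp :: "real^2 \<Rightarrow> real^2" where
  "perp w = vector [- w$2, w$1]"

lemma perp_nth [simp]: "perp w $ 1 = - w$2" "perp w $ 2 = w$1"
  by (simp_all add: perp_def)

lemma cross2_commute: "cross2 b a = - cross2 a b"
  by (simp add: cross2_def)

text \<open>The left side is orthogonal to \<open>w\<close>, hence a multiple of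
  \<open>perp w\<close>. The identity expands \<open>perp w\<close> in the normals \<open>a\<close>
  and \<open>b\<close>, with the signs of the coefficients readable from
  \<open>w \<bullet> a\<close>, \<open>w \<bullet> b\<close> and the determinant.\<close>

lemma perp_decomp: "(w \<bullet> b) *\<^sub>R a - (w \<bullet> a) *\<^sub>R b = - cross2 a b *\<^sub>R perp w"
  by (simp add: eq2_iff inner2 cross2_def algebra_simps)

lemma inner_zero_cross2:
  assumes "cross2 a b \<noteq> 0" "z \<bullet> a = 0" "z \<bullet> b = 0"
  shows "z = 0"
proof -
  have "cross2 a b * z$1 = (z \<bullet> a) * b$2 - (z \<bullet> b) * a$2"
    "cross2 a b * z$2 = (z \<bullet> b) * a$1 - (z \<bullet> a) * b$1"
    by (simp_all add: inner2 cross2_def algebra_simps)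
  with assms show ?thesis by (simp add: eq2_iff)
qed

lemma cross2_solve:
  assumes "cross2 a b \<noteq> 0"
  shows "\<exists>z. z \<bullet> a = \<alpha> \<and> z \<bullet> b = \<beta>"
proof -
  define z :: "real^2" where
    "z = vector [(\<alpha> * b$2 - \<beta> * a$2) / cross2 a b, (\<beta> * a$1 - \<alpha> * b$1) / cross2 a b]"
  have "z \<bullet> a = \<alpha>" "z \<bullet> b = \<beta>"
    using assms unfolding z_def inner2 by (simp_all add: field_simps) (simp_all add: cross2_def algebra_simps)
  then show ?thesis by blast
qed

text \<open>The difference of the squared distances to \<open>s\<close> and \<open>u\<close> is
  affine in \<open>x\<close> and vanishes at \<open>p\<close>. Comparing distances thus means asking
  on which side of the line through \<open>p\<close> with normal \<open>u - s\<close> the point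
  lies.\<close>

lemma norm_less_iff_inner:
  fixes x p :: "'a::real_inner"
  assumes "norm (p - s) = norm (p - u)"
  shows "norm (x - u) < norm (x - s) \<longleftrightarrow> (x - p) \<bullet> (u - s) > 0"
    and "norm (x - u) \<le> norm (x - s) \<longleftrightarrow> (x - p) \<bullet> (u - s) \<ge> 0"
    and "norm (x - u) = norm (x - s) \<longleftrightarrow> (x - p) \<bullet> (u - s) = 0"
proof -
  have *: "(norm (x - s))\<^sup>2 - (norm (x - u))\<^sup>2 = 2 * ((x - p) \<bullet> (u - s))"
  proof -
    have "(norm (p - s))\<^sup>2 = (norm (p - u))\<^sup>2" using assms by simp
    then show ?thesis
      unfolding power2_norm_eq_inner by (simp add: inner_diff_left inner_diff_right inner_commute algebra_simps)
  qed
  have lt: "norm (x - u) < norm (x - s) \<longleftrightarrow> (norm (x - u))\<^sup>2 < (norm (x - s))\<^sup>2"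
    by (meson norm_ge_zero pos2 power_mono_iff linorder_not_le)
  have le: "norm (x - u) \<le> norm (x - s) \<longleftrightarrow> (norm (x - u))\<^sup>2 \<le> (norm (x - s))\<^sup>2"
    by (simp add: power_mono_iff)
  show 1: "norm (x - u) < norm (x - s) \<longleftrightarrow> (x - p) \<bullet> (u - s) > 0" using * lt by linarith
  show 2: "norm (x - u) \<le> norm (x - s) \<longleftrightarrow> (x - p) \<bullet> (u - s) \<ge> 0" using * le by linarith
  show "norm (x - u) = norm (x - s) \<longleftrightarrow> (x - p) \<bullet> (u - s) = 0" using 1 2 by linarith
qed

text \<open>A line meets a circle in at most two points.\<close>

lemma cross2_cocircular:
  assumes "norm (p - s) = norm (p - a)" "norm (p - s) = norm (p - b)" "a \<noteq> s" "b \<noteq> s" "a \<noteq> b"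
  shows "cross2 (a - s) (b - s) \<noteq> 0"
proof
  assume c: "cross2 (a - s) (b - s) = 0"
  define z where "z = p - s"
  define A where "A = a - s"
  define B where "B = b - s"
  \<comment> \<open>The assumption puts \<open>X\<close> on the circle about \<open>z\<close>
    through the origin, and this is the equation of that circle.\<close>
  have two: "2 * (z \<bullet> X) = X \<bullet> X" if "norm z = norm (z - X)" for X
  proof -
    have "(norm (z - X))\<^sup>2 = (norm z)\<^sup>2 - 2 * (z \<bullet> X) + X \<bullet> X"
      unfolding power2_norm_eq_inner by (simp add: inner_diff_left inner_diff_right inner_commute)
    with that show ?thesis by simp
  qed
  have zA: "2 * (z \<bullet> A) = A \<bullet> A" and zB: "2 * (z \<bullet> B) = B \<bullet> B"
    by (rule two; use assms in \<open>simp add: z_def A_def B_def\<close>)+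
  have nz: "A \<noteq> 0" "B \<noteq> 0" using assms by (auto simp: A_def B_def)
  have c': "A$1 * B$2 = A$2 * B$1" using c unfolding A_def[symmetric] B_def[symmetric] cross2_def by simp
  have "\<exists>t. B = t *\<^sub>R A"
  proof (cases "A$1 = 0")
    case True
    with nz have "A$2 \<noteq> 0" by (auto simp: eq2_iff)
    moreover from this c' True have "B$1 = 0" by simp
    ultimately show ?thesis using True by (intro exI[of _ "B$2 / A$2"]) (simp add: eq2_iff)
  next
    case False
    then show ?thesis using c' by (intro exI[of _ "B$1 / A$1"]) (simp add: eq2_iff field_simps)
  qed
  then obtain t where t: "B = t *\<^sub>R A" by blast
  have "t * (A \<bullet> A) = t * t * (A \<bullet> A)"
  proof -
    have "t * (A \<bullet> A) = t * (2 * (z \<bullet> A))" by (simp only: zA)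
    also have "\<dots> = 2 * (z \<bullet> B)" by (simp add: t)
    also have "\<dots> = t * t * (A \<bullet> A)" unfolding zB by (simp add: t)
    finally show ?thesis .
  qed
  with nz have "t = 0 \<or> t = 1" by simp
  with t nz have "B = A" by auto
  then show False using assms by (simp add: A_def B_def)
qed

text \<open>Each pair of sites excludes one slope, so all but finitely many slopes separate
  \<open>S\<close>. The left-to-right order obtained in this way replaces general position.\<close>

lemma ex_generic_functional:
  fixes S :: "(real^2) set"
  assumes "finite S"
  shows "\<exists>w. inj_on (inner w) S"
proof -
  define bad where "bad = (\<lambda>(s,t). - (s$1 - t$1) / (s$2 - t$2)) ` (S \<times> S)"
  have "finite bad" using assms by (simp add: bad_def)
  then obtain m where m: "m \<notin> bad"
    using ex_new_if_finite infinite_UNIV_char_0 by blast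
  have "inj_on (inner (vector [1, m])) S"
  proof (rule inj_onI)
    fix s t assume st: "s \<in> S" "t \<in> S" and "vector [1, m] \<bullet> s = vector [1, m] \<bullet> t"
    then have e: "(s$1 - t$1) + m * (s$2 - t$2) = 0" by (simp add: inner2 algebra_simps)
    show "s = t"
    proof (cases "s$2 = t$2")
      case True with e show ?thesis by (simp add: eq2_iff)
    next
      case False
      then have "m = - (s$1 - t$1) / (s$2 - t$2)" using e by (simp add: field_simps)
      with st have "m \<in> bad" by (auto simp: bad_def)
      with m show ?thesis by simp
    qed
  qed
  then show ?thesis by blast
qed

section \<open>Voronoi cells, their vertices and their Delaunay pairs\<close>

definition vcell :: "(real^2) set \<Rightarrow> real^2 \<Rightarrow> (real^2) set" where
  "vcell R s = {x. \<forall>u\<in>R. norm (x - s) \<le> norm (x - u)}"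

definition scell :: "(real^2) set \<Rightarrow> real^2 \<Rightarrow> (real^2) set" where
  "scell R s = {x. \<forall>u\<in>R - {s}. norm (x - s) < norm (x - u)}"

lemma vcell_inner_le:
  assumes "x \<in> vcell R s" "u \<in> R" "norm (p - s) = norm (p - u)"
  shows "(x - p) \<bullet> (u - s) \<le> 0"
  using assms norm_less_iff_inner(1)[OF assms(3), of x] by (force simp: vcell_def)

text \<open>Both points are apexes of wedges, with normals \<open>a\<close>, \<open>b\<close> and \<open>a'\<close>, \<open>b'\<close>, that are extreme in
  the same one of the directions \<open>perp w\<close> and \<open>- perp w\<close>.\<close>

lemma apex_unique:
  assumes "cross2 a b \<noteq> 0" "cross2 a' b' \<noteq> 0"
    and "w \<bullet> a < 0" "w \<bullet> b > 0" "w \<bullet> a' < 0" "w \<bullet> b' > 0"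
    and "cross2 a b > 0 \<longleftrightarrow> cross2 a' b' > 0"
    and le: "(q - p) \<bullet> a \<le> 0" "(q - p) \<bullet> b \<le> 0" "(p - q) \<bullet> a' \<le> 0" "(p - q) \<bullet> b' \<le> 0"
  shows "p = q"
proof -
  define z where "z = q - p"
  have z': "p - q = - z" by (simp add: z_def)
  have 1: "(w \<bullet> b) * (z \<bullet> a) - (w \<bullet> a) * (z \<bullet> b) = - cross2 a b * (z \<bullet> perp w)" for a b
    using arg_cong[OF perp_decomp[of w b a], of "inner z"] by (simp add: inner_diff_right)
  have t: "(w \<bullet> b) * (z \<bullet> a) \<le> 0" "- (w \<bullet> a) * (z \<bullet> b) \<le> 0"
    using assms by (simp_all add: z_def mult_nonneg_nonpos mult_nonpos_nonpos mult_nonpos_nonneg)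
  have t': "(w \<bullet> b') * (z \<bullet> a') \<ge> 0" "- (w \<bullet> a') * (z \<bullet> b') \<ge> 0"
    using assms unfolding z' by (simp_all add: mult_nonneg_nonneg mult_nonpos_nonneg)
  from 1[of b a] t have A: "cross2 a b * (z \<bullet> perp w) \<ge> 0" by linarith
  from 1[of b' a'] t' have B: "cross2 a' b' * (z \<bullet> perp w) \<le> 0" by linarith
  \<comment> \<open>\<open>A\<close> and \<open>B\<close> bound the component of \<open>z\<close>
    along \<open>perp w\<close> from opposite sides, because the determinants have the same sign.
    The two nonpositive terms in \<open>t\<close> then sum to zero, so each of them is zero.\<close>
  have "z \<bullet> perp w = 0"
    using A B assms(1,2,7) by (smt (verit) mult_neg_neg mult_neg_pos mult_pos_neg mult_pos_pos)
  with 1[of b a] t have "(w \<bullet> b) * (z \<bullet> a) = 0" "- (w \<bullet> a) * (z \<bullet> b) = 0" by auto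
  with assms have "z \<bullet> a = 0" "z \<bullet> b = 0" by auto
  with assms(1) have "z = 0" by (rule inner_zero_cross2)
  then show ?thesis by (simp add: z_def)
qed

text \<open>A Voronoi vertex counts once for every site on its empty circle, so a degenerate vertex
  counts with its degree.\<close>

definition vvert :: "(real^2) set \<Rightarrow> ((real^2) \<times> (real^2)) set" where
  "vvert R = {(p, s). s \<in> R \<and> p \<in> vcell R s \<and> card {u\<in>R. norm (p - u) = norm (p - s)} \<ge> 3}"

lemma card_Un_le_add: "card X \<le> a \<Longrightarrow> card Y \<le> b \<Longrightarrow> card (X \<union> Y) \<le> a + b"
  by (rule order.trans[OF card_Un_le add_mono])

text \<open>The charging principle behind most counts below: picking a charged element for every
  \<open>x\<close> is injective because no element is charged twice.\<close>

lemma card_le_witness: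
  assumes "finite B" "\<And>x. x \<in> A \<Longrightarrow> \<exists>y\<in>B. P x y"
    and "\<And>x x' y. x \<in> A \<Longrightarrow> x' \<in> A \<Longrightarrow> P x y \<Longrightarrow> P x' y \<Longrightarrow> x = x'"
  shows "finite A \<and> card A \<le> card B"
proof -
  obtain f where f: "\<And>x. x \<in> A \<Longrightarrow> f x \<in> B \<and> P x (f x)" using assms(2) by metis
  have "inj_on f A" using f assms(3) by (metis inj_onI)
  moreover have "f ` A \<subseteq> B" using f by blast
  ultimately show ?thesis using assms(1) card_inj_on_le inj_on_finite by blast
qed

text \<open>For these pairs \<open>p\<close> is the extreme point of the Voronoi cell of \<open>s\<close> in direction \<open>perp w\<close> or
  \<open>- perp w\<close>, depending on \<open>b\<close>.\<close>

definition apexes :: "real^2 \<Rightarrow> (real^2) set \<Rightarrow> bool \<Rightarrow> ((real^2) \<times> (real^2)) set" where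
  "apexes w R b = {(p, s). s \<in> R \<and> p \<in> vcell R s \<and> (\<exists>l\<in>R. \<exists>r\<in>R.
      norm (p - s) = norm (p - l) \<and> norm (p - s) = norm (p - r) \<and>
      w \<bullet> l < w \<bullet> s \<and> w \<bullet> s < w \<bullet> r \<and> (cross2 (l - s) (r - s) > 0 \<longleftrightarrow> b))}"

lemma apexes_unique:
  assumes "(p, s) \<in> apexes w R b" "(q, s) \<in> apexes w R b"
  shows "p = q"
proof -
  from assms obtain l r l' r' where s: "s \<in> R" "p \<in> vcell R s" "q \<in> vcell R s"
    and l: "l \<in> R" "r \<in> R" "norm (p - s) = norm (p - l)" "norm (p - s) = norm (p - r)"
      "w \<bullet> l < w \<bullet> s" "w \<bullet> s < w \<bullet> r" "cross2 (l - s) (r - s) > 0 \<longleftrightarrow> b"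
    and l': "l' \<in> R" "r' \<in> R" "norm (q - s) = norm (q - l')" "norm (q - s) = norm (q - r')"
      "w \<bullet> l' < w \<bullet> s" "w \<bullet> s < w \<bullet> r'" "cross2 (l' - s) (r' - s) > 0 \<longleftrightarrow> b"
    unfolding apexes_def by blast
  show "p = q"
  proof (rule apex_unique[where w = w])
    show "cross2 (l - s) (r - s) \<noteq> 0" using l by (intro cross2_cocircular) auto
    show "cross2 (l' - s) (r' - s) \<noteq> 0" using l' by (intro cross2_cocircular) auto
    show "(cross2 (l - s) (r - s) > 0) = (cross2 (l' - s) (r' - s) > 0)"
      using l l' by simp
  qed (use s l l' in \<open>auto simp: inner_diff_right[of w] intro!: vcell_inner_le\<close>)
qed

lemma card_apexes_le:
  assumes "finite R"
  shows "finite (apexes w R b) \<and> card (apexes w R b) \<le> card R"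
proof (rule card_le_witness[OF assms, where P = "\<lambda>x s. s = snd x"])
  fix x x' y assume "x \<in> apexes w R b" "x' \<in> apexes w R b" "y = snd x" "y = snd x'"
  then show "x = x'" by (metis apexes_unique prod.collapse)
qed (auto simp: apexes_def)

lemma apexesI:
  assumes "s \<in> R" "p \<in> vcell R s" "l \<in> R" "r \<in> R"
    "norm (p - s) = norm (p - l)" "norm (p - s) = norm (p - r)" "w \<bullet> l < w \<bullet> s" "w \<bullet> s < w \<bullet> r"
  shows "(p, s) \<in> apexes w R True \<union> apexes w R False"
  using assms by (cases "cross2 (l - s) (r - s) > 0") (auto simp: apexes_def)

lemma vcell_tied:
  assumes "p \<in> vcell R s" "norm (p - s) = norm (p - u)"
  shows "p \<in> vcell R u"
  using assms by (auto simp: vcell_def)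

text \<open>Of the sites on an empty circle all but the leftmost and the rightmost give rise to an apex.\<close>

lemma card_vvert_le:
  assumes "finite R"
  shows "card (vvert R) \<le> 6 * card R" and "finite (vvert R)"
proof -
  obtain w where w: "inj_on (inner w) R"
    using ex_generic_functional[OF assms] by blast
  define Mid where "Mid = apexes w R True \<union> apexes w R False"
  have fMid: "finite Mid" and cMid: "card Mid \<le> 2 * card R"
    using card_apexes_le[OF assms, of w True] card_apexes_le[OF assms, of w False]
      card_Un_le[of "apexes w R True" "apexes w R False"] by (auto simp: Mid_def)
  have MidI: "(p, s) \<in> Mid" if "s \<in> R" "p \<in> vcell R s" "l \<in> R" "r \<in> R"
      "norm (p - s) = norm (p - l)" "norm (p - s) = norm (p - r)" "w \<bullet> l < w \<bullet> s" "w \<bullet> s < w \<bullet> r" for p s l r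
    using apexesI[OF that] by (simp add: Mid_def)
  \<comment> \<open>\<open>E True\<close> collects the leftmost and \<open>E False\<close> the
    rightmost site of each circle. Within either set the centre determines the site, so both are
    bounded by the number of centres occurring in \<open>Mid\<close>.\<close>
  define E where "E b = {(p, s) \<in> vvert R. \<forall>u\<in>R. norm (p - u) = norm (p - s) \<longrightarrow> u \<noteq> s \<longrightarrow>
     (if b then w \<bullet> u > w \<bullet> s else w \<bullet> u < w \<bullet> s)}" for b
  have three: "\<exists>x\<in>R. \<exists>y\<in>R. x \<noteq> s \<and> y \<noteq> s \<and> x \<noteq> y \<and> norm (p - s) = norm (p - x) \<and> norm (p - s) = norm (p - y)"
    if "(p, s) \<in> vvert R" for p s
  proof -
    let ?C = "{u\<in>R. norm (p - u) = norm (p - s)}"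
    have "card ?C \<ge> 3" "s \<in> ?C" using that by (auto simp: vvert_def)
    then have "card (?C - {s}) \<ge> 2" using assms by simp
    then obtain T where "T \<subseteq> ?C - {s}" "card T = 2" by (meson obtain_subset_with_card_n)
    then obtain x y where "{x, y} \<subseteq> ?C - {s}" "x \<noteq> y" by (auto simp: card_2_iff)
    then show ?thesis by (intro bexI[of _ x] bexI[of _ y]) auto
  qed
  have cover: "vvert R \<subseteq> Mid \<union> (E True \<union> E False)"
  proof
    fix x assume x: "x \<in> vvert R"
    obtain p s where xe: "x = (p, s)" by (cases x)
    have ps: "(p, s) \<in> vvert R" using x xe by simp
    show "x \<in> Mid \<union> (E True \<union> E False)"
    proof (rule ccontr)
      assume no: "x \<notin> Mid \<union> (E True \<union> E False)"
      then obtain l r where lr: "l \<in> R" "norm (p - l) = norm (p - s)" "l \<noteq> s" "\<not> w \<bullet> l > w \<bullet> s"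
        "r \<in> R" "norm (p - r) = norm (p - s)" "r \<noteq> s" "\<not> w \<bullet> r < w \<bullet> s" using ps by (auto simp: E_def xe)
      moreover have "w \<bullet> l \<noteq> w \<bullet> s" "w \<bullet> r \<noteq> w \<bullet> s"
        using lr ps w by (auto simp: vvert_def inj_on_def)
      ultimately have "(p, s) \<in> Mid"
        using ps by (intro MidI[of s p l r]) (auto simp: vvert_def)
      with no xe show False by simp
    qed
  qed
  have Esub: "fst ` E b \<subseteq> fst ` Mid" for b
  proof clarsimp
    fix p s assume e: "(p, s) \<in> E b"
    then have ps: "(p, s) \<in> vvert R" by (simp add: E_def)
    then have s: "s \<in> R" "p \<in> vcell R s" by (auto simp: vvert_def)
    from three[OF ps] obtain x y where xy: "x \<in> R" "y \<in> R" "x \<noteq> s" "y \<noteq> s" "x \<noteq> y"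
      "norm (p - s) = norm (p - x)" "norm (p - s) = norm (p - y)" by blast
    have ne: "w \<bullet> x \<noteq> w \<bullet> y" using xy w by (auto simp: inj_on_def)
    have side: "if b then w \<bullet> x > w \<bullet> s \<and> w \<bullet> y > w \<bullet> s else w \<bullet> x < w \<bullet> s \<and> w \<bullet> y < w \<bullet> s"
      using e xy by (auto simp: E_def)
    \<comment> \<open>As \<open>x\<close> and \<open>y\<close> lie on the same side of
      \<open>s\<close>, the one nearer to \<open>s\<close> in direction \<open>w\<close> is strictly
      between \<open>s\<close> and the other.\<close>
    have "(p, x) \<in> Mid \<or> (p, y) \<in> Mid"
    proof (cases "b = (w \<bullet> x < w \<bullet> y)")
      case True
      then have "(p, x) \<in> Mid"
        using side ne xy s vcell_tied[OF s(2)] by (cases b) (auto intro: MidI[of x p s y] MidI[of x p y s])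
      then show ?thesis ..
    next
      case False
      then have "(p, y) \<in> Mid"
        using side ne xy s vcell_tied[OF s(2)] by (cases b) (auto intro: MidI[of y p s x] MidI[of y p x s])
      then show ?thesis ..
    qed
    then show "p \<in> fst ` Mid" by force
  qed
  have Einj: "inj_on fst (E b)" for b
  proof (rule inj_onI, clarsimp)
    fix p s t assume e: "(p, s) \<in> E b" "(p, t) \<in> E b"
    then have "norm (p - s) = norm (p - t)" "s \<in> R" "t \<in> R"
      by (auto simp: E_def vvert_def vcell_def intro: antisym)
    with e show "s = t" by (cases b; force simp: E_def)
  qed
  have fE: "finite (E b)" for b
    using inj_on_finite[OF Einj Esub] fMid by blast
  have cE: "card (E b) \<le> 2 * card R" for b
    using card_inj_on_le[OF Einj Esub finite_imageI[OF fMid], of b] card_image_le[OF fMid, of fst] cMid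
    by linarith
  have f: "finite (Mid \<union> (E True \<union> E False))" using fMid fE by simp
  have "card (vvert R) \<le> card (Mid \<union> (E True \<union> E False))" by (rule card_mono[OF f cover])
  also have "\<dots> \<le> card Mid + (card (E True) + card (E False))"
    by (meson card_Un_le add_left_mono le_trans)
  finally show "card (vvert R) \<le> 6 * card R" using cMid cE[of True] cE[of False] by linarith
  show "finite (vvert R)" by (rule finite_subset[OF cover f])
qed

text \<open>Requiring all other sites to be strictly farther keeps the number of pairs linear even when
  many sites are cocircular.\<close>

definition sdel :: "(real^2) set \<Rightarrow> ((real^2) \<times> (real^2)) set" where
  "sdel R = {(s, t). s \<in> R \<and> t \<in> R \<and> s \<noteq> t \<and>
     (\<exists>y. norm (y - s) = norm (y - t) \<and> (\<forall>u\<in>R - {s, t}. norm (y - s) < norm (y - u)))}"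

lemma sdel_sym: "(s, t) \<in> sdel R \<Longrightarrow> (t, s) \<in> sdel R"
  unfolding sdel_def by (force simp: insert_commute)

text \<open>Follow the bisector of \<open>s\<close> and \<open>t\<close> upwards until it leaves their cells.\<close>

lemma sdel_upper_end:
  assumes R: "finite R" and st: "(s, t) \<in> sdel R"
    and r0: "r0 \<in> R" "cross2 (t - s) (r0 - s) > 0"
  shows "\<exists>p. p \<in> vcell R s \<and> norm (p - s) = norm (p - t) \<and>
    (\<exists>r\<in>R - {s, t}. norm (p - s) = norm (p - r)) \<and>
    (\<forall>u\<in>R - {s, t}. norm (p - s) = norm (p - u) \<longrightarrow> cross2 (t - s) (u - s) > 0)"
proof -
  from st obtain y where y: "norm (y - s) = norm (y - t)" "\<And>u. u \<in> R - {s, t} \<Longrightarrow> norm (y - s) < norm (y - u)"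
    unfolding sdel_def by blast
  define v where "v = perp (t - s)"
  have v: "v \<bullet> z = cross2 (t - s) z" for z by (simp add: v_def inner2 cross2_def algebra_simps)
  define c where "c u = (norm (y - u))\<^sup>2 - (norm (y - s))\<^sup>2" for u
  have cpos: "c u > 0" if "u \<in> R - {s, t}" for u
    using y(2)[OF that] by (simp add: c_def power_strict_mono)
  have move: "(norm (y + a *\<^sub>R v - u))\<^sup>2 - (norm (y + a *\<^sub>R v - s))\<^sup>2 = c u - 2 * a * cross2 (t - s) (u - s)" for a u
    unfolding v[symmetric] c_def power2_norm_eq_inner
    by (simp add: inner_diff_left inner_diff_right inner_add_left inner_add_right inner_commute algebra_simps)
  define P where "P = {u \<in> R. cross2 (t - s) (u - s) > 0}"
  have P: "finite P" "P \<noteq> {}" using R r0 by (auto simp: P_def)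
  have Pst: "P \<subseteq> R - {s, t}" by (auto simp: P_def cross2_def)
  \<comment> \<open>\<open>f u\<close> is the time at which the point moving along the bisector
    becomes as close to \<open>u\<close> as to \<open>s\<close>. The earliest such time over the
    sites \<open>P\<close> above the line through \<open>s\<close> and \<open>t\<close> ends the
    Voronoi edge.\<close>
  define f where "f u = c u / (2 * cross2 (t - s) (u - s))" for u
  define a where "a = Min (f ` P)"
  have "a \<in> f ` P" unfolding a_def using P by (intro Min_in) auto
  then obtain r where r: "r \<in> P" "a = f r" by blast
  have amin: "a \<le> f u" if "u \<in> P" for u using P that by (simp add: a_def)
  have apos: "a > 0" using r cpos[of r] Pst by (auto simp: f_def P_def intro!: divide_pos_pos)
  define p where "p = y + a *\<^sub>R v"
  have move': "(norm (p - u))\<^sup>2 - (norm (p - s))\<^sup>2 = c u - 2 * a * cross2 (t - s) (u - s)" for u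
    using move[of a u] by (simp add: p_def)
  have eq_iff: "norm (p - s) = norm (p - u) \<longleftrightarrow> c u = 2 * a * cross2 (t - s) (u - s)" for u
  proof -
    have "norm (p - s) = norm (p - u) \<longleftrightarrow> (norm (p - s))\<^sup>2 = (norm (p - u))\<^sup>2"
      by (metis norm_ge_zero power2_eq_iff_nonneg)
    then show ?thesis using move'[of u] by linarith
  qed
  have le_iff: "norm (p - s) \<le> norm (p - u) \<longleftrightarrow> c u \<ge> 2 * a * cross2 (t - s) (u - s)" for u
  proof -
    have "norm (p - s) \<le> norm (p - u) \<longleftrightarrow> (norm (p - s))\<^sup>2 \<le> (norm (p - u))\<^sup>2"
      by (metis abs_le_square_iff abs_norm_cancel)
    then show ?thesis using move'[of u] by linarith
  qed
  have cell: "norm (p - s) \<le> norm (p - u)" if "u \<in> R" for u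
  proof (cases "u \<in> P")
    case True
    then show ?thesis using amin[OF True] unfolding le_iff by (simp add: f_def P_def field_simps)
  next
    case False
    with that have "cross2 (t - s) (u - s) \<le> 0" by (auto simp: P_def)
    then have "2 * a * cross2 (t - s) (u - s) \<le> 0" using apos by (simp add: mult_nonneg_nonpos)
    moreover have "c u \<ge> 0"
      using cpos[of u] that y(1) by (cases "u \<in> {s, t}") (auto simp: c_def less_imp_le)
    ultimately show ?thesis unfolding le_iff by linarith
  qed
  have pt: "norm (p - s) = norm (p - t)"
    unfolding eq_iff using y(1) by (simp add: c_def cross2_def)
  have pr: "norm (p - s) = norm (p - r)" using r by (auto simp: eq_iff f_def P_def)
  have up: "cross2 (t - s) (u - s) > 0" if "u \<in> R - {s, t}" "norm (p - s) = norm (p - u)" for u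
    using that cpos[of u] apos by (auto simp: eq_iff zero_less_mult_iff)
  have r2: "r \<in> R - {s, t}" using r Pst by blast
  show ?thesis
  proof (intro exI conjI)
    show "p \<in> vcell R s" using cell by (simp add: vcell_def)
    show "\<exists>r\<in>R - {s, t}. norm (p - s) = norm (p - r)" using r2 pr by blast
  qed (use pt up in auto)
qed

text \<open>If \<open>t\<close> lay between \<open>s\<close> and \<open>t'\<close>, convexity of the
  norm would put it into every closed disk with \<open>s\<close> and \<open>t'\<close> on its
  boundary, against the strict inequality in \<open>sdel\<close>.\<close>

lemma sdel_collinear:
  assumes "(s, t) \<in> sdel R" "(s, t') \<in> sdel R" "w \<bullet> s < w \<bullet> t" "w \<bullet> s < w \<bullet> t'"
    and c: "cross2 (t - s) (t' - s) = 0"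
  shows "t = t'"
proof -
  have 1: "t = t'" if h: "(s, t') \<in> sdel R" "t \<in> R" "w \<bullet> s < w \<bullet> t" "w \<bullet> t \<le> w \<bullet> t'"
    "cross2 (t - s) (t' - s) = 0" for t t'
  proof (rule ccontr)
    assume ne: "t \<noteq> t'"
    have wpos: "w \<bullet> (t' - s) > 0" using h by (simp add: inner_diff_right)
    define a where "a = (w \<bullet> (t - s)) / (w \<bullet> (t' - s))"
    have a: "0 < a" "a \<le> 1" using h wpos by (auto simp: a_def inner_diff_right)
    have "(w \<bullet> (t' - s)) *\<^sub>R (t - s) = (w \<bullet> (t - s)) *\<^sub>R (t' - s)"
      using perp_decomp[of w "t' - s" "t - s"] h(5) by simp
    then have "t - s = a *\<^sub>R (t' - s)"
      using wpos by (simp add: a_def eq2_iff field_simps)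
    then have t: "t = s + a *\<^sub>R (t' - s)" by (simp add: algebra_simps)
    from h(1) obtain y where y: "norm (y - s) = norm (y - t')" "\<And>u. u \<in> R - {s, t'} \<Longrightarrow> norm (y - s) < norm (y - u)"
      unfolding sdel_def by blast
    have "t \<noteq> s" using h(3) by auto
    then have "norm (y - s) < norm (y - t)" using y(2)[of t] h(2) ne by auto
    moreover have "y - t = (1 - a) *\<^sub>R (y - s) + a *\<^sub>R (y - t')" unfolding t by (simp add: algebra_simps)
    then have "norm (y - t) \<le> (1 - a) * norm (y - s) + a * norm (y - t')"
      using a norm_triangle_ineq[of "(1 - a) *\<^sub>R (y - s)" "a *\<^sub>R (y - t')"] by simp
    ultimately show False using y(1) by (simp add: algebra_simps)
  qed
  have c': "cross2 (t' - s) (t - s) = 0" using c by (simp add: cross2_def algebra_simps)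
  show ?thesis
    using 1[of t' t] 1[of t t'] assms c' by (cases "w \<bullet> t \<le> w \<bullet> t'") (auto simp: sdel_def)
qed

text \<open>A pair is charged to an apex at the upper end of its Voronoi edge: to one of its own sites if
  that one is not extreme on the circle, and to a third site on the circle otherwise.\<close>

lemma card_sdel_le:
  assumes R: "finite R"
  shows "finite (sdel R) \<and> card (sdel R) \<le> 14 * card R"
proof -
  obtain w where w: "inj_on (inner w) R"
    using ex_generic_functional[OF R] by blast
  define UE where "UE p s t \<longleftrightarrow> s \<in> R \<and> t \<in> R \<and> w \<bullet> s < w \<bullet> t \<and> p \<in> vcell R s \<and> norm (p - s) = norm (p - t) \<and>
    (\<exists>r\<in>R - {s, t}. norm (p - s) = norm (p - r)) \<and>
    (\<forall>u\<in>R - {s, t}. norm (p - s) = norm (p - u) \<longrightarrow> cross2 (t - s) (u - s) > 0)" for p s t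
  \<comment> \<open>Two right ends for the same \<open>p\<close> and \<open>s\<close> would each lie
    counterclockwise of the other as seen from \<open>s\<close>.\<close>
  have UEt: "t = t'" if "UE p s t" "UE p s t'" for p s t t'
  proof (rule ccontr)
    assume "t \<noteq> t'"
    then have "cross2 (t - s) (t' - s) > 0" "cross2 (t' - s) (t - s) > 0"
      using that unfolding UE_def by (metis DiffI insertE order_less_irrefl singletonD)+
    then show False using cross2_commute[of "t - s" "t' - s"] by linarith
  qed
  have UEs: "s = s'" if "UE p s t" "UE p s' t" for p s s' t
  proof (rule ccontr)
    assume "s \<noteq> s'"
    then have "cross2 (t - s) (s' - s) > 0" "cross2 (t - s') (s - s') > 0"
      using that unfolding UE_def by (metis DiffI insertE order_less_irrefl singletonD)+
    then show False by (simp add: cross2_def algebra_simps)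
  qed
  define Mid where "Mid = apexes w R True \<union> apexes w R False"
  define A where "A b = {(s, t). \<exists>p. UE p s t \<and> (p, s) \<in> apexes w R b}" for b
  define B where "B b = {(s, t). \<exists>p. UE p s t \<and> (p, t) \<in> apexes w R b}" for b
  \<comment> \<open>Charges to a third site \<open>r\<close>: with neither \<open>s\<close> nor
    \<open>t\<close> an apex at \<open>p\<close>, these two are the leftmost and the rightmost site
    on the circle, so \<open>p\<close> alone determines the pair.\<close>
  define C where "C b = {(s, t). \<exists>p r. UE p s t \<and> (p, r) \<in> apexes w R b \<and> (p, s) \<notin> Mid \<and> (p, t) \<notin> Mid}" for b
  define L where "L = {(s, t) \<in> sdel R. w \<bullet> s < w \<bullet> t}"
  \<comment> \<open>No site lies above the line through \<open>s\<close> and \<open>t\<close>, so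
    the upper part of the edge is unbounded. Two such pairs with the same \<open>s\<close> are
    collinear, which leaves one for each \<open>s\<close>.\<close>
  define N where "N = {(s, t) \<in> L. \<forall>u\<in>R. cross2 (t - s) (u - s) \<le> 0}"
  have cA: "finite (A b) \<and> card (A b) \<le> card R" for b
  proof (rule card_le_witness[OF R, where P = "\<lambda>x y. y = fst x"])
    fix x x' y assume "x \<in> A b" "x' \<in> A b" "y = fst x" "y = fst x'"
    then obtain t t' p p' where x: "x = (y, t)" "x' = (y, t')" and h: "UE p y t" "(p, y) \<in> apexes w R b"
      "UE p' y t'" "(p', y) \<in> apexes w R b" by (cases x; cases x') (auto simp: A_def)
    then show "x = x'" using apexes_unique[OF h(2,4)] UEt by blast
  qed (auto simp: A_def apexes_def)
  have cB: "finite (B b) \<and> card (B b) \<le> card R" for b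
  proof (rule card_le_witness[OF R, where P = "\<lambda>x y. y = snd x"])
    fix x x' y assume "x \<in> B b" "x' \<in> B b" "y = snd x" "y = snd x'"
    then obtain s s' p p' where x: "x = (s, y)" "x' = (s', y)" and h: "UE p s y" "(p, y) \<in> apexes w R b"
      "UE p' s' y" "(p', y) \<in> apexes w R b" by (cases x; cases x') (auto simp: B_def)
    then show "x = x'" using apexes_unique[OF h(2,4)] UEs by blast
  qed (auto simp: B_def apexes_def)
  define PC where "PC b x r \<longleftrightarrow> (\<exists>p. UE p (fst x) (snd x) \<and> (p, r) \<in> apexes w R b \<and> (p, fst x) \<notin> Mid \<and> (p, snd x) \<notin> Mid)" for b x r
  have cC: "finite (C b) \<and> card (C b) \<le> card R" for b
  proof (rule card_le_witness[OF R, where P = "PC b"])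
    fix x assume "x \<in> C b"
    then obtain s t p r where "x = (s, t)" "UE p s t" "(p, r) \<in> apexes w R b" "(p, s) \<notin> Mid" "(p, t) \<notin> Mid"
      unfolding C_def by blast
    moreover have "r \<in> R" using calculation by (simp add: apexes_def)
    ultimately show "\<exists>r\<in>R. PC b x r" by (auto simp: PC_def)
  next
    fix x x' r
    assume "PC b x r" "PC b x' r"
    then obtain s t s' t' p p' where x: "x = (s, t)" "x' = (s', t')" and
      h: "UE p s t" "(p, r) \<in> apexes w R b" "(p, s) \<notin> Mid" "(p, t) \<notin> Mid"
        "UE p' s' t'" "(p', r) \<in> apexes w R b" "(p', s') \<notin> Mid" "(p', t') \<notin> Mid"
      unfolding PC_def by (metis prod.collapse)
    have p: "p' = p" using apexes_unique[OF h(6,2)] .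
    have M: "(p, b) \<in> Mid" if "a \<in> R" "b \<in> R" "c \<in> R" "p \<in> vcell R b" "norm (p - b) = norm (p - a)"
       "norm (p - b) = norm (p - c)" "w \<bullet> a < w \<bullet> b" "w \<bullet> b < w \<bullet> c" for a b c
      using apexesI[of b R p a c] that by (simp add: Mid_def)
    have u: "s \<in> R" "t \<in> R" "w \<bullet> s < w \<bullet> t" "p \<in> vcell R s" "norm (p - s) = norm (p - t)"
      "s' \<in> R" "t' \<in> R" "w \<bullet> s' < w \<bullet> t'" "p \<in> vcell R s'" "norm (p - s') = norm (p - t')"
      using h(1,5) unfolding p UE_def by blast+
    have e: "norm (p - s) = norm (p - s')" using u unfolding vcell_def by (intro antisym) blast+
    have vt: "p \<in> vcell R t" "p \<in> vcell R t'" using u vcell_tied by blast+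
    note nm = h(3,4) h(7,8)[unfolded p]
    have "\<not> w \<bullet> s < w \<bullet> s'" using M[of s s' t'] u e nm by auto
    moreover have "\<not> w \<bullet> s' < w \<bullet> s" using M[of s' s t] u e nm by auto
    ultimately have "s = s'" using w u by (meson inj_onD linorder_less_linear)
    moreover have "\<not> w \<bullet> t < w \<bullet> t'" using M[of s t t'] u e nm vt by auto
    moreover have "\<not> w \<bullet> t' < w \<bullet> t" using M[of s' t' t] u e nm vt by auto
    then have "t = t'" using calculation(2) w u by (meson inj_onD linorder_less_linear)
    ultimately show "x = x'" using x by simp
  qed
  have cN: "finite N \<and> card N \<le> card R"
  proof (rule card_le_witness[OF R, where P = "\<lambda>x y. y = fst x"])
    fix x x' y assume h: "x \<in> N" "x' \<in> N" "y = fst x" "y = fst x'"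
    obtain t t' where x: "x = (y, t)" "x' = (y, t')" using h(3,4) by (metis surjective_pairing)
    have "cross2 (t - y) (t' - y) \<le> 0" "cross2 (t' - y) (t - y) \<le> 0"
      using h(1,2) unfolding x N_def L_def sdel_def by auto
    then have "cross2 (t - y) (t' - y) = 0" using cross2_commute[of "t - y" "t' - y"] by linarith
    then have "t = t'" using h(1,2) unfolding x by (intro sdel_collinear[of y t R t' w]) (auto simp: N_def L_def)
    with x show "x = x'" by simp
  qed (auto simp: N_def L_def sdel_def)
  have LU: "L \<subseteq> N \<union> (A True \<union> A False \<union> (B True \<union> B False) \<union> (C True \<union> C False))"
  proof
    fix x assume "x \<in> L"
    then obtain s t where x: "x = (s, t)" and st: "(s, t) \<in> L" by (cases x) auto
    show "x \<in> N \<union> (A True \<union> A False \<union> (B True \<union> B False) \<union> (C True \<union> C False))"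
    proof (rule ccontr)
      assume no: "x \<notin> N \<union> (A True \<union> A False \<union> (B True \<union> B False) \<union> (C True \<union> C False))"
      then have "(s, t) \<notin> N" by (simp add: x)
      with st obtain r0 where r0: "r0 \<in> R" "cross2 (t - s) (r0 - s) > 0" by (auto simp: N_def not_le)
      have sd: "(s, t) \<in> sdel R" "w \<bullet> s < w \<bullet> t" "s \<in> R" "t \<in> R" using st by (auto simp: L_def sdel_def)
      obtain p where "UE p s t"
        using sdel_upper_end[OF R sd(1) r0] sd unfolding UE_def by blast
      then obtain r where u: "UE p s t" "r \<in> R" "r \<noteq> s" "r \<noteq> t" "norm (p - s) = norm (p - r)" unfolding UE_def by blast
      have uu: "w \<bullet> s < w \<bullet> t" "p \<in> vcell R s" "norm (p - s) = norm (p - t)"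
        using u(1) unfolding UE_def by blast+
      have nm: "(p, s) \<notin> Mid" "(p, t) \<notin> Mid" using no u(1) unfolding x by (auto simp: A_def B_def Mid_def)
      have nr: "(p, r) \<notin> Mid" using no u(1) nm unfolding x by (auto simp: C_def Mid_def)
      have vt: "p \<in> vcell R t" "p \<in> vcell R r" using uu u(5) vcell_tied by blast+
      have M: "(p, b) \<in> Mid" if "a \<in> R" "b \<in> R" "c \<in> R" "p \<in> vcell R b" "norm (p - b) = norm (p - a)"
         "norm (p - b) = norm (p - c)" "w \<bullet> a < w \<bullet> b" "w \<bullet> b < w \<bullet> c" for a b c
        using apexesI[of b R p a c] that by (simp add: Mid_def)
      note f = uu u(2-5) nm nr vt sd(3,4)
      have "\<not> w \<bullet> r < w \<bullet> s" using M[of r s t] f by auto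
      moreover have "\<not> w \<bullet> t < w \<bullet> r" using M[of s t r] f by auto
      moreover have "\<not> (w \<bullet> s < w \<bullet> r \<and> w \<bullet> r < w \<bullet> t)" using M[of s r t] f by auto
      moreover have "w \<bullet> r \<noteq> w \<bullet> s" "w \<bullet> r \<noteq> w \<bullet> t" using w f by (auto simp: inj_on_def)
      ultimately show False by linarith
    qed
  qed
  have fU: "finite (N \<union> (A True \<union> A False \<union> (B True \<union> B False) \<union> (C True \<union> C False)))"
    using cA cB cC cN by simp
  have "card L \<le> card (N \<union> (A True \<union> A False \<union> (B True \<union> B False) \<union> (C True \<union> C False)))"
    by (rule card_mono[OF fU LU])
  also have "\<dots> \<le> card N + (card (A True) + card (A False) + (card (B True) + card (B False)) + (card (C True) + card (C False)))"
    by (intro card_Un_le_add order.refl)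
  \<comment> \<open>One for \<open>N\<close> and two orientations for each of \<open>A\<close>,
    \<open>B\<close>, \<open>C\<close>. Adding the mirrored pairs later doubles the bound.\<close>
  also have "\<dots> \<le> 7 * card R"
    using cA[of True] cA[of False] cB[of True] cB[of False] cC[of True] cC[of False] cN by linarith
  finally have cL: "card L \<le> 7 * card R" .
  have fL: "finite L" by (rule finite_subset[OF LU fU])
  have cov: "sdel R \<subseteq> L \<union> prod.swap ` L"
  proof
    fix x assume "x \<in> sdel R"
    then obtain s t where x: "x = (s, t)" and st: "(s, t) \<in> sdel R" by (cases x) auto
    have ts: "(t, s) \<in> sdel R" using st sdel_sym by blast
    have "w \<bullet> t \<noteq> w \<bullet> s" using st w by (auto simp: sdel_def inj_on_def)
    then have "(s, t) \<in> L \<or> (t, s) \<in> L" using st ts by (auto simp: L_def)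
    then show "x \<in> L \<union> prod.swap ` L" unfolding x by force
  qed
  have "card (sdel R) \<le> card (L \<union> prod.swap ` L)" by (rule card_mono[OF _ cov]) (use fL in simp)
  also have "\<dots> \<le> card L + card L"
    by (intro card_Un_le_add order.refl card_image_le fL)
  finally have "card (sdel R) \<le> 14 * card R" using cL by linarith
  moreover have "finite (sdel R)" by (rule finite_subset[OF cov]) (use fL in simp)
  ultimately show ?thesis by blast
qed

section \<open>The overlay of two Voronoi diagrams\<close>

definition sdeg :: "real^2 \<Rightarrow> (real^2) set \<Rightarrow> nat" where
  "sdeg t R = card {u. (t, u) \<in> sdel R}"

lemma sum_sdeg_le:
  assumes "finite R"
  shows "(\<Sum>t\<in>R. sdeg t R) \<le> 14 * card R"
proof -
  have eq: "sdel R = Sigma R (\<lambda>t. {u. (t, u) \<in> sdel R})" unfolding sdel_def by blast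
  have "finite {u. (t, u) \<in> sdel R}" for t
    by (rule finite_subset[OF _ assms]) (auto simp: sdel_def)
  then have "card (sdel R) = (\<Sum>t\<in>R. sdeg t R)"
    unfolding sdeg_def by (subst eq) (intro card_SigmaI assms ballI)
  then show ?thesis using card_sdel_le[OF assms] by linarith
qed

text \<open>On the way from \<open>x\<close> to \<open>u\<close> there is a point that is equally far from \<open>u\<close> and \<open>v\<close>.\<close>

lemma scell_imp_sdel:
  assumes u: "u \<in> R" "x \<in> scell R u" and v: "v \<notin> R" "norm (x - v) \<le> norm (x - u)"
  shows "(v, u) \<in> sdel (insert v R)"
proof -
  define y where "y l = x + l *\<^sub>R (u - x)" for l :: real
  define f where "f l = norm (y l - v) - norm (y l - u)" for l
  have "continuous_on {0..1} f" unfolding f_def y_def by (intro continuous_intros)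
  moreover have "f 0 \<le> 0" "0 \<le> f 1" using v by (auto simp: f_def y_def)
  ultimately obtain l where l: "0 \<le> l" "l \<le> 1" "f l = 0" using IVT'[of f 0 0 1] by auto
  \<comment> \<open>Moving straight towards \<open>u\<close> shortens the distance to
    \<open>u\<close> by the full length of the move, and any other distance by at most that
    length.\<close>
  have "norm (y l - u) < norm (y l - z)" if z: "z \<in> R - {u}" for z
  proof -
    have "y l - u = (1 - l) *\<^sub>R (x - u)" by (simp add: y_def algebra_simps)
    then have yu: "norm (y l - u) = norm (x - u) - l * norm (x - u)"
      using l by (simp only: norm_scaleR) (simp add: left_diff_distrib)
    have xz: "x - z = (y l - z) + l *\<^sub>R (x - u)" by (simp add: y_def algebra_simps)
    have "norm (x - z) \<le> norm (y l - z) + l * norm (x - u)"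
      unfolding xz using l norm_triangle_ineq[of "y l - z" "l *\<^sub>R (x - u)"] by simp
    moreover have "norm (x - u) < norm (x - z)" using u z by (auto simp: scell_def)
    ultimately show ?thesis unfolding yu by linarith
  qed
  then have "norm (y l - v) = norm (y l - u)" "\<forall>z\<in>insert v R - {v, u}. norm (y l - v) < norm (y l - z)"
    using l by (auto simp: f_def)
  then show ?thesis
    using u v unfolding sdel_def by blast
qed

text \<open>Indexes the two-dimensional cells of the overlay: the intersection of two open Voronoi
  cells is convex, so each pair contributes one cell.\<close>

definition opairs :: "(real^2) set \<Rightarrow> (real^2) set \<Rightarrow> ((real^2) \<times> (real^2)) set" where
  "opairs R Q = {(u, v). u \<in> R \<and> v \<in> Q \<and> scell R u \<inter> scell Q v \<noteq> {}}"

text \<open>Take a point common to both cells. Adding the nearer of \<open>u\<close> and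
  \<open>v\<close> to the sites of the other makes the two Delaunay neighbours. The right-hand side
  consists of degrees of newly inserted sites, which is what averaging over permutations
  controls.\<close>

lemma card_opairs_le:
  assumes "finite R" "finite Q" "R \<inter> Q = {}"
  shows "card (opairs R Q) \<le> (\<Sum>v\<in>Q. sdeg v (insert v R)) + (\<Sum>u\<in>R. sdeg u (insert u Q))"
proof -
  define A where "A = Sigma Q (\<lambda>v. {u. (v, u) \<in> sdel (insert v R)})"
  define B where "B = Sigma R (\<lambda>u. {v. (u, v) \<in> sdel (insert u Q)})"
  have fin: "finite {z. (t, z) \<in> sdel X}" if "finite X" for t X
    by (rule finite_subset[OF _ that]) (auto simp: sdel_def)
  have fA: "finite A" "card A = (\<Sum>v\<in>Q. sdeg v (insert v R))"
    unfolding A_def sdeg_def using assms fin by (auto intro!: card_SigmaI)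
  have fB: "finite B" "card B = (\<Sum>u\<in>R. sdeg u (insert u Q))"
    unfolding B_def sdeg_def using assms fin by (auto intro!: card_SigmaI)
  have "opairs R Q \<subseteq> prod.swap ` A \<union> B"
  proof
    fix z assume "z \<in> opairs R Q"
    then obtain u v x where z: "z = (u, v)" and uv: "u \<in> R" "v \<in> Q" "x \<in> scell R u" "x \<in> scell Q v"
      by (auto simp: opairs_def)
    show "z \<in> prod.swap ` A \<union> B"
    proof (cases "norm (x - v) \<le> norm (x - u)")
      case True
      then have "(v, u) \<in> A" using scell_imp_sdel[of u R x v] uv assms by (auto simp: A_def)
      then show ?thesis unfolding z by force
    next
      case False
      then have "(u, v) \<in> B" using scell_imp_sdel[of v Q x u] uv assms by (auto simp: B_def)
      then show ?thesis unfolding z by simp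
    qed
  qed
  then have "card (opairs R Q) \<le> card (prod.swap ` A \<union> B)"
    using fA fB by (intro card_mono) auto
  also have "\<dots> \<le> card A + card B" by (intro card_Un_le_add card_image_le fA order.refl)
  finally show ?thesis using fA fB by simp
qed

text \<open>A crossing of two Voronoi edges occurs four times, once for each choice of a side of
  either edge, that is, once for each adjacent overlay cell.\<close>

definition xcross :: "(real^2) set \<Rightarrow> (real^2) set \<Rightarrow> ((real^2) \<times> (real^2) \<times> (real^2) \<times> (real^2) \<times> (real^2)) set" where
  "xcross R Q = {(p, s, a, t, b). s \<in> R \<and> a \<in> R \<and> t \<in> Q \<and> b \<in> Q \<and>
     norm (p - s) = norm (p - a) \<and> (\<forall>u\<in>R - {s, a}. norm (p - s) < norm (p - u)) \<and>
     norm (p - t) = norm (p - b) \<and> (\<forall>u\<in>Q - {t, b}. norm (p - t) < norm (p - u)) \<and>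
     cross2 (a - s) (b - t) \<noteq> 0}"

lemma ex_move_in_open:
  fixes p :: "'a::real_normed_vector"
  assumes "open X" "p \<in> X"
  shows "\<exists>e>0. p + e *\<^sub>R z \<in> X"
proof -
  obtain r where r: "r > 0" "ball p r \<subseteq> X" using assms open_contains_ball by blast
  define e where "e = r / (norm z + 1)"
  have nz: "norm z + 1 > 0" using norm_ge_zero[of z] by linarith
  have "e > 0" using r nz by (simp add: e_def)
  moreover have "e * norm z < r" using r nz by (simp add: e_def field_simps)
  then have "p + e *\<^sub>R z \<in> ball p r" using \<open>e > 0\<close> by (simp add: dist_norm)
  ultimately show ?thesis using r by blast
qed

lemma open_nearer:
  fixes s :: "'a::real_normed_vector"
  assumes "finite U"
  shows "open {x. \<forall>u\<in>U. norm (x - s) < norm (x - u)}"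
proof -
  have "{x. \<forall>u\<in>U. norm (x - s) < norm (x - u)} = (\<Inter>u\<in>U. {x. norm (x - s) < norm (x - u)})" by auto
  also have "open \<dots>"
    using assms by (intro open_INT ballI open_Collect_less continuous_intros)
  finally show ?thesis .
qed

text \<open>The two bisectors are transversal, so some direction \<open>z\<close> leads from
  \<open>p\<close> strictly to the side of \<open>s\<close> and strictly to the side of
  \<open>t\<close>. A small step keeps all other sites farther.\<close>

lemma xcross_imp_opairs:
  assumes R: "finite R" "finite Q" and x: "(p, s, a, t, b) \<in> xcross R Q"
  shows "(s, t) \<in> opairs R Q"
proof -
  have h: "s \<in> R" "a \<in> R" "t \<in> Q" "b \<in> Q"
     "norm (p - s) = norm (p - a)" "\<And>u. u\<in>R - {s, a} \<Longrightarrow> norm (p - s) < norm (p - u)"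
     "norm (p - t) = norm (p - b)" "\<And>u. u\<in>Q - {t, b} \<Longrightarrow> norm (p - t) < norm (p - u)"
     "cross2 (a - s) (b - t) \<noteq> 0" using x unfolding xcross_def by blast+
  obtain z where z: "z \<bullet> (a - s) = -1" "z \<bullet> (b - t) = -1" using cross2_solve[OF h(9)] by blast
  let ?A = "{x. \<forall>u\<in>R - {s, a}. norm (x - s) < norm (x - u)}"
  let ?B = "{x. \<forall>u\<in>Q - {t, b}. norm (x - t) < norm (x - u)}"
  have op: "open (?A \<inter> ?B)" using R by (intro open_Int open_nearer) auto
  have pi: "p \<in> ?A \<inter> ?B" using h by simp
  obtain e where e: "e > 0" "p + e *\<^sub>R z \<in> ?A \<inter> ?B" using ex_move_in_open[OF op pi, of z] by auto
  have "z \<bullet> (s - a) = 1" "z \<bullet> (t - b) = 1" using z by (simp_all add: inner_diff_right)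
  then have "norm (p + e *\<^sub>R z - s) < norm (p + e *\<^sub>R z - a)" "norm (p + e *\<^sub>R z - t) < norm (p + e *\<^sub>R z - b)"
    using e by (simp_all add: norm_less_iff_inner(1)[OF h(5)[symmetric]] norm_less_iff_inner(1)[OF h(7)[symmetric]])
  moreover have "\<forall>u\<in>R - {s, a}. norm (p + e *\<^sub>R z - s) < norm (p + e *\<^sub>R z - u)"
    "\<forall>u\<in>Q - {t, b}. norm (p + e *\<^sub>R z - t) < norm (p + e *\<^sub>R z - u)" using e(2) by simp_all
  ultimately have "p + e *\<^sub>R z \<in> scell R s \<inter> scell Q t" unfolding scell_def by blast
  then show ?thesis using h by (auto simp: opairs_def)
qed

lemma xcross_swap:
  assumes "(p, s, a, t, b) \<in> xcross R Q"
  shows "(p, a, s, t, b) \<in> xcross R Q" "(p, s, a, b, t) \<in> xcross R Q"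
proof -
  have "cross2 (s - a) (b - t) = - cross2 (a - s) (b - t)" "cross2 (a - s) (t - b) = - cross2 (a - s) (b - t)"
    by (simp_all add: cross2_def algebra_simps)
  then show "(p, a, s, t, b) \<in> xcross R Q" "(p, s, a, b, t) \<in> xcross R Q"
    using assms unfolding xcross_def by (auto simp: insert_commute)
qed

lemma vcell_nearest2:
  assumes "norm (p - s) = norm (p - a)" "\<And>u. u \<in> R - {s, a} \<Longrightarrow> norm (p - s) < norm (p - u)"
  shows "p \<in> vcell R s"
  unfolding vcell_def
proof (clarify)
  fix u assume "u \<in> R"
  then show "norm (p - s) \<le> norm (p - u)"
    using assms by (cases "u \<in> {s, a}") (auto simp: less_imp_le)
qed

text \<open>The direction \<open>e\<close> is generic, and \<open>p\<close> is the extreme point in direction \<open>e\<close> of the overlay cell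
  of \<open>s\<close> and \<open>t\<close>.\<close>

lemma xcross_unique:
  assumes x: "(p, s, a, t, b) \<in> xcross R Q" "(q, s, a', t, b') \<in> xcross R Q"
    and al: "\<alpha> > 0" "\<beta> > 0" "e = \<alpha> *\<^sub>R (a - s) + \<beta> *\<^sub>R (b - t)"
    and al': "\<alpha>' > 0" "\<beta>' > 0" "e = \<alpha>' *\<^sub>R (a' - s) + \<beta>' *\<^sub>R (b' - t)"
  shows "(p, a, b) = (q, a', b')"
proof -
  have h: "s \<in> R" "a \<in> R" "t \<in> Q" "b \<in> Q"
     "norm (p - s) = norm (p - a)" "\<And>u. u\<in>R - {s, a} \<Longrightarrow> norm (p - s) < norm (p - u)"
     "norm (p - t) = norm (p - b)" "\<And>u. u\<in>Q - {t, b} \<Longrightarrow> norm (p - t) < norm (p - u)"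
     "cross2 (a - s) (b - t) \<noteq> 0" using x(1) unfolding xcross_def by blast+
  have h': "a' \<in> R" "b' \<in> Q"
     "norm (q - s) = norm (q - a')" "\<And>u. u\<in>R - {s, a'} \<Longrightarrow> norm (q - s) < norm (q - u)"
     "norm (q - t) = norm (q - b')" "\<And>u. u\<in>Q - {t, b'} \<Longrightarrow> norm (q - t) < norm (q - u)"
     "cross2 (a' - s) (b' - t) \<noteq> 0" using x(2) unfolding xcross_def by blast+
  have cell: "p \<in> vcell R s" "p \<in> vcell Q t" "q \<in> vcell R s" "q \<in> vcell Q t"
    using vcell_nearest2[OF h(5,6)] vcell_nearest2[OF h(7,8)] vcell_nearest2[OF h'(3,4)]
      vcell_nearest2[OF h'(5,6)] by blast+
  define z where "z = q - p"
  have "z \<bullet> (a - s) \<le> 0" "z \<bullet> (b - t) \<le> 0"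
    unfolding z_def using vcell_inner_le[OF cell(3) h(2,5)] vcell_inner_le[OF cell(4) h(4,7)] by auto
  then have n: "\<alpha> * (z \<bullet> (a - s)) \<le> 0" "\<beta> * (z \<bullet> (b - t)) \<le> 0" using al by (auto simp: mult_le_0_iff)
  have "(- z) \<bullet> (a' - s) \<le> 0" "(- z) \<bullet> (b' - t) \<le> 0"
    unfolding z_def using vcell_inner_le[OF cell(1) h'(1,3)] vcell_inner_le[OF cell(2) h'(2,5)] by auto
  then have n': "\<alpha>' * (z \<bullet> (a' - s)) \<ge> 0" "\<beta>' * (z \<bullet> (b' - t)) \<ge> 0" using al' by (auto simp: zero_le_mult_iff)
  have e1: "z \<bullet> e = \<alpha> * (z \<bullet> (a - s)) + \<beta> * (z \<bullet> (b - t))" unfolding al(3) by (simp add: inner_add_right)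
  have e2: "z \<bullet> e = \<alpha>' * (z \<bullet> (a' - s)) + \<beta>' * (z \<bullet> (b' - t))" unfolding al'(3) by (simp add: inner_add_right)
  \<comment> \<open>By \<open>e1\<close> and \<open>e2\<close>, \<open>z \<bullet> e\<close> is at
    once a sum of nonpositive and a sum of nonnegative terms.\<close>
  have "\<alpha> * (z \<bullet> (a - s)) = 0" "\<beta> * (z \<bullet> (b - t)) = 0" using n n' e1 e2 by linarith+
  then have "z \<bullet> (a - s) = 0" "z \<bullet> (b - t) = 0" using al by auto
  then have "z = 0" by (rule inner_zero_cross2[OF h(9)])
  then have q: "q = p" by (simp add: z_def)
  have "a \<noteq> s" "b \<noteq> t" using h(9) by (auto simp: cross2_def)
  \<comment> \<open>At the common point only \<open>s\<close> and \<open>a\<close> are nearest in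
    \<open>R\<close>, and only \<open>t\<close> and \<open>b\<close> in \<open>Q\<close>; this
    identifies \<open>a'\<close> and \<open>b'\<close>.\<close>
  then have "a = a'" "b = b'" using h'(4)[of a] h'(6)[of b] h(2,4,5,7) unfolding q by auto
  then show ?thesis using q by simp
qed

lemma scaleR_solve:
  fixes A :: "'a::real_vector"
  assumes "x *\<^sub>R A - y *\<^sub>R B = - c *\<^sub>R e" "c \<noteq> 0"
  shows "e = (- x / c) *\<^sub>R A + (y / c) *\<^sub>R B"
proof -
  have "e = (- 1 / c) *\<^sub>R (x *\<^sub>R A - y *\<^sub>R B)" using assms by simp
  then show ?thesis by (simp add: scaleR_diff_right)
qed

text \<open>For generic \<open>w\<close> the vector \<open>perp w\<close> has two nonzero
  coefficients in the normals of the crossing edges. Swapping \<open>s\<close> with \<open>a\<close>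
  or \<open>t\<close> with \<open>b\<close> flips their signs, so one of the four orientations makes
  both positive, and there the crossing is the extreme point of its cell.\<close>

lemma card_xcross_le:
  assumes R: "finite R" "finite Q"
  shows "finite (xcross R Q) \<and> card (xcross R Q) \<le> 4 * card (opairs R Q)"
proof -
  obtain w where w: "inj_on (inner w) (R \<union> Q)"
    using ex_generic_functional[of "R \<union> Q"] R by blast
  define good where "good = (\<lambda>(p :: real^2, s, a, t, b). \<exists>\<alpha> \<beta>. \<alpha> > 0 \<and> \<beta> > 0 \<and> perp w = \<alpha> *\<^sub>R (a - s) + \<beta> *\<^sub>R (b - t))"
  define N where "N = {x \<in> xcross R Q. good x}"
  define f1 :: "(real^2) \<times> (real^2) \<times> (real^2) \<times> (real^2) \<times> (real^2) \<Rightarrow> _" where "f1 = (\<lambda>(p, s, a, t, b). (p, a, s, t, b))"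
  define f2 :: "(real^2) \<times> (real^2) \<times> (real^2) \<times> (real^2) \<times> (real^2) \<Rightarrow> _" where "f2 = (\<lambda>(p, s, a, t, b). (p, s, a, b, t))"
  have fo: "finite (opairs R Q)"
    by (rule finite_subset[of _ "R \<times> Q"]) (use R in \<open>auto simp: opairs_def\<close>)
  have N: "finite N \<and> card N \<le> card (opairs R Q)"
  proof (rule card_le_witness[OF fo, where P = "\<lambda>(p, s, a, t, b) y. y = (s, t)"])
    fix x assume "x \<in> N"
    then obtain p s a t b where x: "x = (p, s, a, t, b)" "x \<in> xcross R Q" unfolding N_def by (cases x) auto
    have "(s, t) \<in> opairs R Q" using x xcross_imp_opairs[OF R] by blast
    then show "\<exists>y\<in>opairs R Q. (case x of (p, s, a, t, b) \<Rightarrow> \<lambda>y. y = (s, t)) y" using x by auto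
  next
    fix x x' y assume "x \<in> N" "x' \<in> N" "(case x of (p, s, a, t, b) \<Rightarrow> \<lambda>y. y = (s, t)) y"
      "(case x' of (p, s, a, t, b) \<Rightarrow> \<lambda>y. y = (s, t)) y"
    moreover obtain p s a t b where "x = (p, s, a, t, b)" by (metis prod.collapse)
    moreover obtain p' s' a' t' b' where "x' = (p', s', a', t', b')" by (metis prod.collapse)
    ultimately have x: "x = (p, s, a, t, b)" "x' = (p', s, a', t, b')" "x \<in> N" "x' \<in> N" by auto
    then have "x \<in> xcross R Q" "x' \<in> xcross R Q" "good x" "good x'" unfolding N_def by blast+
    then show "x = x'" unfolding x good_def using xcross_unique[of p s a t b R Q p' a' b'] by auto
  qed
  have cover: "xcross R Q \<subseteq> (N \<union> f1 ` N) \<union> (f2 ` N \<union> f1 ` (f2 ` N))"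
  proof
    fix x assume x: "x \<in> xcross R Q"
    obtain p s a t b where xe: "x = (p, s, a, t, b)" by (metis prod.collapse)
    note x = x[unfolded xe]
    have h: "s \<in> R" "a \<in> R" "t \<in> Q" "b \<in> Q" "cross2 (a - s) (b - t) \<noteq> 0" using x unfolding xcross_def by blast+
    then have "a \<noteq> s" "b \<noteq> t" by (auto simp: cross2_def)
    then have nz: "w \<bullet> (a - s) \<noteq> 0" "w \<bullet> (b - t) \<noteq> 0"
      using w h by (auto simp: inner_diff_right inj_on_def)
    define c where "c = cross2 (a - s) (b - t)"
    define \<alpha> where "\<alpha> = - (w \<bullet> (b - t)) / c"
    define \<beta> where "\<beta> = (w \<bullet> (a - s)) / c"
    have c: "c \<noteq> 0" using h by (simp add: c_def)
    have nab: "\<alpha> \<noteq> 0" "\<beta> \<noteq> 0" using nz c by (auto simp: \<alpha>_def \<beta>_def)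
    have e: "perp w = \<alpha> *\<^sub>R (a - s) + \<beta> *\<^sub>R (b - t)"
      unfolding \<alpha>_def \<beta>_def using perp_decomp[of w "b - t" "a - s"] c
      by (intro scaleR_solve) (simp_all add: c_def)
    have e1: "perp w = (- \<alpha>) *\<^sub>R (s - a) + \<beta> *\<^sub>R (b - t)" "perp w = \<alpha> *\<^sub>R (a - s) + (- \<beta>) *\<^sub>R (t - b)"
      "perp w = (- \<alpha>) *\<^sub>R (s - a) + (- \<beta>) *\<^sub>R (t - b)"
      unfolding e by (simp_all add: algebra_simps)
    consider "\<alpha> > 0" "\<beta> > 0" | "\<alpha> < 0" "\<beta> > 0" | "\<alpha> > 0" "\<beta> < 0" | "\<alpha> < 0" "\<beta> < 0"
      using nab by linarith
    then show "x \<in> (N \<union> f1 ` N) \<union> (f2 ` N \<union> f1 ` (f2 ` N))"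
    proof cases
      case 1
      then have "x \<in> N" using x e unfolding N_def good_def xe by blast
      then show ?thesis by blast
    next
      case 2
      then have "- \<alpha> > 0" by simp
      then have "(p, a, s, t, b) \<in> N" using 2 e1(1) xcross_swap(1)[OF x] unfolding N_def good_def by blast
      then have "f1 (p, a, s, t, b) \<in> f1 ` N" by blast
      then show ?thesis by (simp add: f1_def xe)
    next
      case 3
      then have "- \<beta> > 0" by simp
      then have "(p, s, a, b, t) \<in> N" using 3 e1(2) xcross_swap(2)[OF x] unfolding N_def good_def by blast
      then have "f2 (p, s, a, b, t) \<in> f2 ` N" by blast
      then show ?thesis by (simp add: f2_def xe)
    next
      case 4
      then have "- \<alpha> > 0" "- \<beta> > 0" by simp_all
      then have "(p, a, s, b, t) \<in> N" using e1(3) xcross_swap(2)[OF xcross_swap(1)[OF x]] unfolding N_def good_def by blast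
      then have "f1 (f2 (p, a, s, b, t)) \<in> f1 ` (f2 ` N)" by blast
      then show ?thesis by (simp add: f1_def f2_def xe)
    qed
  qed
  have f: "finite ((N \<union> f1 ` N) \<union> (f2 ` N \<union> f1 ` (f2 ` N)))" using N by simp
  have "card (xcross R Q) \<le> card ((N \<union> f1 ` N) \<union> (f2 ` N \<union> f1 ` (f2 ` N)))" by (rule card_mono[OF f cover])
  also have "\<dots> \<le> (card N + card N) + (card N + card N)"
    using N by (intro card_Un_le_add order.refl card_image_le order.trans[OF card_image_le card_image_le]) auto
  finally show ?thesis using N finite_subset[OF cover f] by linarith
qed

section \<open>Averages over permutations and random colourings\<close>

text \<open>Exchangeability in counting form: swapping two fixed positions is an involution on the
  orderings.\<close>

lemma sum_permutations_transpose:
  assumes "finite S" "i < card S" "j < card S"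
  shows "(\<Sum>xs\<in>permutations_of_set S. H (permute_list (Transposition.transpose i j) xs)) = (\<Sum>xs\<in>permutations_of_set S. H xs)"
proof -
  define f where "f = (permute_list (Transposition.transpose i j) :: 'a list \<Rightarrow> _)"
  have per: "Transposition.transpose i j permutes {..<length xs}" if "xs \<in> permutations_of_set S" for xs
    using that assms length_finite_permutations_of_set[OF that] by (intro permutes_swap_id) auto
  have inS: "f xs \<in> permutations_of_set S" if "xs \<in> permutations_of_set S" for xs
    unfolding f_def using that per[OF that]
    by (intro permutations_of_setI) (simp_all add: permutations_of_setD)
  have inv: "f (f xs) = xs" if "xs \<in> permutations_of_set S" for xs
    unfolding f_def permute_list_compose[OF per[OF that], symmetric] by simp
  show ?thesis
    by (rule sum.reindex_bij_witness[where i = f and j = f]) (use inS inv in \<open>auto simp: f_def\<close>)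
qed

lemma image_nth_permute_transpose:
  assumes "i \<in> P" "j \<in> P" "P \<subseteq> {..<length xs}"
  shows "nth (permute_list (Transposition.transpose i j) xs) ` P = nth xs ` P"
proof -
  have per: "Transposition.transpose i j permutes {..<length xs}" using assms by (intro permutes_swap_id) auto
  have "nth (permute_list (Transposition.transpose i j) xs) ` P = (\<lambda>m. xs ! Transposition.transpose i j m) ` P"
    using assms permute_list_nth[OF per] by (intro image_cong refl) auto
  also have "\<dots> = nth xs ` (Transposition.transpose i j ` P)" by (simp add: image_image)
  also have "Transposition.transpose i j ` P = P" using assms by (intro permutes_image permutes_swap_id) auto
  finally show ?thesis .
qed

lemma image_nth_permute_transpose_disjoint:
  assumes "i \<notin> Q" "j \<notin> Q" "i < length xs" "j < length xs" "Q \<subseteq> {..<length xs}"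
  shows "nth (permute_list (Transposition.transpose i j) xs) ` Q = nth xs ` Q"
proof -
  have per: "Transposition.transpose i j permutes {..<length xs}" using assms by (intro permutes_swap_id) auto
  show ?thesis
  proof (rule image_cong)
    fix m assume "m \<in> Q"
    then have "m \<noteq> i" "m \<noteq> j" "m < length xs" using assms by auto
    then show "permute_list (Transposition.transpose i j) xs ! m = xs ! m"
      using permute_list_nth[OF per] by simp
  qed simp
qed

text \<open>Backwards analysis: as long as \<open>H\<close> is unaffected by swaps inside
  \<open>P\<close>, each of the sites in the positions \<open>P\<close> is equally likely to be the
  one in position \<open>a\<close>.\<close>

lemma sum_permutations_nth_average:
  fixes H :: "'a list \<Rightarrow> 'a \<Rightarrow> nat"
  assumes S: "finite S" and P: "P \<subseteq> {..<card S}" "a \<in> P"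
    and inv: "\<And>xs i j. xs \<in> permutations_of_set S \<Longrightarrow> i \<in> P \<Longrightarrow> j \<in> P \<Longrightarrow> H (permute_list (Transposition.transpose i j) xs) = H xs"
  shows "card P * (\<Sum>xs\<in>permutations_of_set S. H xs (xs ! a)) =
    (\<Sum>xs\<in>permutations_of_set S. \<Sum>s\<in>nth xs ` P. H xs s)"
proof -
  have same: "(\<Sum>xs\<in>permutations_of_set S. H xs (xs ! a)) = (\<Sum>xs\<in>permutations_of_set S. H xs (xs ! b))" if b: "b \<in> P" for b
  proof -
    have "(\<Sum>xs\<in>permutations_of_set S. H xs (xs ! a)) =
      (\<Sum>xs\<in>permutations_of_set S. H (permute_list (Transposition.transpose a b) xs) (permute_list (Transposition.transpose a b) xs ! a))"
      by (rule sum_permutations_transpose[OF S, where H = "\<lambda>xs. H xs (xs ! a)", symmetric]) (use P b in auto)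
    also have "\<dots> = (\<Sum>xs\<in>permutations_of_set S. H xs (xs ! b))"
    proof (rule sum.cong)
      fix xs assume xs: "xs \<in> permutations_of_set S"
      have l: "length xs = card S" by (rule length_finite_permutations_of_set[OF xs])
      have "Transposition.transpose a b permutes {..<length xs}" using P b l by (intro permutes_swap_id) auto
      from permute_list_nth[OF this, of a] have "permute_list (Transposition.transpose a b) xs ! a = xs ! b"
        using P l by auto
      then show "H (permute_list (Transposition.transpose a b) xs) (permute_list (Transposition.transpose a b) xs ! a) = H xs (xs ! b)"
        using inv[OF xs P(2) b] by simp
    qed simp
    finally show ?thesis .
  qed
  have "card P * (\<Sum>xs\<in>permutations_of_set S. H xs (xs ! a)) = (\<Sum>b\<in>P. \<Sum>xs\<in>permutations_of_set S. H xs (xs ! b))"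
    by (subst sum.cong[OF refl same[symmetric]]) simp_all
  also have "\<dots> = (\<Sum>xs\<in>permutations_of_set S. \<Sum>b\<in>P. H xs (xs ! b))" by (rule sum.swap)
  also have "\<dots> = (\<Sum>xs\<in>permutations_of_set S. \<Sum>s\<in>nth xs ` P. H xs s)"
  proof (rule sum.cong)
    fix xs assume xs: "xs \<in> permutations_of_set S"
    have l: "length xs = card S" by (rule length_finite_permutations_of_set[OF xs])
    have "inj_on (nth xs) P"
      using permutations_of_setD(2)[OF xs] P l by (intro inj_on_nth) auto
    then show "(\<Sum>b\<in>P. H xs (xs ! b)) = (\<Sum>s\<in>nth xs ` P. H xs s)"
      by (simp add: sum.reindex)
  qed simp
  finally show ?thesis .
qed

lemma permutations_nth_facts:
  assumes "finite S" "xs \<in> permutations_of_set S" "P \<subseteq> {..<card S}"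
  shows "length xs = card S" "inj_on (nth xs) P" "card (nth xs ` P) = card P" "finite (nth xs ` P)"
proof -
  show l: "length xs = card S" by (rule length_finite_permutations_of_set[OF assms(2)])
  show i: "inj_on (nth xs) P"
    using permutations_of_setD(2)[OF assms(2)] assms(3) l by (intro inj_on_nth) auto
  show "card (nth xs ` P) = card P" by (rule card_image[OF i])
  show "finite (nth xs ` P)" using finite_subset[OF assms(3)] by simp
qed

text \<open>The site in position \<open>a\<close> is a uniformly random one among those in
  \<open>P\<close>, so its expected degree is the average degree.\<close>

lemma sum_sdeg_permutations_le:
  assumes S: "finite S" and P: "P \<subseteq> {..<card S}" "a \<in> P"
  shows "(\<Sum>xs\<in>permutations_of_set S. sdeg (xs ! a) (nth xs ` P)) \<le> 14 * fact (card S)"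
proof -
  have fP: "finite P" using P finite_subset by blast
  have "card P * (\<Sum>xs\<in>permutations_of_set S. sdeg (xs ! a) (nth xs ` P)) =
    (\<Sum>xs\<in>permutations_of_set S. \<Sum>s\<in>nth xs ` P. sdeg s (nth xs ` P))"
    by (rule sum_permutations_nth_average[OF S P, where H = "\<lambda>xs s. sdeg s (nth xs ` P)"])
       (use permutations_nth_facts(1)[OF S _ P(1)] P in \<open>simp add: image_nth_permute_transpose\<close>)
  also have "\<dots> \<le> (\<Sum>xs\<in>permutations_of_set S. 14 * card P)"
  proof (rule sum_mono)
    fix xs assume xs: "xs \<in> permutations_of_set S"
    show "(\<Sum>s\<in>nth xs ` P. sdeg s (nth xs ` P)) \<le> 14 * card P"
      using sum_sdeg_le[OF permutations_nth_facts(4)[OF S xs P(1)]] permutations_nth_facts(3)[OF S xs P(1)] by simp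
  qed
  also have "\<dots> = card P * (14 * fact (card S))" using S by simp
  finally show ?thesis using P fP by (auto simp: card_gt_0_iff)
qed

lemma sum_vvert_permutations_le:
  assumes S: "finite S" and P: "P \<subseteq> {..<card S}" "a \<in> P"
  shows "(\<Sum>xs\<in>permutations_of_set S. card {p. (p, xs ! a) \<in> vvert (nth xs ` P)}) \<le> 6 * fact (card S)"
proof -
  have fP: "finite P" using P finite_subset by blast
  have le: "(\<Sum>s\<in>R. card {p. (p, s) \<in> vvert R}) \<le> 6 * card R" if R: "finite R" for R
  proof -
    have eq: "(vvert R)\<inverse> = Sigma R (\<lambda>s. {p. (p, s) \<in> vvert R})"
      by (auto simp: vvert_def)
    have "{p. (p, s) \<in> vvert R} \<subseteq> fst ` vvert R" for s by force
    then have "finite {p. (p, s) \<in> vvert R}" for s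
      by (rule finite_subset[OF _ finite_imageI[OF card_vvert_le(2)[OF R]]])
    then have "(\<Sum>s\<in>R. card {p. (p, s) \<in> vvert R}) = card ((vvert R)\<inverse>)"
      unfolding eq using R by simp
    also have "\<dots> = card (vvert R)" by simp
    finally show ?thesis using card_vvert_le(1)[OF R] by linarith
  qed
  have "card P * (\<Sum>xs\<in>permutations_of_set S. card {p. (p, xs ! a) \<in> vvert (nth xs ` P)}) =
    (\<Sum>xs\<in>permutations_of_set S. \<Sum>s\<in>nth xs ` P. card {p. (p, s) \<in> vvert (nth xs ` P)})"
    by (rule sum_permutations_nth_average[OF S P, where H = "\<lambda>xs s. card {p. (p, s) \<in> vvert (nth xs ` P)}"])
       (use permutations_nth_facts(1)[OF S _ P(1)] P in \<open>simp add: image_nth_permute_transpose\<close>)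
  also have "\<dots> \<le> (\<Sum>xs\<in>permutations_of_set S. 6 * card P)"
  proof (rule sum_mono)
    fix xs assume xs: "xs \<in> permutations_of_set S"
    show "(\<Sum>s\<in>nth xs ` P. card {p. (p, s) \<in> vvert (nth xs ` P)}) \<le> 6 * card P"
      using le[OF permutations_nth_facts(4)[OF S xs P(1)]] permutations_nth_facts(3)[OF S xs P(1)] by simp
  qed
  also have "\<dots> = card P * (6 * fact (card S))" using S by simp
  finally show ?thesis using P fP by (auto simp: card_gt_0_iff)
qed

text \<open>A single site of one sample, joined to the other sample, occupies one position of
  \<open>insert b P\<close> like any other, so its expected degree is bounded by a constant.\<close>

lemma sum_opairs_permutations_le:
  assumes S: "finite S" and P: "P \<subseteq> {..<card S}" "Q \<subseteq> {..<card S}" "P \<inter> Q = {}"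
  shows "(\<Sum>xs\<in>permutations_of_set S. card (opairs (nth xs ` P) (nth xs ` Q)))
    \<le> 14 * fact (card S) * (card P + card Q)"
proof -
  have fin: "finite P" "finite Q" using P finite_subset by blast+
  have half: "(\<Sum>xs\<in>permutations_of_set S. \<Sum>v\<in>nth xs ` Q. sdeg v (insert v (nth xs ` P))) \<le> 14 * fact (card S) * card Q"
    if P: "P \<subseteq> {..<card S}" "Q \<subseteq> {..<card S}" for P Q
  proof -
    have "(\<Sum>xs\<in>permutations_of_set S. \<Sum>v\<in>nth xs ` Q. sdeg v (insert v (nth xs ` P))) =
      (\<Sum>xs\<in>permutations_of_set S. \<Sum>b\<in>Q. sdeg (xs ! b) (nth xs ` insert b P))"
      by (rule sum.cong) (simp_all add: sum.reindex permutations_nth_facts(2)[OF S _ P(2)])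
    also have "\<dots> = (\<Sum>b\<in>Q. \<Sum>xs\<in>permutations_of_set S. sdeg (xs ! b) (nth xs ` insert b P))" by (rule sum.swap)
    also have "\<dots> \<le> (\<Sum>b\<in>Q. 14 * fact (card S))"
      by (rule sum_mono, rule sum_sdeg_permutations_le[OF S]) (use P in auto)
    finally show ?thesis by (simp add: mult.commute)
  qed
  have "(\<Sum>xs\<in>permutations_of_set S. card (opairs (nth xs ` P) (nth xs ` Q))) \<le>
    (\<Sum>xs\<in>permutations_of_set S. (\<Sum>v\<in>nth xs ` Q. sdeg v (insert v (nth xs ` P))) +
       (\<Sum>u\<in>nth xs ` P. sdeg u (insert u (nth xs ` Q))))"
  proof (rule sum_mono, rule card_opairs_le)
    fix xs assume xs: "xs \<in> permutations_of_set S"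
    have "inj_on (nth xs) (P \<union> Q)" using permutations_nth_facts(2)[OF S xs, of "P \<union> Q"] P by blast
    then show "nth xs ` P \<inter> nth xs ` Q = {}" using P(3) unfolding inj_on_def by blast
  qed (use fin in auto)
  also have "\<dots> \<le> 14 * fact (card S) * card Q + 14 * fact (card S) * card P"
    unfolding sum.distrib by (intro add_mono half P)
  finally show ?thesis by (simp add: algebra_simps)
qed

definition xcross_at :: "(real^2) set \<Rightarrow> (real^2) set \<Rightarrow> real^2 \<Rightarrow> real^2 \<Rightarrow> ((real^2) \<times> (real^2) \<times> (real^2)) set" where
  "xcross_at R Q s t = {(p, a, b). (p, s, a, t, b) \<in> xcross R Q}"

lemma sum_xcross_at:
  assumes "finite R" "finite Q"
  shows "(\<Sum>s\<in>R. \<Sum>t\<in>Q. card (xcross_at R Q s t)) = card (xcross R Q)" and "finite (xcross_at R Q s t)"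
proof -
  have fx: "finite (xcross R Q)" using card_xcross_le[OF assms] by blast
  define f where "f = (\<lambda>(p :: real^2, s :: real^2, a :: real^2, t :: real^2, b :: real^2). (p, a, b))"
  have "xcross_at R Q s t \<subseteq> f ` xcross R Q" for s t by (force simp: f_def xcross_at_def)
  then show fin: "finite (xcross_at R Q s t)" for s t
    by (rule finite_subset[OF _ finite_imageI[OF fx]])
  define g where "g = (\<lambda>(p :: real^2, s :: real^2, a :: real^2, t :: real^2, b :: real^2). (s, t, p, a, b))"
  have "inj_on g (xcross R Q)" by (auto simp: g_def inj_on_def)
  then have "card (xcross R Q) = card (g ` xcross R Q)" by (simp add: card_image)
  also have "g ` xcross R Q = Sigma R (\<lambda>s. Sigma Q (\<lambda>t. xcross_at R Q s t))"
    by (auto simp: g_def xcross_at_def xcross_def image_iff)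
  also have "card \<dots> = (\<Sum>s\<in>R. \<Sum>t\<in>Q. card (xcross_at R Q s t))"
    using assms fin by (simp add: card_SigmaI)
  finally show "(\<Sum>s\<in>R. \<Sum>t\<in>Q. card (xcross_at R Q s t)) = card (xcross R Q)" by simp
qed

text \<open>Swaps inside one sample leave the other in place, so the average can be taken over
  \<open>P\<close> and then over \<open>Q\<close>, which turns the crossings at two given sites into
  all crossings. The constant is \<open>56 = 4 * 14\<close>.\<close>

lemma sum_xcross_permutations_le:
  assumes S: "finite S" and P: "P \<subseteq> {..<card S}" "a \<in> P" and Q: "Q \<subseteq> {..<card S}" "b \<in> Q" and PQ: "P \<inter> Q = {}"
  shows "card P * card Q * (\<Sum>xs\<in>permutations_of_set S. card (xcross_at (nth xs ` P) (nth xs ` Q) (xs ! a) (xs ! b)))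
    \<le> 56 * fact (card S) * (card P + card Q)"
proof -
  let ?X = "\<lambda>xs s t. card (xcross_at (nth xs ` P) (nth xs ` Q) s t)"
  have fin: "finite P" "finite Q" using P Q finite_subset by blast+
  have invP: "nth (permute_list (Transposition.transpose i j) xs) ` P = nth xs ` P \<and> nth (permute_list (Transposition.transpose i j) xs) ` Q = nth xs ` Q \<and>
      (\<forall>m\<in>Q. permute_list (Transposition.transpose i j) xs ! m = xs ! m)"
    if xs: "xs \<in> permutations_of_set S" "i \<in> P" "j \<in> P"
      and PQ: "P \<subseteq> {..<card S}" "Q \<subseteq> {..<card S}" "P \<inter> Q = {}" for xs i j P Q
  proof (intro conjI ballI)
    have l: "length xs = card S" by (rule length_finite_permutations_of_set[OF xs(1)])
    show "nth (permute_list (Transposition.transpose i j) xs) ` P = nth xs ` P"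
      using xs PQ l by (intro image_nth_permute_transpose) auto
    show "nth (permute_list (Transposition.transpose i j) xs) ` Q = nth xs ` Q"
      using xs PQ l by (intro image_nth_permute_transpose_disjoint) auto
    fix m assume m: "m \<in> Q"
    have "Transposition.transpose i j permutes {..<length xs}" using xs PQ l by (intro permutes_swap_id) auto
    moreover have "m < length xs" "m \<noteq> i" "m \<noteq> j" using m xs PQ l by auto
    ultimately show "permute_list (Transposition.transpose i j) xs ! m = xs ! m"
      by (simp add: permute_list_nth)
  qed
  have "card Q * (card P * (\<Sum>xs\<in>permutations_of_set S. ?X xs (xs ! a) (xs ! b)))
    = card Q * (\<Sum>xs\<in>permutations_of_set S. \<Sum>s\<in>nth xs ` P. ?X xs s (xs ! b))"
  proof (rule arg_cong[where f = "(*) (card Q)"], rule sum_permutations_nth_average[OF S P, where H = "\<lambda>xs s. ?X xs s (xs ! b)"])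
    fix xs i j assume "xs \<in> permutations_of_set S" "i \<in> P" "j \<in> P"
    from invP[OF this P(1) Q(1) PQ] show "(\<lambda>s. ?X (permute_list (Transposition.transpose i j) xs) s (permute_list (Transposition.transpose i j) xs ! b)) = (\<lambda>s. ?X xs s (xs ! b))"
      using Q(2) by simp
  qed
  also have "\<dots> = (\<Sum>xs\<in>permutations_of_set S. \<Sum>t\<in>nth xs ` Q. \<Sum>s\<in>nth xs ` P. ?X xs s t)"
  proof (rule sum_permutations_nth_average[OF S Q, where H = "\<lambda>xs t. \<Sum>s\<in>nth xs ` P. ?X xs s t"])
    fix xs i j assume "xs \<in> permutations_of_set S" "i \<in> Q" "j \<in> Q"
    from invP[OF this Q(1) P(1)] show "(\<lambda>t. \<Sum>s\<in>nth (permute_list (Transposition.transpose i j) xs) ` P. ?X (permute_list (Transposition.transpose i j) xs) s t) =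
      (\<lambda>t. \<Sum>s\<in>nth xs ` P. ?X xs s t)"
      using PQ by (simp add: Int_commute)
  qed
  also have "\<dots> = (\<Sum>xs\<in>permutations_of_set S. card (xcross (nth xs ` P) (nth xs ` Q)))"
  proof (rule sum.cong)
    fix xs
    show "(\<Sum>t\<in>nth xs ` Q. \<Sum>s\<in>nth xs ` P. ?X xs s t) = card (xcross (nth xs ` P) (nth xs ` Q))"
      unfolding sum_xcross_at(1)[OF finite_imageI[OF fin(1)] finite_imageI[OF fin(2)], symmetric] by (rule sum.swap)
  qed simp
  also have "\<dots> \<le> (\<Sum>xs\<in>permutations_of_set S. 4 * card (opairs (nth xs ` P) (nth xs ` Q)))"
    by (rule sum_mono, rule conjunct2[OF card_xcross_le]) (use fin in auto)
  also have "\<dots> \<le> 4 * (14 * fact (card S) * (card P + card Q))"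
    unfolding sum_distrib_left[symmetric] by (intro mult_left_mono sum_opairs_permutations_le S P Q PQ) simp
  finally show ?thesis by (simp add: algebra_simps)
qed

text \<open>Read as a probability: each site of \<open>W\<close> may have only one admissible
  colour, which costs a factor \<open>1 / N\<close>, and each site of \<open>Z\<close> loses at most
  two colours. By Bernoulli's inequality all of \<open>Z\<close> complies with probability at least
  \<open>1 - 2 * card Z / N\<close>, and \<open>4 * card Z \<le> N\<close> makes this at least
  1/2.\<close>

lemma coloring_count:
  fixes N :: nat
  assumes W: "W \<subseteq> {..<n}" "Z \<subseteq> {..<n}" "W \<inter> Z = {}" and N: "4 * card Z \<le> N" "N > 0"
    and A: "\<And>u. u < n \<Longrightarrow> finite (A u)" "\<And>u. u \<in> W \<Longrightarrow> card (A u) \<ge> 1" "\<And>u. u \<in> Z \<Longrightarrow> card (A u) + 2 \<ge> N"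
      "\<And>u. u < n \<Longrightarrow> u \<notin> W \<Longrightarrow> u \<notin> Z \<Longrightarrow> card (A u) \<ge> N"
  shows "N ^ n \<le> 2 * N ^ card W * card (PiE {..<n} A)"
proof -
  define Y where "Y = {..<n} - (W \<union> Z)"
  have fin: "finite W" "finite Z" "finite Y" using W(1,2) by (auto simp: Y_def intro: finite_subset)
  have dec: "{..<n} = (W \<union> Z) \<union> Y" using W by (auto simp: Y_def)
  have "card {..<n} = card W + card Z + card Y"
    unfolding dec using fin W(3) by (subst card_Un_disjoint; (subst card_Un_disjoint)?) (auto simp: Y_def)
  then have n: "n = card W + card Z + card Y" by simp
  have "card (PiE {..<n} A) = (\<Prod>u<n. card (A u))" by (simp add: card_PiE)
  also have "\<dots> = (\<Prod>u\<in>W. card (A u)) * (\<Prod>u\<in>Z. card (A u)) * (\<Prod>u\<in>Y. card (A u))"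
    unfolding dec using fin W(3) by (subst prod.union_disjoint; (subst prod.union_disjoint)?) (auto simp: Y_def)
  finally have c: "real (card (PiE {..<n} A)) = (\<Prod>u\<in>W. real (card (A u))) * (\<Prod>u\<in>Z. real (card (A u))) * (\<Prod>u\<in>Y. real (card (A u)))"
    by simp
  have pW: "(\<Prod>u\<in>W. real (card (A u))) \<ge> 1" using A(2) by (intro prod_ge_1) force
  have "(\<Prod>u\<in>Y. real (card (A u))) \<ge> (\<Prod>u\<in>Y. real N)" using A(4) by (intro prod_mono) (auto simp: Y_def)
  then have pY: "(\<Prod>u\<in>Y. real (card (A u))) \<ge> real N ^ card Y" by simp
  have pZ: "2 * (\<Prod>u\<in>Z. real (card (A u))) \<ge> real N ^ card Z"
  \<comment> \<open>With \<open>Z\<close> empty, \<open>N\<close> may be as small as 1. Otherwise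
    the hypothesis forces \<open>N \<ge> 4\<close>, so that Bernoulli's inequality applies and
    \<open>N - 2\<close> is nonnegative.\<close>
  proof (cases "card Z = 0")
    case True
    then show ?thesis using fin by simp
  next
    case False
    then have N4: "N \<ge> 4" using N by simp
    have r: "- 1 \<le> - 2 / real N" using N4 by (simp add: field_simps)
    have "1 / 2 \<le> 1 + real (card Z) * (- 2 / real N)" using N by (simp add: field_simps)
    also have "\<dots> \<le> (1 + - 2 / real N) ^ card Z" by (rule Bernoulli_inequality[OF r])
    finally have "real N ^ card Z * (1 / 2) \<le> real N ^ card Z * (1 + - 2 / real N) ^ card Z"
      by (intro mult_left_mono) auto
    also have "\<dots> = (real N - 2) ^ card Z"
    proof -
      have "real N * (1 + - 2 / real N) = real N - 2" using N by (simp add: field_simps)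
      then show ?thesis by (metis power_mult_distrib)
    qed
    also have "\<dots> = (\<Prod>u\<in>Z. real N - 2)" by simp
    also have "\<dots> \<le> (\<Prod>u\<in>Z. real (card (A u)))"
    proof (rule prod_mono)
      fix u assume "u \<in> Z"
      then show "0 \<le> real N - 2 \<and> real N - 2 \<le> real (card (A u))" using A(3)[of u] N4 by linarith
    qed
    finally show ?thesis by simp
  qed
  have "real N ^ card Z * real N ^ card Y \<le> (2 * (\<Prod>u\<in>Z. real (card (A u)))) * (\<Prod>u\<in>Y. real (card (A u)))"
    by (intro mult_mono pZ pY) (auto intro!: prod_nonneg)
  also have "\<dots> \<le> (\<Prod>u\<in>W. real (card (A u))) * ((2 * (\<Prod>u\<in>Z. real (card (A u)))) * (\<Prod>u\<in>Y. real (card (A u))))"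
    using mult_right_mono[OF pW, of "(2 * (\<Prod>u\<in>Z. real (card (A u)))) * (\<Prod>u\<in>Y. real (card (A u)))"]
    by (simp add: prod_nonneg)
  finally have "real N ^ card Z * real N ^ card Y \<le> 2 * real (card (PiE {..<n} A))"
    unfolding c by (simp add: mult_ac)
  then have "real N ^ card W * (real N ^ card Z * real N ^ card Y) \<le> real N ^ card W * (2 * real (card (PiE {..<n} A)))"
    by (intro mult_left_mono) auto
  then have "real (N ^ n) \<le> real (2 * N ^ card W * card (PiE {..<n} A))"
    unfolding n by (simp add: power_add mult_ac)
  then show ?thesis by (simp only: of_nat_le_iff)
qed

text \<open>With \<open>K\<close> the number of colourings, the third assumption says that each
  \<open>t\<close> survives a random colouring with probability at least \<open>1 / M\<close>;
  exchanging the sums gives the bound. Finiteness comes along, since \<open>K > 0\<close> places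
  every \<open>t\<close> in some \<open>X c\<close>.\<close>

lemma double_count:
  assumes "finite C" "\<And>c. c \<in> C \<Longrightarrow> finite (X c)" "\<And>t. t \<in> T \<Longrightarrow> K \<le> M * card {c \<in> C. t \<in> X c}" "K > 0"
  shows "finite T \<and> K * card T \<le> M * (\<Sum>c\<in>C. card (X c))"
proof
  have "T \<subseteq> (\<Union>c\<in>C. X c)"
  proof
    fix t assume "t \<in> T"
    then have "card {c \<in> C. t \<in> X c} \<noteq> 0"
      using assms(3)[of t] assms(4) by (metis mult_0_right not_le)
    then have "{c \<in> C. t \<in> X c} \<noteq> {}" by (metis card.empty)
    then show "t \<in> (\<Union>c\<in>C. X c)" by blast
  qed
  then show fT: "finite T" using assms finite_subset by blast
  have "K * card T = (\<Sum>t\<in>T. K)" by simp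
  also have "\<dots> \<le> (\<Sum>t\<in>T. M * card {c \<in> C. t \<in> X c})" by (rule sum_mono) (use assms in auto)
  also have "\<dots> = M * (\<Sum>t\<in>T. card {c \<in> C. t \<in> X c})" by (simp add: sum_distrib_left)
  also have "(\<Sum>t\<in>T. card {c \<in> C. t \<in> X c}) = (\<Sum>c\<in>C. card {t \<in> T. t \<in> X c})"
    by (rule sum_multicount_gen) (use fT assms in auto)
  also have "\<dots> \<le> (\<Sum>c\<in>C. card (X c))"
    using assms by (intro sum_mono card_mono) auto
  finally show "K * card T \<le> M * (\<Sum>c\<in>C. card (X c))" by simp
qed

text \<open>Position \<open>i\<close> itself is included, so for \<open>c i = v\<close> the
  cardinality is the rank of \<open>i\<close> in its colour class, counted from 1.\<close>

definition marked :: "(nat \<Rightarrow> nat) \<Rightarrow> nat \<Rightarrow> nat \<Rightarrow> nat set" where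
  "marked c v i = {u. u \<le> i \<and> c u = v}"

text \<open>The ranks within one colour class are pairwise distinct numbers between 1 and
  \<open>n\<close>, so their reciprocals form part of the harmonic sum.\<close>

lemma sum_inverse_rank_le:
  assumes "A \<subseteq> {i. i < n \<and> c i = v}"
  shows "(\<Sum>i\<in>A. 1 / real (card (marked c v i))) \<le> harm n"
proof -
  let ?f = "\<lambda>i. card (marked c v i)"
  have fin: "finite (marked c v i)" for i by (rule finite_subset[of _ "{..i}"]) (auto simp: marked_def)
  have lt: "?f i < ?f j" if "i < j" "j \<in> A" for i j
  proof (rule psubset_card_mono[OF fin])
    have "j \<in> marked c v j" "j \<notin> marked c v i" using that assms by (auto simp: marked_def)
    moreover have "marked c v i \<subseteq> marked c v j" using that by (auto simp: marked_def)
    ultimately show "marked c v i \<subset> marked c v j" by blast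
  qed
  have inj: "inj_on ?f A" by (rule inj_onI) (metis lt less_irrefl linorder_neqE_nat)
  have sub: "?f ` A \<subseteq> {1..n}"
  proof clarify
    fix i assume i: "i \<in> A"
    have "marked c v i \<subseteq> {..<n}" using i assms by (auto simp: marked_def)
    from card_mono[OF _ this] have "?f i \<le> n" by simp
    moreover have "i \<in> marked c v i" using i assms by (auto simp: marked_def)
    then have "?f i \<noteq> 0" using fin by auto
    ultimately show "?f i \<in> {1..n}" by simp
  qed
  have "(\<Sum>i\<in>A. 1 / real (?f i)) = (\<Sum>m\<in>?f ` A. inverse (real m))"
    using inj by (simp add: sum.reindex inverse_eq_divide)
  also have "\<dots> \<le> (\<Sum>m\<in>{1..n}. inverse (real m))" by (rule sum_mono2) (use sub in auto)
  finally show ?thesis by (simp add: harm_def)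
qed

section \<open>Shallow ties and crossings, and their survival in random samples\<close>

definition shallow_ties :: "nat \<Rightarrow> (real^2) list \<Rightarrow> ((real^2) \<times> nat) set" where
  "shallow_ties k xs = {(p, i). i < length xs \<and>
     card {u. u < i \<and> norm (p - xs ! u) < norm (p - xs ! i)} < k \<and>
     2 \<le> card {u. u < i \<and> norm (p - xs ! u) = norm (p - xs ! i)}}"

text \<open>Besides \<open>k - 1\<close> closer sites, one further earlier site may tie with \<open>xs ! i\<close>.\<close>

definition shallow_crossings :: "nat \<Rightarrow> (real^2) list \<Rightarrow> ((real^2) \<times> nat \<times> nat \<times> nat \<times> nat) set" where
  "shallow_crossings k xs = {(p, i, a, j, b). i < length xs \<and> j < length xs \<and> a < i \<and> b < j \<and>
     norm (p - xs ! i) = norm (p - xs ! a) \<and> norm (p - xs ! j) = norm (p - xs ! b) \<and>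
     norm (p - xs ! i) \<noteq> norm (p - xs ! j) \<and> cross2 (xs ! a - xs ! i) (xs ! b - xs ! j) \<noteq> 0 \<and>
     card {u. u < i \<and> u \<noteq> a \<and> norm (p - xs ! u) \<le> norm (p - xs ! i)} \<le> k \<and>
     card {u. u < j \<and> u \<noteq> b \<and> norm (p - xs ! u) \<le> norm (p - xs ! j)} \<le> k}"

text \<open>The colours 0 and 1 select two disjoint samples; all other colours discard a site.\<close>

definition colored_ties :: "(real^2) list \<Rightarrow> (nat \<Rightarrow> nat) \<Rightarrow> ((real^2) \<times> nat) set" where
  "colored_ties xs c = {(p, i). i < length xs \<and> c i = 0 \<and> (p, xs ! i) \<in> vvert (nth xs ` marked c 0 i)}"

definition colored_crossings :: "(real^2) list \<Rightarrow> (nat \<Rightarrow> nat) \<Rightarrow> ((real^2) \<times> nat \<times> nat \<times> nat \<times> nat) set" where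
  "colored_crossings xs c = {(p, i, a, j, b). i < length xs \<and> j < length xs \<and> a \<le> i \<and> b \<le> j \<and> c i = 0 \<and> c j = 1 \<and>
     (p, xs ! i, xs ! a, xs ! j, xs ! b) \<in> xcross (nth xs ` marked c 0 i) (nth xs ` marked c 1 j)}"

lemma finite_marked [simp]: "finite (marked c v i)"
  by (rule finite_subset[of _ "{..i}"]) (auto simp: marked_def)

lemma card_colored_ties_le:
  "finite (colored_ties xs c) \<and> card (colored_ties xs c) \<le>
     (\<Sum>i | i < length xs \<and> c i = 0. card {p. (p, xs ! i) \<in> vvert (nth xs ` marked c 0 i)})"
proof -
  let ?I = "{i. i < length xs \<and> c i = 0}"
  let ?V = "\<lambda>i. {p. (p, xs ! i) \<in> vvert (nth xs ` marked c 0 i)}"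
  have eq: "(colored_ties xs c)\<inverse> = Sigma ?I ?V" by (auto simp: colored_ties_def)
  have fin: "finite (?V i)" for i
  proof (rule finite_subset)
    show "?V i \<subseteq> fst ` vvert (nth xs ` marked c 0 i)" by force
    show "finite (fst ` vvert (nth xs ` marked c 0 i))" by (intro finite_imageI card_vvert_le(2)) simp
  qed
  have "card (colored_ties xs c) = card ((colored_ties xs c)\<inverse>)" by simp
  also have "\<dots> = (\<Sum>i\<in>?I. card (?V i))" unfolding eq by (rule card_SigmaI) (use fin in auto)
  finally have 1: "card (colored_ties xs c) \<le> (\<Sum>i\<in>?I. card (?V i))" by simp
  have "finite ((colored_ties xs c)\<inverse>)" unfolding eq using fin by (intro finite_SigmaI) auto
  with 1 show ?thesis by simp
qed

lemma card_colored_crossings_le: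
  assumes d: "distinct xs"
  shows "finite (colored_crossings xs c) \<and> card (colored_crossings xs c) \<le>
     (\<Sum>i | i < length xs \<and> c i = 0. \<Sum>j | j < length xs \<and> c j = 1.
        card (xcross_at (nth xs ` marked c 0 i) (nth xs ` marked c 1 j) (xs ! i) (xs ! j)))"
proof -
  let ?I = "\<lambda>v. {i. i < length xs \<and> c i = v}"
  let ?X = "\<lambda>i j. xcross_at (nth xs ` marked c 0 i) (nth xs ` marked c 1 j) (xs ! i) (xs ! j)"
  define S where "S = Sigma (?I 0) (\<lambda>i. Sigma (?I 1) (\<lambda>j. ?X i j))"
  define f where "f = (\<lambda>(p :: real^2, i :: nat, a, j :: nat, b). (i, j, p, xs ! a, xs ! b))"
  have fin: "finite (?X i j)" for i j by (rule sum_xcross_at(2)) simp_all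
  have fS: "finite S" unfolding S_def using fin by (intro finite_SigmaI) auto
  have cS: "card S = (\<Sum>i\<in>?I 0. \<Sum>j\<in>?I 1. card (?X i j))"
    unfolding S_def using fin by (subst card_SigmaI) (auto intro!: sum.cong card_SigmaI finite_SigmaI)
  have inj: "inj_on f (colored_crossings xs c)"
    using d by (auto simp: inj_on_def f_def colored_crossings_def nth_eq_iff_index_eq)
  have sub: "f ` colored_crossings xs c \<subseteq> S"
    by (auto simp: f_def S_def colored_crossings_def xcross_at_def)
  show ?thesis using card_inj_on_le[OF inj sub fS] inj_on_finite[OF inj sub fS] cS by simp
qed

text \<open>Three sites of the circle are asked to have colour 0, which gives the exponent 3. The
  fewer than \<open>k\<close> closer earlier sites are asked to avoid it, which makes the circle
  empty in the sample.\<close>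

lemma shallow_ties_sampled:
  assumes d: "distinct xs" and k: "k \<ge> 1" and t: "t \<in> shallow_ties k xs"
  shows "(8 * k) ^ length xs \<le> 2 * (8 * k) ^ 3 * card {c \<in> {..<length xs} \<rightarrow>\<^sub>E {..<8 * k}. t \<in> colored_ties xs c}"
proof -
  let ?n = "length xs"
  obtain p i where t': "t = (p, i)" by (cases t)
  define Z where "Z = {u. u < i \<and> norm (p - xs ! u) < norm (p - xs ! i)}"
  define E where "E = {u. u < i \<and> norm (p - xs ! u) = norm (p - xs ! i)}"
  have i: "i < ?n" "card Z < k" "2 \<le> card E" using t by (auto simp: t' shallow_ties_def Z_def E_def)
  obtain W' where "W' \<subseteq> E" "card W' = 2" by (rule obtain_subset_with_card_n[OF i(3)])
  then obtain a b where ab: "a \<in> E" "b \<in> E" "a \<noteq> b" by (auto simp: card_2_iff)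
  define W where "W = {i, a, b}"
  have cW: "card W = 3" using ab by (auto simp: W_def E_def)
  define A where "A u = (if u \<in> W then {0} else if u \<in> Z then {1..<8 * k} else {..<8 * k})" for u
  have "(8 * k) ^ ?n \<le> 2 * (8 * k) ^ card W * card (PiE {..<?n} A)"
    by (rule coloring_count[where Z = Z])
       (use i ab k in \<open>auto simp: W_def Z_def E_def A_def\<close>)
  also have "card (PiE {..<?n} A) \<le> card {c \<in> {..<?n} \<rightarrow>\<^sub>E {..<8 * k}. t \<in> colored_ties xs c}"
  proof (rule card_mono)
    show "finite {c \<in> {..<?n} \<rightarrow>\<^sub>E {..<8 * k}. t \<in> colored_ties xs c}"
      by (rule finite_subset[of _ "{..<?n} \<rightarrow>\<^sub>E {..<8 * k}"]) (auto intro: finite_PiE)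
    show "PiE {..<?n} A \<subseteq> {c \<in> {..<?n} \<rightarrow>\<^sub>E {..<8 * k}. t \<in> colored_ties xs c}"
    proof
      fix c assume c: "c \<in> PiE {..<?n} A"
      have cA: "c u \<in> A u" if "u < ?n" for u using c that by auto
      have "A u \<subseteq> {..<8 * k}" for u using k by (auto simp: A_def)
      then have C: "c \<in> {..<?n} \<rightarrow>\<^sub>E {..<8 * k}" using c by (auto simp: PiE_iff)
      have lt: "u < ?n" if "u \<in> W" for u using that ab i by (auto simp: W_def E_def)
      have c0: "c u = 0" if "u \<in> W" for u using cA[OF lt[OF that]] that by (simp add: A_def)
      have le: "norm (p - xs ! i) \<le> norm (p - xs ! u)" if u: "u \<in> marked c 0 i" for u
      proof (rule ccontr)
        assume "\<not> ?thesis"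
        then have "u \<in> Z" using u by (cases "u = i") (auto simp: marked_def Z_def)
        moreover from this have "u \<notin> W" using ab by (auto simp: W_def Z_def E_def)
        ultimately have "c u \<noteq> 0" using cA[of u] i by (auto simp: A_def Z_def)
        then show False using u by (simp add: marked_def)
      qed
      have W': "W \<subseteq> marked c 0 i" using c0 ab by (auto simp: marked_def W_def E_def)
      have sub: "nth xs ` W \<subseteq> {u \<in> nth xs ` marked c 0 i. norm (p - u) = norm (p - xs ! i)}"
        using W' ab by (auto simp: W_def E_def)
      have "inj_on (nth xs) W" using d lt by (intro inj_on_nth) auto
      then have "card (nth xs ` W) = 3" using cW by (simp add: card_image)
      then have "card {u \<in> nth xs ` marked c 0 i. norm (p - u) = norm (p - xs ! i)} \<ge> 3"
        using card_mono[OF _ sub] by simp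
      moreover have "i \<in> marked c 0 i" using c0 by (simp add: W_def marked_def)
      ultimately have "t \<in> colored_ties xs c"
        using i le c0 by (auto simp: t' colored_ties_def vvert_def vcell_def W_def)
      then show "c \<in> {c \<in> {..<?n} \<rightarrow>\<^sub>E {..<8 * k}. t \<in> colored_ties xs c}" using C by simp
    qed
  qed
  finally show ?thesis using cW by simp
qed

text \<open>Each of the two pairs has at most \<open>k\<close> spoilers. The number of colours is
  four times \<open>2 * k\<close>, as \<open>coloring_count\<close> requires. Barring the spoilers
  from both colours leaves each pair as the two nearest sites of its sample, strictly ahead of the
  rest; the four prescribed colours give the exponent 4.\<close>

lemma shallow_crossings_sampled:
  assumes d: "distinct xs" and k: "k \<ge> 1" and t: "t \<in> shallow_crossings k xs"
  shows "(8 * k) ^ length xs \<le> 2 * (8 * k) ^ 4 * card {c \<in> {..<length xs} \<rightarrow>\<^sub>E {..<8 * k}. t \<in> colored_crossings xs c}"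
proof -
  let ?n = "length xs"
  obtain p i a j b where t': "t = (p, i, a, j, b)" by (cases t)
  define Z1 where "Z1 = {u. u < i \<and> u \<noteq> a \<and> norm (p - xs ! u) \<le> norm (p - xs ! i)}"
  define Z2 where "Z2 = {u. u < j \<and> u \<noteq> b \<and> norm (p - xs ! u) \<le> norm (p - xs ! j)}"
  have h: "i < ?n" "j < ?n" "a < i" "b < j" "norm (p - xs ! i) = norm (p - xs ! a)"
    "norm (p - xs ! j) = norm (p - xs ! b)" "norm (p - xs ! i) \<noteq> norm (p - xs ! j)"
    "cross2 (xs ! a - xs ! i) (xs ! b - xs ! j) \<noteq> 0" "card Z1 \<le> k" "card Z2 \<le> k"
    using t unfolding t' shallow_crossings_def Z1_def Z2_def mem_Collect_eq prod.case by blast+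
  \<comment> \<open>The two pairs lie on circles of different radius about \<open>p\<close>, so
    their sites are distinct.\<close>
  have ne: "i \<noteq> j" "i \<noteq> b" "a \<noteq> j" "a \<noteq> b" using h(5-7) by auto
  define W where "W = {i, a, j, b}"
  \<comment> \<open>A site of one pair may be a spoiler for the other pair, but its colour already
    keeps it out of that sample.\<close>
  define Z where "Z = (Z1 \<union> Z2) - W"
  have cW: "card W = 4" using h(3,4) ne by (simp add: W_def)
  have fZ: "finite Z1" "finite Z2" by (auto simp: Z1_def Z2_def)
  have "card Z \<le> card (Z1 \<union> Z2)" unfolding Z_def using fZ by (intro card_mono) auto
  also have "\<dots> \<le> k + k" by (intro card_Un_le_add h)
  finally have cZ: "4 * card Z \<le> 8 * k" by simp
  define A where "A u = (if u \<in> {i, a} then {0} else if u \<in> {j, b} then {1} else if u \<in> Z then {2..<8 * k} else {..<8 * k})" for u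
  have "(8 * k) ^ ?n \<le> 2 * (8 * k) ^ card W * card (PiE {..<?n} A)"
  proof (rule coloring_count[where Z = Z])
    show "W \<subseteq> {..<?n}" using h(1-4) by (auto simp: W_def)
    show "Z \<subseteq> {..<?n}" using h(1,2) by (auto simp: Z_def Z1_def Z2_def)
  qed (use cZ k in \<open>auto simp: W_def Z_def A_def\<close>)
  also have "card (PiE {..<?n} A) \<le> card {c \<in> {..<?n} \<rightarrow>\<^sub>E {..<8 * k}. t \<in> colored_crossings xs c}"
  proof (rule card_mono)
    show "finite {c \<in> {..<?n} \<rightarrow>\<^sub>E {..<8 * k}. t \<in> colored_crossings xs c}"
      by (rule finite_subset[of _ "{..<?n} \<rightarrow>\<^sub>E {..<8 * k}"]) (auto intro: finite_PiE)
    show "PiE {..<?n} A \<subseteq> {c \<in> {..<?n} \<rightarrow>\<^sub>E {..<8 * k}. t \<in> colored_crossings xs c}"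
    proof
      fix c assume c: "c \<in> PiE {..<?n} A"
      have cA: "c u \<in> A u" if "u < ?n" for u using c that by auto
      have "A u \<subseteq> {..<8 * k}" for u using k by (auto simp: A_def)
      then have C: "c \<in> {..<?n} \<rightarrow>\<^sub>E {..<8 * k}" using c by (auto simp: PiE_iff)
      have cc: "c i = 0" "c a = 0" "c j = 1" "c b = 1"
        using cA[of i] cA[of a] cA[of j] cA[of b] h(1-4) ne by (auto simp: A_def)
      have far: "norm (p - xs ! i) < norm (p - xs ! u)" if u: "u \<in> marked c 0 i" "u \<noteq> i" "u \<noteq> a" for u
      proof (rule ccontr)
        assume "\<not> ?thesis"
        then have "u \<in> Z1" using u by (auto simp: marked_def Z1_def)
        moreover have "u \<notin> {j, b}" using u cc by (auto simp: marked_def)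
        ultimately have "c u \<ge> 2" using cA[of u] h(1) u by (auto simp: A_def Z_def W_def Z1_def)
        then show False using u by (simp add: marked_def)
      qed
      have far': "norm (p - xs ! j) < norm (p - xs ! u)" if u: "u \<in> marked c 1 j" "u \<noteq> j" "u \<noteq> b" for u
      proof (rule ccontr)
        assume "\<not> ?thesis"
        then have "u \<in> Z2" using u by (auto simp: marked_def Z2_def)
        moreover have "u \<notin> {i, a}" using u cc by (auto simp: marked_def)
        ultimately have "c u \<ge> 2" using cA[of u] h(2) u by (auto simp: A_def Z_def W_def Z2_def)
        then show False using u by (simp add: marked_def)
      qed
      have m: "i \<in> marked c 0 i" "a \<in> marked c 0 i" "j \<in> marked c 1 j" "b \<in> marked c 1 j"
        using cc h(3,4) by (auto simp: marked_def)
      have "(p, xs ! i, xs ! a, xs ! j, xs ! b) \<in> xcross (nth xs ` marked c 0 i) (nth xs ` marked c 1 j)"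
        unfolding xcross_def mem_Collect_eq prod.case
        using m h(5,6,8) far far' by (intro conjI) blast+
      then have "t \<in> colored_crossings xs c"
        using h(1-4) cc by (simp add: t' colored_crossings_def)
      then show "c \<in> {c \<in> {..<?n} \<rightarrow>\<^sub>E {..<8 * k}. t \<in> colored_crossings xs c}" using C by simp
    qed
  qed
  finally show ?thesis using cW by simp
qed

lemma finite_shallow:
  assumes "distinct xs" "k \<ge> 1"
  shows "finite (shallow_ties k xs)" "finite (shallow_crossings k xs)"
    and "(8 * k) ^ length xs * card (shallow_ties k xs) \<le>
      2 * (8 * k) ^ 3 * (\<Sum>c\<in>{..<length xs} \<rightarrow>\<^sub>E {..<8 * k}. card (colored_ties xs c))"
    and "(8 * k) ^ length xs * card (shallow_crossings k xs) \<le>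
      2 * (8 * k) ^ 4 * (\<Sum>c\<in>{..<length xs} \<rightarrow>\<^sub>E {..<8 * k}. card (colored_crossings xs c))"
proof -
  let ?C = "{..<length xs} \<rightarrow>\<^sub>E {..<8 * k}"
  have C: "finite ?C" by (auto intro: finite_PiE)
  have pos: "(8 * k) ^ length xs > 0" using assms by simp
  have 1: "finite (shallow_ties k xs) \<and> (8 * k) ^ length xs * card (shallow_ties k xs) \<le>
      2 * (8 * k) ^ 3 * (\<Sum>c\<in>?C. card (colored_ties xs c))"
    by (rule double_count[OF C _ _ pos]) (use card_colored_ties_le shallow_ties_sampled[OF assms] in auto)
  have 2: "finite (shallow_crossings k xs) \<and> (8 * k) ^ length xs * card (shallow_crossings k xs) \<le>
      2 * (8 * k) ^ 4 * (\<Sum>c\<in>?C. card (colored_crossings xs c))"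
    by (rule double_count[OF C _ _ pos])
       (use card_colored_crossings_le[OF assms(1)] shallow_crossings_sampled[OF assms] in auto)
  show "finite (shallow_ties k xs)" "finite (shallow_crossings k xs)"
    "(8 * k) ^ length xs * card (shallow_ties k xs) \<le> 2 * (8 * k) ^ 3 * (\<Sum>c\<in>?C. card (colored_ties xs c))"
    "(8 * k) ^ length xs * card (shallow_crossings k xs) \<le> 2 * (8 * k) ^ 4 * (\<Sum>c\<in>?C. card (colored_crossings xs c))"
    using 1 2 by blast+
qed

text \<open>Colours belong to positions, not to sites. For a fixed colouring the samples therefore
  occupy fixed positions while the permutation varies, and each contributes a bounded average. The
  number of colourings cancels in the end; the constant is \<open>12 = 2 * 6\<close>.\<close>

lemma sum_shallow_ties_le:
  assumes S: "finite S" and k: "k \<ge> 1"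
  shows "(\<Sum>xs\<in>permutations_of_set S. card (shallow_ties k xs)) \<le> 12 * (8 * k) ^ 3 * card S * fact (card S)"
proof -
  let ?n = "card S" and ?Pm = "permutations_of_set S"
  let ?C = "{..<?n} \<rightarrow>\<^sub>E {..<8 * k}"
  have len: "length xs = ?n" if "xs \<in> ?Pm" for xs by (rule length_finite_permutations_of_set[OF that])
  have inner: "(\<Sum>xs\<in>?Pm. card (colored_ties xs c)) \<le> ?n * (6 * fact ?n)" for c
  proof -
    have "(\<Sum>xs\<in>?Pm. card (colored_ties xs c)) \<le>
      (\<Sum>xs\<in>?Pm. \<Sum>i | i < ?n \<and> c i = 0. card {p. (p, xs ! i) \<in> vvert (nth xs ` marked c 0 i)})"
    proof (rule sum_mono)
      fix xs assume xs: "xs \<in> ?Pm"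
      show "card (colored_ties xs c) \<le> (\<Sum>i\<in>{i. i < ?n \<and> c i = 0}. card {p. (p, xs ! i) \<in> vvert (nth xs ` marked c 0 i)})"
        using card_colored_ties_le[of xs c] unfolding len[OF xs] by blast
    qed
    also have "\<dots> = (\<Sum>i | i < ?n \<and> c i = 0. \<Sum>xs\<in>?Pm. card {p. (p, xs ! i) \<in> vvert (nth xs ` marked c 0 i)})"
      by (rule sum.swap)
    also have "\<dots> \<le> (\<Sum>i | i < ?n \<and> c i = 0. 6 * fact ?n)"
      by (rule sum_mono, rule sum_vvert_permutations_le[OF S]) (auto simp: marked_def)
    also have "\<dots> = card {i. i < ?n \<and> c i = 0} * (6 * fact ?n)" by simp
    also have "\<dots> \<le> ?n * (6 * fact ?n)"
      using card_mono[of "{..<?n}" "{i. i < ?n \<and> c i = 0}"] by (intro mult_right_mono) auto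
    finally show ?thesis .
  qed
  have "(8 * k) ^ ?n * (\<Sum>xs\<in>?Pm. card (shallow_ties k xs)) = (\<Sum>xs\<in>?Pm. (8 * k) ^ ?n * card (shallow_ties k xs))"
    by (rule sum_distrib_left)
  also have "\<dots> \<le> (\<Sum>xs\<in>?Pm. 2 * (8 * k) ^ 3 * (\<Sum>c\<in>?C. card (colored_ties xs c)))"
  proof (rule sum_mono)
    fix xs assume xs: "xs \<in> ?Pm"
    show "(8 * k) ^ ?n * card (shallow_ties k xs) \<le> 2 * (8 * k) ^ 3 * (\<Sum>c\<in>?C. card (colored_ties xs c))"
      using finite_shallow(3)[OF permutations_of_setD(2)[OF xs] k] unfolding len[OF xs] .
  qed
  also have "\<dots> = 2 * (8 * k) ^ 3 * (\<Sum>c\<in>?C. \<Sum>xs\<in>?Pm. card (colored_ties xs c))"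
    unfolding sum_distrib_left[symmetric] by (subst sum.swap) (rule refl)
  also have "\<dots> \<le> 2 * (8 * k) ^ 3 * (\<Sum>c\<in>?C. ?n * (6 * fact ?n))"
    by (intro mult_left_mono sum_mono inner) auto
  also have "\<dots> = (8 * k) ^ ?n * (12 * (8 * k) ^ 3 * ?n * fact ?n)"
    by (simp add: card_PiE)
  finally show ?thesis using k by simp
qed

text \<open>For a fixed colouring, a pair of positions of ranks \<open>x\<close> and
  \<open>y\<close> in the two colour classes has on average \<open>O(1 / x + 1 / y)\<close>
  crossings. Each reciprocal sums to at most \<open>harm n\<close> over its own class, and the other
  class contributes at most a factor \<open>n\<close>. The constant is
  \<open>224 = 2 * 2 * 56\<close>.\<close>

lemma sum_shallow_crossings_le:
  assumes S: "finite S" and k: "k \<ge> 1"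
  shows "real (\<Sum>xs\<in>permutations_of_set S. card (shallow_crossings k xs)) \<le>
    224 * (8 * real k) ^ 4 * real (card S) * harm (card S) * fact (card S)"
proof -
  let ?n = "card S" and ?Pm = "permutations_of_set S"
  let ?C = "{..<?n} \<rightarrow>\<^sub>E {..<8 * k}"
  let ?I = "\<lambda>c v. {i. i < ?n \<and> c i = v}"
  have len: "length xs = ?n" if "xs \<in> ?Pm" for xs by (rule length_finite_permutations_of_set[OF that])
  have cI: "real (card (?I c v)) \<le> real ?n" for c :: "nat \<Rightarrow> nat" and v
    using card_mono[of "{..<?n}" "?I c v"] by auto
  let ?X = "\<lambda>c xs i j. card (xcross_at (nth xs ` marked c 0 i) (nth xs ` marked c 1 j) (xs ! i) (xs ! j))"
  let ?m = "\<lambda>c v i. real (card (marked c v i))"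
  have recip: "s \<le> K * (1 / x + 1 / y)" if "x * y * s \<le> K * (x + y)" "x > 0" "y > 0" for x y s K :: real
  proof -
    have "s \<le> (K * (x + y)) / (x * y)" using that by (simp add: pos_le_divide_eq mult.commute)
    also have "\<dots> = K * (1 / x + 1 / y)" using that by (simp add: field_simps)
    finally show ?thesis .
  qed
  have dist: "(\<Sum>i\<in>A. \<Sum>j\<in>B. K * (f i + g j)) = K * (real (card B) * sum f A + real (card A) * sum g B)"
    for A B :: "nat set" and f g :: "nat \<Rightarrow> real" and K :: real
    by (simp add: sum_distrib_left[symmetric] sum.distrib)
  have one: "real (\<Sum>xs\<in>?Pm. ?X c xs i j) \<le> 56 * fact ?n * (1 / ?m c 0 i + 1 / ?m c 1 j)"
    if i: "i \<in> ?I c 0" "j \<in> ?I c 1" for c i j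
  proof -
    have "card (marked c 0 i) * card (marked c 1 j) * (\<Sum>xs\<in>?Pm. ?X c xs i j)
       \<le> 56 * fact ?n * (card (marked c 0 i) + card (marked c 1 j))"
      by (rule sum_xcross_permutations_le[OF S]) (use i in \<open>auto simp: marked_def\<close>)
    then have "real (card (marked c 0 i) * card (marked c 1 j) * (\<Sum>xs\<in>?Pm. ?X c xs i j))
       \<le> real (56 * fact ?n * (card (marked c 0 i) + card (marked c 1 j)))" by (simp only: of_nat_le_iff)
    then have "?m c 0 i * ?m c 1 j * real (\<Sum>xs\<in>?Pm. ?X c xs i j) \<le> 56 * fact ?n * (?m c 0 i + ?m c 1 j)"
      by (simp only: of_nat_mult of_nat_add of_nat_fact of_nat_numeral)
    moreover have "i \<in> marked c 0 i" "j \<in> marked c 1 j" using i by (auto simp: marked_def)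
    then have "?m c 0 i > 0" "?m c 1 j > 0" by (auto simp: card_gt_0_iff)
    ultimately show ?thesis by (intro recip)
  qed
  have inner: "real (\<Sum>xs\<in>?Pm. card (colored_crossings xs c)) \<le> 112 * fact ?n * (real ?n * harm ?n)" for c
  proof -
    have "(\<Sum>xs\<in>?Pm. card (colored_crossings xs c)) \<le> (\<Sum>xs\<in>?Pm. \<Sum>i\<in>?I c 0. \<Sum>j\<in>?I c 1. ?X c xs i j)"
    proof (rule sum_mono)
      fix xs assume xs: "xs \<in> ?Pm"
      show "card (colored_crossings xs c) \<le> (\<Sum>i\<in>?I c 0. \<Sum>j\<in>?I c 1. ?X c xs i j)"
        using card_colored_crossings_le[OF permutations_of_setD(2)[OF xs], of c] unfolding len[OF xs] by blast
    qed
    also have "\<dots> = (\<Sum>i\<in>?I c 0. \<Sum>j\<in>?I c 1. \<Sum>xs\<in>?Pm. ?X c xs i j)"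
      by (subst sum.swap, rule sum.cong[OF refl], rule sum.swap)
    finally have "real (\<Sum>xs\<in>?Pm. card (colored_crossings xs c)) \<le> real (\<Sum>i\<in>?I c 0. \<Sum>j\<in>?I c 1. \<Sum>xs\<in>?Pm. ?X c xs i j)"
      by (simp only: of_nat_le_iff)
    also have "\<dots> = (\<Sum>i\<in>?I c 0. \<Sum>j\<in>?I c 1. real (\<Sum>xs\<in>?Pm. ?X c xs i j))" by simp
    also have "\<dots> \<le> (\<Sum>i\<in>?I c 0. \<Sum>j\<in>?I c 1. 56 * fact ?n * (1 / ?m c 0 i + 1 / ?m c 1 j))"
      by (intro sum_mono one)
    also have "\<dots> = 56 * fact ?n * (real (card (?I c 1)) * (\<Sum>i\<in>?I c 0. 1 / ?m c 0 i) +
       real (card (?I c 0)) * (\<Sum>j\<in>?I c 1. 1 / ?m c 1 j))"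
      by (rule dist)
    also have "\<dots> \<le> 56 * fact ?n * (real ?n * harm ?n + real ?n * harm ?n)"
      by (intro mult_left_mono add_mono mult_mono cI sum_inverse_rank_le) (auto intro: sum_nonneg)
    finally show ?thesis by (simp add: mult_ac)
  qed
  have "(8 * k) ^ ?n * (\<Sum>xs\<in>?Pm. card (shallow_crossings k xs)) = (\<Sum>xs\<in>?Pm. (8 * k) ^ ?n * card (shallow_crossings k xs))"
    by (rule sum_distrib_left)
  also have "\<dots> \<le> (\<Sum>xs\<in>?Pm. 2 * (8 * k) ^ 4 * (\<Sum>c\<in>?C. card (colored_crossings xs c)))"
  proof (rule sum_mono)
    fix xs assume xs: "xs \<in> ?Pm"
    show "(8 * k) ^ ?n * card (shallow_crossings k xs) \<le> 2 * (8 * k) ^ 4 * (\<Sum>c\<in>?C. card (colored_crossings xs c))"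
      using finite_shallow(4)[OF permutations_of_setD(2)[OF xs] k] unfolding len[OF xs] .
  qed
  also have "\<dots> = 2 * (8 * k) ^ 4 * (\<Sum>c\<in>?C. \<Sum>xs\<in>?Pm. card (colored_crossings xs c))"
    unfolding sum_distrib_left[symmetric] by (subst sum.swap) (rule refl)
  finally have "real ((8 * k) ^ ?n * (\<Sum>xs\<in>?Pm. card (shallow_crossings k xs))) \<le>
      real (2 * (8 * k) ^ 4 * (\<Sum>c\<in>?C. \<Sum>xs\<in>?Pm. card (colored_crossings xs c)))" by (simp only: of_nat_le_iff)
  also have "\<dots> = 2 * (8 * real k) ^ 4 * (\<Sum>c\<in>?C. real (\<Sum>xs\<in>?Pm. card (colored_crossings xs c)))" by simp
  also have "\<dots> \<le> 2 * (8 * real k) ^ 4 * (\<Sum>c\<in>?C. 112 * fact ?n * (real ?n * harm ?n))"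
    by (intro mult_left_mono sum_mono inner) auto
  also have "\<dots> = (8 * real k) ^ ?n * (224 * (8 * real k) ^ 4 * real ?n * harm ?n * fact ?n)"
    by (simp add: card_PiE)
  finally have "(8 * real k) ^ ?n * real (\<Sum>xs\<in>?Pm. card (shallow_crossings k xs)) \<le>
    (8 * real k) ^ ?n * (224 * (8 * real k) ^ 4 * real ?n * harm ?n * fact ?n)" by simp
  moreover have "(8 * real k) ^ ?n > 0" using k by simp
  ultimately show ?thesis by (rule mult_left_le_imp_le)
qed

section \<open>Boundaries of environments\<close>

definition closer_set :: "(real^2) set \<Rightarrow> real^2 \<Rightarrow> real^2 \<Rightarrow> (real^2) set" where
  "closer_set U s x = {u\<in>U. norm (x - u) < norm (x - s)}"

definition closer_eq_set :: "(real^2) set \<Rightarrow> real^2 \<Rightarrow> real^2 \<Rightarrow> (real^2) set" where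
  "closer_eq_set U s x = {u\<in>U. norm (x - u) \<le> norm (x - s)}"

definition site_env :: "nat \<Rightarrow> (real^2) set \<Rightarrow> real^2 \<Rightarrow> (real^2) set" where
  "site_env k U s = {x. card (closer_set U s x) < k}"

text \<open>The boundary in combinatorial form: \<open>s\<close> is among the \<open>k\<close>
  nearest if ties are resolved in its favour, and is not if they are resolved against it.\<close>

definition site_front :: "nat \<Rightarrow> (real^2) set \<Rightarrow> real^2 \<Rightarrow> (real^2) set" where
  "site_front k U s = {x. card (closer_set U s x) < k \<and> k \<le> card (closer_eq_set U s x)}"

lemma le_sorted_nth_iff:
  fixes ys :: "'a::linorder list"
  assumes "sorted ys" "1 \<le> k" "k \<le> length ys"
  shows "v \<le> ys ! (k - 1) \<longleftrightarrow> length (filter (\<lambda>y. y < v) ys) < k"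
proof -
  have len: "length (filter (\<lambda>y. y < v) ys) = card {i. i < length ys \<and> ys ! i < v}"
    by (rule length_filter_conv_card)
  show ?thesis
  proof
    assume v: "v \<le> ys ! (k - 1)"
    have "{i. i < length ys \<and> ys ! i < v} \<subseteq> {..<k - 1}"
    proof
      fix i assume "i \<in> {i. i < length ys \<and> ys ! i < v}"
      then have i: "i < length ys" "ys ! i < v" by auto
      show "i \<in> {..<k - 1}"
      proof (rule ccontr)
        assume "i \<notin> {..<k - 1}"
        then have "ys ! (k - 1) \<le> ys ! i" using assms i by (intro sorted_nth_mono) auto
        then show False using i v by auto
      qed
    qed
    from card_mono[OF _ this] have "card {i. i < length ys \<and> ys ! i < v} \<le> k - 1" by simp
    then show "length (filter (\<lambda>y. y < v) ys) < k" using len assms by linarith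
  next
    assume l: "length (filter (\<lambda>y. y < v) ys) < k"
    show "v \<le> ys ! (k - 1)"
    proof (rule ccontr)
      assume "\<not> v \<le> ys ! (k - 1)"
      then have lt: "ys ! (k - 1) < v" by simp
      have "{..<k} \<subseteq> {i. i < length ys \<and> ys ! i < v}"
      proof
        fix i assume "i \<in> {..<k}"
        then have "ys ! i \<le> ys ! (k - 1)" "i < length ys" using assms by (auto intro: sorted_nth_mono)
        then show "i \<in> {i. i < length ys \<and> ys ! i < v}" using lt by auto
      qed
      from card_mono[OF _ this] have "k \<le> card {i. i < length ys \<and> ys ! i < v}" by simp
      then show False using l len by linarith
    qed
  qed
qed

text \<open>Replaces the sorted list in \<open>kth_dist\<close> by a count of closer sites. If there
  are fewer than \<open>k\<close> sites the count is automatically small enough, in agreement with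
  the convention in \<open>nearest\<close>.\<close>

lemma nearest_iff:
  assumes T: "finite T" and k: "1 \<le> k"
  shows "s \<in> nearest k x T \<longleftrightarrow> s \<in> T \<and> card (closer_set T s x) < k"
proof (cases "card T < k")
  case True
  have "card (closer_set T s x) \<le> card T" unfolding closer_set_def using T by (intro card_mono) auto
  then show ?thesis using True by (auto simp: nearest_def)
next
  case False
  let ?M = "image_mset (\<lambda>s. norm (x - s)) (mset_set T)"
  let ?ys = "sorted_list_of_multiset ?M"
  have len: "length ?ys = card T"
    by (metis mset_sorted_list_of_multiset size_image_mset size_mset size_mset_set)
  have "length (filter (\<lambda>y. y < norm (x - s)) ?ys) = size (filter_mset (\<lambda>y. y < norm (x - s)) ?M)"
    by (metis mset_filter mset_sorted_list_of_multiset size_mset)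
  also have "\<dots> = size (filter_mset (\<lambda>u. norm (x - u) < norm (x - s)) (mset_set T))"
    by (simp add: filter_mset_image_mset)
  also have "\<dots> = card (closer_set T s x)" using T by (simp add: closer_set_def filter_mset_mset_set)
  finally have "norm (x - s) \<le> ?ys ! (k - 1) \<longleftrightarrow> card (closer_set T s x) < k"
    using le_sorted_nth_iff[of ?ys k "norm (x - s)"] k False len by simp
  then show ?thesis using False by (simp add: nearest_def kth_dist_def)
qed

lemma environment_eq:
  assumes "finite U" "1 \<le> k" "s \<notin> U"
  shows "environment k s (insert s U) = site_env k U s"
proof -
  have "closer_set (insert s U) s x = closer_set U s x" for x by (auto simp: closer_set_def)
  then show ?thesis using assms by (auto simp: environment_def site_env_def nearest_iff)
qed

text \<open>Expanding the square about \<open>s\<close> leaves a condition linear in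
  \<open>x - s\<close>, whose behaviour along a ray from \<open>s\<close> is visible.\<close>

lemma closer_iff_inner:
  fixes x :: "'a::real_inner"
  shows "norm (x - u) < norm (x - s) \<longleftrightarrow> (u - s) \<bullet> (u - s) < 2 * ((x - s) \<bullet> (u - s))"
    and "norm (x - u) \<le> norm (x - s) \<longleftrightarrow> (u - s) \<bullet> (u - s) \<le> 2 * ((x - s) \<bullet> (u - s))"
proof -
  have *: "(norm (x - u))\<^sup>2 = (norm (x - s))\<^sup>2 + (u - s) \<bullet> (u - s) - 2 * ((x - s) \<bullet> (u - s))"
    unfolding power2_norm_eq_inner by (simp add: inner_diff_left inner_diff_right inner_commute)
  have le: "norm (x - u) \<le> norm (x - s) \<longleftrightarrow> (norm (x - u))\<^sup>2 \<le> (norm (x - s))\<^sup>2"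
    by (metis abs_le_square_iff abs_norm_cancel)
  have le': "norm (x - s) \<le> norm (x - u) \<longleftrightarrow> (norm (x - s))\<^sup>2 \<le> (norm (x - u))\<^sup>2"
    by (metis abs_le_square_iff abs_norm_cancel)
  show "norm (x - u) \<le> norm (x - s) \<longleftrightarrow> (u - s) \<bullet> (u - s) \<le> 2 * ((x - s) \<bullet> (u - s))"
    unfolding le using * by linarith
  show "norm (x - u) < norm (x - s) \<longleftrightarrow> (u - s) \<bullet> (u - s) < 2 * ((x - s) \<bullet> (u - s))"
    using * le' by (smt (verit, best))
qed

text \<open>If \<open>u\<close> is at least as close as \<open>s\<close>, then \<open>z\<close> has
  a positive component towards \<open>u\<close>, and moving outwards makes \<open>u\<close> strictly
  closer.\<close>

lemma closer_eq_subset_closer_far: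
  assumes "s \<notin> U" "m > l" "l \<ge> 0"
  shows "closer_eq_set U s (s + l *\<^sub>R z) \<subseteq> closer_set U s (s + m *\<^sub>R z)"
proof
  fix u assume "u \<in> closer_eq_set U s (s + l *\<^sub>R z)"
  then have "u \<in> U" "norm (s + l *\<^sub>R z - u) \<le> norm (s + l *\<^sub>R z - s)" unfolding closer_eq_set_def by blast+
  then have u: "u \<in> U" "(u - s) \<bullet> (u - s) \<le> 2 * (l * (z \<bullet> (u - s)))"
    using closer_iff_inner(2)[of "s + l *\<^sub>R z" u s] by simp_all
  have "(u - s) \<bullet> (u - s) > 0" using u assms by auto
  then have "l * (z \<bullet> (u - s)) > 0" using u by linarith
  then have "z \<bullet> (u - s) > 0" using assms by (simp add: zero_less_mult_iff)
  then have "l * (z \<bullet> (u - s)) < m * (z \<bullet> (u - s))" using assms by simp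
  then have "(u - s) \<bullet> (u - s) < 2 * ((s + m *\<^sub>R z - s) \<bullet> (u - s))" using u by simp
  then show "u \<in> closer_set U s (s + m *\<^sub>R z)"
    unfolding closer_iff_inner(1)[symmetric] using u by (simp only: closer_set_def mem_Collect_eq)
qed

text \<open>The environment is strictly star-shaped, so each ray from \<open>s\<close> meets its boundary at most once.\<close>

lemma site_front_ray_unique:
  assumes U: "finite U" "s \<notin> U" and x: "s + l *\<^sub>R z \<in> site_front k U s" "s + m *\<^sub>R z \<in> site_front k U s" "l \<ge> 0" "m \<ge> 0"
  shows "l = m"
proof -
  have False if "s + l *\<^sub>R z \<in> site_front k U s" "s + m *\<^sub>R z \<in> site_front k U s" "l \<ge> 0" "l < m" for l m
  proof -
    have "card (closer_eq_set U s (s + l *\<^sub>R z)) \<le> card (closer_set U s (s + m *\<^sub>R z))"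
      using U closer_eq_subset_closer_far[OF U(2) that(4,3)]
      by (intro card_mono) (auto simp: closer_set_def)
    then show False using that by (auto simp: site_front_def)
  qed
  then show ?thesis using x by (metis linorder_neqE_linordered_idom)
qed

text \<open>Finitely many strict inequalities persist in a neighbourhood; only ties can be broken
  either way.\<close>

lemma eventually_closer_sets:
  assumes U: "finite U"
  shows "\<exists>r>0. \<forall>y\<in>ball x r. closer_set U s x \<subseteq> closer_set U s y \<and> closer_eq_set U s y \<subseteq> closer_eq_set U s x"
proof -
  define X where "X = (\<Inter>u\<in>closer_set U s x. {y. norm (y - u) < norm (y - s)}) \<inter>
    (\<Inter>u\<in>U - closer_eq_set U s x. {y. norm (y - s) < norm (y - u)})"
  have "open X" unfolding X_def
    using U by (intro open_Int open_INT ballI open_Collect_less continuous_intros) (auto simp: closer_set_def)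
  moreover have "x \<in> X" by (auto simp: X_def closer_set_def closer_eq_set_def)
  ultimately obtain r where r: "r > 0" "ball x r \<subseteq> X" using open_contains_ball by blast
  show ?thesis
  proof (intro exI conjI ballI)
    fix y assume "y \<in> ball x r"
    then have y: "y \<in> X" using r by blast
    show "closer_set U s x \<subseteq> closer_set U s y"
    proof
      fix u assume u: "u \<in> closer_set U s x"
      then have "norm (y - u) < norm (y - s)" using y unfolding X_def by blast
      then show "u \<in> closer_set U s y" using u by (simp add: closer_set_def)
    qed
    show "closer_eq_set U s y \<subseteq> closer_eq_set U s x"
    proof (rule ccontr)
      assume "\<not> ?thesis"
      then obtain u where u: "u \<in> closer_eq_set U s y" "u \<notin> closer_eq_set U s x" by blast
      then have "u \<in> U - closer_eq_set U s x" by (auto simp: closer_eq_set_def)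
      then have "norm (y - s) < norm (y - u)" using y unfolding X_def by blast
      then show False using u by (simp add: closer_eq_set_def)
    qed
  qed (rule r)
qed

lemma finite_closer [simp]: "finite U \<Longrightarrow> finite (closer_set U s x)" "finite U \<Longrightarrow> finite (closer_eq_set U s x)"
  by (auto simp: closer_set_def closer_eq_set_def)

text \<open>Semicontinuity of the two counts transfers the behaviour of nearby inner and outer
  points to a boundary point. Conversely, a small step outwards on the ray from \<open>s\<close>
  turns every tie against \<open>s\<close>.\<close>

lemma frontier_site_env:
  assumes U: "finite U" "s \<notin> U" and k: "1 \<le> k"
  shows "frontier (site_env k U s) = site_front k U s"
proof (intro set_eqI iffI)
  fix x assume x: "x \<in> frontier (site_env k U s)"
  obtain r where r: "r > 0" "\<forall>y\<in>ball x r. closer_set U s x \<subseteq> closer_set U s y \<and> closer_eq_set U s y \<subseteq> closer_eq_set U s x"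
    using eventually_closer_sets[OF U(1)] by blast
  obtain y y' where y: "y \<in> site_env k U s" "dist x y < r" "y' \<notin> site_env k U s" "dist x y' < r"
    using x r(1) unfolding frontier_straddle by blast
  have "card (closer_set U s x) \<le> card (closer_set U s y)" using r y U by (intro card_mono) auto
  moreover have "closer_set U s y' \<subseteq> closer_eq_set U s y'" by (auto simp: closer_set_def closer_eq_set_def)
  moreover have "closer_eq_set U s y' \<subseteq> closer_eq_set U s x" using r y by simp
  ultimately have "card (closer_set U s y') \<le> card (closer_eq_set U s x)" "card (closer_set U s x) \<le> card (closer_set U s y)"
    using U by (auto intro!: card_mono)
  then show "x \<in> site_front k U s" using y by (auto simp: site_env_def site_front_def)
next
  fix x assume x: "x \<in> site_front k U s"
  have xin: "x \<in> site_env k U s" using x by (simp add: site_front_def site_env_def)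
  show "x \<in> frontier (site_env k U s)"
    unfolding frontier_straddle
  proof (intro allI impI conjI)
    fix e :: real assume e: "e > 0"
    show "\<exists>y\<in>site_env k U s. dist x y < e" using xin e by (intro bexI[of _ x]) auto
    \<comment> \<open>The added 1 makes the step beyond \<open>x\<close> strictly shorter than
      \<open>e\<close>.\<close>
    define d where "d = e / (norm (x - s) + 1)"
    have nz: "norm (x - s) + 1 > 0" by (smt (verit) norm_ge_zero)
    have d: "d > 0" using e nz by (simp add: d_def)
    define y where "y = s + (1 + d) *\<^sub>R (x - s)"
    have sub: "closer_eq_set U s x \<subseteq> closer_set U s y"
      using closer_eq_subset_closer_far[OF U(2), of 1 "1 + d" "x - s"] d by (simp add: y_def)
    have "card (closer_eq_set U s x) \<le> card (closer_set U s y)"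
      using U by (intro card_mono[OF _ sub]) auto
    then have "y \<notin> site_env k U s" using x by (auto simp: site_front_def site_env_def)
    have "x - y = - (d *\<^sub>R (x - s))" by (simp add: y_def algebra_simps)
    then have "dist x y = d * norm (x - s)" using d by (simp add: dist_norm)
    moreover have "d * norm (x - s) < d * (norm (x - s) + 1)" using d by simp
    moreover have "d * (norm (x - s) + 1) = e" using nz by (simp add: d_def)
    ultimately have "dist x y < e" by simp
    with \<open>y \<notin> site_env k U s\<close> show "\<exists>y. y \<notin> site_env k U s \<and> dist x y < e" by blast
  qed
qed

lemma closed_site_front:
  assumes "finite U" "s \<notin> U" "1 \<le> k"
  shows "closed (site_front k U s)"
  using frontier_closed[of "site_env k U s"] frontier_site_env[OF assms] by simp

lemma closed_site_env:
  assumes "finite U" "s \<notin> U" "1 \<le> k"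
  shows "closed (site_env k U s)"
proof -
  have "frontier (site_env k U s) \<subseteq> site_env k U s"
    unfolding frontier_site_env[OF assms] by (auto simp: site_front_def site_env_def)
  then show ?thesis by (simp add: frontier_subset_eq)
qed

lemma site_front_tie:
  assumes "finite U" "x \<in> site_front k U s"
  shows "\<exists>u\<in>U. norm (x - u) = norm (x - s)"
proof (rule ccontr)
  assume "\<not> ?thesis"
  then have "closer_eq_set U s x = closer_set U s x" by (force simp: closer_set_def closer_eq_set_def)
  then show False using assms by (auto simp: site_front_def)
qed

text \<open>A tie at a point near \<open>p\<close> must be a tie at \<open>p\<close> already, since
  strict inequalities persist. So near \<open>p\<close> the boundary lies on finitely many bisectors
  through \<open>p\<close>.\<close>

lemma site_front_near:
  assumes U: "finite U"
  shows "\<exists>r>0. \<forall>x\<in>site_front k U s \<inter> ball p r. \<exists>u\<in>U. norm (p - u) = norm (p - s) \<and> (x - p) \<bullet> (u - s) = 0"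
proof -
  obtain r where r: "r > 0" "\<forall>y\<in>ball p r. closer_set U s p \<subseteq> closer_set U s y \<and> closer_eq_set U s y \<subseteq> closer_eq_set U s p"
    using eventually_closer_sets[OF U] by blast
  show ?thesis
  proof (intro exI conjI ballI)
    fix x assume x: "x \<in> site_front k U s \<inter> ball p r"
    obtain u where u: "u \<in> U" "norm (x - u) = norm (x - s)" using site_front_tie[OF U] x by blast
    have "u \<in> closer_eq_set U s x" "u \<notin> closer_set U s x" using u by (auto simp: closer_set_def closer_eq_set_def)
    then have "u \<in> closer_eq_set U s p" "u \<notin> closer_set U s p" using r x by blast+
    then have p: "norm (p - u) = norm (p - s)" by (auto simp: closer_set_def closer_eq_set_def)
    then have "(x - p) \<bullet> (u - s) = 0" using norm_less_iff_inner(3)[of p s u x] u by simp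
    then show "\<exists>u\<in>U. norm (p - u) = norm (p - s) \<and> (x - p) \<bullet> (u - s) = 0" using u p by blast
  qed (rule r)
qed

text \<open>A short piece of each ray from \<open>s\<close> through a neighbour \<open>z\<close> of the boundary point \<open>y\<close> leaves the
  environment, and where it does so it must meet the line.\<close>

lemma site_front_locally_line:
  assumes U: "finite U" "s \<notin> U" and k: "1 \<le> k" and y: "y \<in> site_front k U s"
    and r: "r > 0" "site_front k U s \<inter> ball y r \<subseteq> {x. (x - y) \<bullet> n = 0}" and n: "n \<noteq> 0"
  shows "(s - y) \<bullet> n \<noteq> 0 \<and> (\<exists>r'>0. r' \<le> r \<and> site_front k U s \<inter> ball y r' = {x. (x - y) \<bullet> n = 0} \<inter> ball y r')"
proof -
  let ?F = "site_front k U s" and ?E = "site_env k U s"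
  define N where "N = norm (y - s) + 1"
  have N: "N > 0" "norm (y - s) < N" unfolding N_def by (smt (verit) norm_ge_zero)+
  \<comment> \<open>Small enough that, on rays through points near \<open>y\<close>, the piece
    between the factors \<open>1 - d\<close> and \<open>1 + d\<close> stays in
    \<open>ball y r\<close>.\<close>
  define d where "d = min (1 / 2) (r / (4 * N))"
  have d: "d > 0" "d \<le> 1 / 2" "d * N \<le> r / 4" using r N by (auto simp: d_def min_def field_simps)
  define y1 where "y1 = s + (1 - d) *\<^sub>R (y - s)"
  define y2 where "y2 = s + (1 + d) *\<^sub>R (y - s)"
  have "closer_eq_set U s y1 \<subseteq> closer_set U s y"
    using closer_eq_subset_closer_far[OF U(2), of "1 - d" 1 "y - s"] d by (simp add: y1_def)
  then have c1: "card (closer_eq_set U s y1) < k"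
    using card_mono[OF finite_closer(1)[OF U(1)]] y unfolding site_front_def by (metis (mono_tags, lifting) le_less_trans mem_Collect_eq)
  have "closer_eq_set U s y \<subseteq> closer_set U s y2"
    using closer_eq_subset_closer_far[OF U(2), of 1 "1 + d" "y - s"] d by (simp add: y2_def)
  then have c2: "card (closer_set U s y2) \<ge> k"
    using card_mono[OF finite_closer(1)[OF U(1)]] y unfolding site_front_def by (metis (mono_tags, lifting) order.trans mem_Collect_eq)
  obtain r1 where r1: "r1 > 0" "\<forall>z\<in>ball y1 r1. closer_set U s y1 \<subseteq> closer_set U s z \<and> closer_eq_set U s z \<subseteq> closer_eq_set U s y1"
    using eventually_closer_sets[OF U(1)] by blast
  obtain r2 where r2: "r2 > 0" "\<forall>z\<in>ball y2 r2. closer_set U s y2 \<subseteq> closer_set U s z \<and> closer_eq_set U s z \<subseteq> closer_eq_set U s y2"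
    using eventually_closer_sets[OF U(1)] by blast
  define q where "q = min (r / 4) (min (r1 / 2) (r2 / 2))"
  have q: "q > 0" "q \<le> r / 4" "q \<le> r1 / 2" "q \<le> r2 / 2" using r r1 r2 by (auto simp: q_def)
  \<comment> \<open>\<open>z1\<close> and \<open>z2\<close> are the images of \<open>z\<close> under
    the dilations about \<open>s\<close> that take \<open>y\<close> to \<open>y1\<close> and
    \<open>y2\<close>. They inherit being inside and outside, so the boundary is met between them,
    close enough to \<open>y\<close> to lie on the line.\<close>
  have X: "\<exists>l>0. s + l *\<^sub>R (z - s) \<in> ?F \<and> (s + l *\<^sub>R (z - s) - y) \<bullet> n = 0" if z: "z \<in> ball y q" for z
  proof -
    have zy: "norm (z - y) < q" using z by (simp add: dist_norm norm_minus_commute)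
    define z1 where "z1 = s + (1 - d) *\<^sub>R (z - s)"
    define z2 where "z2 = s + (1 + d) *\<^sub>R (z - s)"
    have "z1 - y1 = (1 - d) *\<^sub>R (z - y)" by (simp add: z1_def y1_def algebra_simps)
    then have "norm (z1 - y1) = (1 - d) * norm (z - y)" using d by simp
    also have "\<dots> \<le> 1 * norm (z - y)" using d by (intro mult_right_mono) auto
    finally have "norm (z1 - y1) \<le> norm (z - y)" by simp
    then have "z1 \<in> ball y1 r1" using zy q by (simp add: dist_norm norm_minus_commute)
    then have "closer_eq_set U s z1 \<subseteq> closer_eq_set U s y1" using r1 by blast
    then have "card (closer_eq_set U s z1) < k"
      using c1 card_mono[OF finite_closer(2)[OF U(1)]] le_less_trans by blast
    moreover have "card (closer_set U s z1) \<le> card (closer_eq_set U s z1)"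
      using U by (intro card_mono) (auto simp: closer_set_def closer_eq_set_def)
    ultimately have z1: "z1 \<in> ?E" by (simp add: site_env_def)
    have "z2 - y2 = (1 + d) *\<^sub>R (z - y)" by (simp add: z2_def y2_def algebra_simps)
    then have "norm (z2 - y2) = (1 + d) * norm (z - y)" using d by simp
    also have "\<dots> \<le> 2 * norm (z - y)" using d by (intro mult_right_mono) auto
    finally have "norm (z2 - y2) \<le> 2 * norm (z - y)" .
    then have "z2 \<in> ball y2 r2" using zy q by (simp add: dist_norm norm_minus_commute)
    then have "closer_set U s y2 \<subseteq> closer_set U s z2" using r2 by blast
    then have z2: "z2 \<notin> ?E"
      using c2 card_mono[OF finite_closer(1)[OF U(1)]] by (simp add: site_env_def not_less) (meson order.trans)
    have "closed_segment z1 z2 \<inter> frontier ?E \<noteq> {}"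
      by (rule connected_Int_frontier) (use z1 z2 in auto)
    then obtain x where x: "x \<in> closed_segment z1 z2" "x \<in> ?F" unfolding frontier_site_env[OF U k] by blast
    obtain t where t: "0 \<le> t" "t \<le> 1" "x = (1 - t) *\<^sub>R z1 + t *\<^sub>R z2" using x(1) by (auto simp: closed_segment_def)
    define l where "l = 1 + (2 * t - 1) * d"
    have xl: "x = s + l *\<^sub>R (z - s)" unfolding t(3) z1_def z2_def l_def by (simp add: eq2_iff algebra_simps)
    have "\<bar>2 * t - 1\<bar> \<le> 1" using t by auto
    then have ld: "\<bar>l - 1\<bar> \<le> d" using d by (simp add: l_def abs_mult mult_left_le_one_le)
    have l0: "l > 0" "l \<le> 2" using ld d by auto
    have "x - y = l *\<^sub>R (z - y) + (l - 1) *\<^sub>R (y - s)" unfolding xl by (simp add: algebra_simps)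
    then have "norm (x - y) \<le> l * norm (z - y) + \<bar>l - 1\<bar> * norm (y - s)"
      using norm_triangle_ineq[of "l *\<^sub>R (z - y)" "(l - 1) *\<^sub>R (y - s)"] l0 by simp
    also have "\<dots> \<le> 2 * norm (z - y) + d * N"
      using l0 ld N d by (intro add_mono mult_mono) auto
    also have "\<dots> < r" using zy q d r by linarith
    finally have "x \<in> ball y r" by (simp add: dist_norm norm_minus_commute)
    then have "(x - y) \<bullet> n = 0" using x r by blast
    then show ?thesis using l0 x xl by blast
  qed
  \<comment> \<open>Were \<open>s\<close> on the line, a ray from \<open>s\<close> through a point
    off the line would never meet it again.\<close>
  have sn: "(s - y) \<bullet> n \<noteq> 0"
  proof
    assume s0: "(s - y) \<bullet> n = 0"
    obtain e where e: "e > 0" "y + e *\<^sub>R n \<in> ball y q"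
      using ex_move_in_open[of "ball y q" y n] q by auto
    obtain l where l: "l > 0" "(s + l *\<^sub>R (y + e *\<^sub>R n - s) - y) \<bullet> n = 0" using X[OF e(2)] by blast
    have "(s + l *\<^sub>R (y + e *\<^sub>R n - s) - y) \<bullet> n = (1 - l) * ((s - y) \<bullet> n) + l * e * (n \<bullet> n)"
      by (simp add: inner_diff_left inner_add_left algebra_simps)
    with s0 l e n show False by simp
  qed
  have "?F \<inter> ball y q = {x. (x - y) \<bullet> n = 0} \<inter> ball y q"
  proof
    show "?F \<inter> ball y q \<subseteq> {x. (x - y) \<bullet> n = 0} \<inter> ball y q" using r q by (auto simp: subset_iff)
    show "{x. (x - y) \<bullet> n = 0} \<inter> ball y q \<subseteq> ?F \<inter> ball y q"
    proof
      fix z assume "z \<in> {x. (x - y) \<bullet> n = 0} \<inter> ball y q"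
      then have z: "(z - y) \<bullet> n = 0" "z \<in> ball y q" by auto
      obtain l where l: "l > 0" "s + l *\<^sub>R (z - s) \<in> ?F" "(s + l *\<^sub>R (z - s) - y) \<bullet> n = 0" using X[OF z(2)] by blast
      have "(s + l *\<^sub>R (z - s) - y) \<bullet> n = (1 - l) * ((s - y) \<bullet> n) + l * ((z - y) \<bullet> n)"
        by (simp add: inner_diff_left inner_add_left algebra_simps)
      with l z sn have "l = 1" by simp
      then show "z \<in> ?F \<inter> ball y q" using l z by simp
    qed
  qed
  moreover have "q \<le> r" using q r by linarith
  ultimately show ?thesis using sn q by blast
qed

section \<open>Vertices of the overlay\<close>

lemma range_line_eq:
  assumes "v \<noteq> 0"
  shows "range (\<lambda>t::real. p + t *\<^sub>R v) = {x. (x - p) \<bullet> perp v = 0}"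
proof (intro set_eqI iffI)
  fix x assume "x \<in> range (\<lambda>t::real. p + t *\<^sub>R v)"
  then show "x \<in> {x. (x - p) \<bullet> perp v = 0}" by (auto simp: inner2)
next
  fix x assume "x \<in> {x. (x - p) \<bullet> perp v = 0}"
  define z where "z = x - p"
  have e: "z$2 * v$1 = z$1 * v$2" using \<open>x \<in> _\<close> by (simp add: z_def inner2 algebra_simps)
  have "(v$1)\<^sup>2 + (v$2)\<^sup>2 \<noteq> 0" using assms by (simp add: eq2_iff sum_power2_eq_zero_iff)
  then have vv: "v \<bullet> v \<noteq> 0" using assms by simp
  have "(v \<bullet> v) *\<^sub>R z = (z \<bullet> v) *\<^sub>R v"
    using e by (simp add: eq2_iff inner2 algebra_simps)
  then have "z = ((z \<bullet> v) / (v \<bullet> v)) *\<^sub>R v"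
    using vv by (simp add: eq2_iff field_simps)
  then have "x = p + ((z \<bullet> v) / (v \<bullet> v)) *\<^sub>R v" by (simp add: z_def algebra_simps)
  then show "x \<in> range (\<lambda>t::real. p + t *\<^sub>R v)" by blast
qed

text \<open>Passes from direction vectors to normal vectors, the form in which bisectors
  arise.\<close>

lemma locally_straight_iff:
  "locally_straight B p \<longleftrightarrow> (\<exists>n r. n \<noteq> 0 \<and> r > 0 \<and> B \<inter> ball p r = {x. (x - p) \<bullet> n = 0} \<inter> ball p r)"
proof
  assume "locally_straight B p"
  then obtain v r where "v \<noteq> 0" "r > 0" "B \<inter> ball p r = {x. (x - p) \<bullet> perp v = 0} \<inter> ball p r"
    unfolding locally_straight_def using range_line_eq by metis
  moreover have "perp v \<noteq> 0" using \<open>v \<noteq> 0\<close> by (auto simp: eq2_iff)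
  ultimately show "\<exists>n r. n \<noteq> 0 \<and> r > 0 \<and> B \<inter> ball p r = {x. (x - p) \<bullet> n = 0} \<inter> ball p r" by blast
next
  assume "\<exists>n r. n \<noteq> 0 \<and> r > 0 \<and> B \<inter> ball p r = {x. (x - p) \<bullet> n = 0} \<inter> ball p r"
  then obtain n r where n: "n \<noteq> 0" "r > 0" "B \<inter> ball p r = {x. (x - p) \<bullet> n = 0} \<inter> ball p r" by blast
  have pn: "perp n \<noteq> 0" using n by (auto simp: eq2_iff)
  have "perp (perp n) = - n" by (simp add: eq2_iff)
  then have "range (\<lambda>t::real. p + t *\<^sub>R perp n) = {x. (x - p) \<bullet> n = 0}"
    unfolding range_line_eq[OF pn] by simp
  then show "locally_straight B p" unfolding locally_straight_def using n pn by metis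
qed

lemma inner_parallel_zero:
  assumes "cross2 A B = 0" "A \<noteq> 0" "z \<bullet> A = 0"
  shows "z \<bullet> B = 0"
proof -
  have "(A \<bullet> A) * (z \<bullet> B) = (z \<bullet> A) * (A \<bullet> B) + (perp A \<bullet> z) * cross2 A B"
    by (simp add: inner2 cross2_def algebra_simps)
  with assms show ?thesis by simp
qed

text \<open>Positions are counted from 0 here: for distinct sites this is the boundary of
  \<open>env k xs (Suc i)\<close>.\<close>

definition front :: "nat \<Rightarrow> (real^2) list \<Rightarrow> nat \<Rightarrow> (real^2) set" where
  "front k xs i = site_front k (nth xs ` {..<i}) (xs ! i)"

definition curves :: "nat \<Rightarrow> (real^2) list \<Rightarrow> (real^2) set" where
  "curves k xs = (\<Union>i<length xs. front k xs i)"

text \<open>A vertex counts once for every boundary through it, since each such boundary may begin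
  or end edges there.\<close>

definition incidences :: "nat \<Rightarrow> (real^2) list \<Rightarrow> ((real^2) \<times> nat) set" where
  "incidences k xs = {(p, i). i < length xs \<and> p \<in> arr_vertices (curves k xs) \<and> p \<in> front k xs i}"

lemma nth_notin_earlier: "distinct xs \<Longrightarrow> i < length xs \<Longrightarrow> xs ! i \<notin> nth xs ` {..<i}"
  by (auto simp: nth_eq_iff_index_eq)

lemma card_earlier:
  assumes "distinct xs" "i < length xs"
  shows "card {u \<in> nth xs ` {..<i}. P u} = card {u. u < i \<and> P (xs ! u)}"
proof -
  have "{u \<in> nth xs ` {..<i}. P u} = nth xs ` {u. u < i \<and> P (xs ! u)}" by auto
  moreover have "inj_on (nth xs) {u. u < i \<and> P (xs ! u)}" using assms by (intro inj_on_nth) auto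
  ultimately show ?thesis by (simp add: card_image)
qed

lemma front_iff:
  assumes "distinct xs" "i < length xs"
  shows "p \<in> front k xs i \<longleftrightarrow> card {u. u < i \<and> norm (p - xs ! u) < norm (p - xs ! i)} < k \<and>
    k \<le> card {u. u < i \<and> norm (p - xs ! u) \<le> norm (p - xs ! i)}"
  unfolding front_def site_front_def closer_set_def closer_eq_set_def card_earlier[OF assms] by simp

lemma closed_front:
  assumes "distinct xs" "i < length xs" "1 \<le> k"
  shows "closed (front k xs i)"
  unfolding front_def using nth_notin_earlier[OF assms(1,2)] assms(3) by (intro closed_site_front) auto

lemma front_tie:
  assumes "p \<in> front k xs i"
  shows "\<exists>a<i. norm (p - xs ! a) = norm (p - xs ! i)"
  using site_front_tie[of "nth xs ` {..<i}" p k "xs ! i"] assms by (auto simp: front_def)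

text \<open>If every front through \<open>p\<close> followed the bisector of \<open>a\<close> and
  \<open>i\<close>, then all curves near \<open>p\<close> would lie on this line. The front of
  \<open>i\<close> alone fills the line near \<open>p\<close>, so \<open>p\<close> would not be a
  vertex.\<close>

lemma vertex_other_bisector:
  assumes d: "distinct xs" and k: "1 \<le> k" and p: "p \<in> arr_vertices (curves k xs)"
    and i: "i < length xs" "p \<in> front k xs i" and a: "a < i" "norm (p - xs ! a) = norm (p - xs ! i)"
    and only: "\<And>u. u < i \<Longrightarrow> norm (p - xs ! u) = norm (p - xs ! i) \<Longrightarrow> u = a"
  shows "\<exists>j<length xs. \<exists>b<j. p \<in> front k xs j \<and> norm (p - xs ! b) = norm (p - xs ! j) \<and>
    cross2 (xs ! b - xs ! j) (xs ! a - xs ! i) \<noteq> 0"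
proof (rule ccontr)
  assume neg: "\<not> ?thesis"
  define n where "n = xs ! a - xs ! i"
  have n: "n \<noteq> 0" using d i a by (simp add: n_def nth_eq_iff_index_eq)
  define L where "L = {x. (x - p) \<bullet> n = 0}"
  have ex: "\<exists>r>0. front k xs j \<inter> ball p r \<subseteq> L" if j: "j < length xs" for j
  proof (cases "p \<in> front k xs j")
    case False
    have "open (- front k xs j)" using closed_front[OF d j k] by (simp add: open_Compl)
    then obtain r where "r > 0" "ball p r \<subseteq> - front k xs j" using False open_contains_ball by blast
    then show ?thesis by blast
  next
    case True
    have "finite (nth xs ` {..<j})" by simp
    from site_front_near[OF this, of k "xs ! j" p] obtain r where r: "r > 0"
      "\<forall>x\<in>front k xs j \<inter> ball p r. \<exists>u\<in>nth xs ` {..<j}. norm (p - u) = norm (p - xs ! j) \<and> (x - p) \<bullet> (u - xs ! j) = 0"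
      unfolding front_def by blast
    have "front k xs j \<inter> ball p r \<subseteq> L"
    proof
      fix x assume "x \<in> front k xs j \<inter> ball p r"
      then obtain b where b: "b < j" "norm (p - xs ! b) = norm (p - xs ! j)" "(x - p) \<bullet> (xs ! b - xs ! j) = 0"
        using r(2) by blast
      then have "cross2 (xs ! b - xs ! j) n = 0" using neg True j unfolding n_def by blast
      moreover have "xs ! b - xs ! j \<noteq> 0" using d j b by (simp add: nth_eq_iff_index_eq)
      ultimately show "x \<in> L" using inner_parallel_zero b(3) by (simp add: L_def)
    qed
    then show ?thesis using r(1) by blast
  qed
  then obtain R where R: "\<And>j. j < length xs \<Longrightarrow> R j > 0 \<and> front k xs j \<inter> ball p (R j) \<subseteq> L" by metis
  define r where "r = Min (R ` {..<length xs})"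
  have fin: "finite (R ` {..<length xs})" "R ` {..<length xs} \<noteq> {}" using i by auto
  have "r \<in> R ` {..<length xs}" unfolding r_def by (rule Min_in[OF fin])
  then have r0: "r > 0" using R by auto
  have rle: "r \<le> R j" if "j < length xs" for j unfolding r_def using that by (intro Min_le fin) auto
  have sub: "front k xs j \<inter> ball p r \<subseteq> L" if "j < length xs" for j
    using R[OF that] rle[OF that] by (auto simp: subset_iff)
  have "finite (nth xs ` {..<i})" by simp
  from site_front_locally_line[OF this nth_notin_earlier[OF d i(1)] k i(2)[unfolded front_def] r0 sub[OF i(1), unfolded front_def L_def] n]
  obtain r' where r': "r' > 0" "r' \<le> r" "front k xs i \<inter> ball p r' = L \<inter> ball p r'"
    unfolding front_def L_def by blast
  have "curves k xs \<inter> ball p r' = L \<inter> ball p r'"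
  proof
    show "curves k xs \<inter> ball p r' \<subseteq> L \<inter> ball p r'"
      using sub r'(2) by (fastforce simp: curves_def)
    show "L \<inter> ball p r' \<subseteq> curves k xs \<inter> ball p r'"
      using r'(3) i(1) by (auto simp: curves_def)
  qed
  then have "locally_straight (curves k xs) p"
    unfolding locally_straight_iff using n r'(1) by (auto simp: L_def)
  then show False using p by (simp add: arr_vertices_def)
qed

text \<open>Serves to replace a site with many ties by the third site of the same circle.\<close>

lemma ex_third_element:
  fixes C :: "nat set"
  assumes "finite C" "card C \<ge> 3"
  shows "\<exists>m\<in>C. card {u\<in>C. u < m} = 2"
proof -
  define ys where "ys = sorted_list_of_set C"
  have ys: "sorted_wrt (<) ys" "set ys = C" "length ys = card C" using assms by (auto simp: ys_def)
  have lt: "ys ! i < ys ! j \<longleftrightarrow> i < j" if "i < length ys" "j < length ys" for i j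
    using ys(1) that by (metis linorder_neqE_nat less_asym less_irrefl sorted_wrt_iff_nth_less)
  have "{u\<in>C. u < ys ! 2} = {ys ! 0, ys ! 1}"
  proof
    show "{u\<in>C. u < ys ! 2} \<subseteq> {ys ! 0, ys ! 1}"
    proof
      fix u assume "u \<in> {u\<in>C. u < ys ! 2}"
      then obtain i where i: "i < length ys" "u = ys ! i" "ys ! i < ys ! 2" using ys(2) by (auto simp: in_set_conv_nth)
      then have "i < 2" using lt[of i 2] ys assms by simp
      then have "i = 0 \<or> i = 1" by linarith
      then show "u \<in> {ys ! 0, ys ! 1}" using i by auto
    qed
    have "ys ! 0 \<in> C" "ys ! 1 \<in> C" using ys assms by (metis Suc_le_lessD nth_mem numeral_3_eq_3 less_trans zero_less_Suc One_nat_def Suc_less_eq lessI)+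
    then show "{ys ! 0, ys ! 1} \<subseteq> {u\<in>C. u < ys ! 2}" using lt[of 0 2] lt[of 1 2] ys assms by simp
  qed
  moreover have "ys ! 0 \<noteq> ys ! 1" using lt[of 0 1] ys assms by auto
  moreover have "ys ! 2 \<in> C" using ys assms by (metis Suc_le_lessD nth_mem numeral_2_eq_2 numeral_3_eq_3)
  ultimately show ?thesis by (intro bexI[of _ "ys ! 2"]) simp_all
qed

text \<open>A front whose site has a single tie follows one bisector near \<open>p\<close>, so at a
  vertex another front must leave that line. Whether the site of that front lies on the same circle
  decides between the two kinds of charge.\<close>

lemma incidence_cases:
  assumes d: "distinct xs" and k: "1 \<le> k" and pi: "(p, i) \<in> incidences k xs" and nt: "(p, i) \<notin> shallow_ties k xs"
  shows "card {u. u < i \<and> norm (p - xs ! u) = norm (p - xs ! i)} = 1 \<and>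
    ((\<exists>j. (p, j) \<in> shallow_ties k xs \<and> norm (p - xs ! j) = norm (p - xs ! i)) \<or>
     (\<exists>j b a. (p, j, b, i, a) \<in> shallow_crossings k xs))"
proof -
  define Tie where "Tie j = {u. u < j \<and> norm (p - xs ! u) = norm (p - xs ! j)}" for j
  have fT: "finite (Tie j)" for j by (simp add: Tie_def)
  have i: "i < length xs" "p \<in> arr_vertices (curves k xs)" "p \<in> front k xs i"
    using pi by (auto simp: incidences_def)
  have depth: "card {u. u < j \<and> norm (p - xs ! u) < norm (p - xs ! j)} < k" if "j < length xs" "p \<in> front k xs j" for j
    using that front_iff[OF d] by blast
  have c1: "card (Tie i) < 2" using nt i(1) depth[OF i(1,3)] by (simp add: shallow_ties_def Tie_def)
  obtain a where a: "a < i" "norm (p - xs ! a) = norm (p - xs ! i)" using front_tie[OF i(3)] by blast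
  have aT: "a \<in> Tie i" using a by (simp add: Tie_def)
  then have c: "card (Tie i) = 1" using c1 fT by (metis One_nat_def card_gt_0_iff empty_iff less_2_cases less_irrefl)
  then have Ti: "Tie i = {a}" using aT by (metis card_1_singletonE singletonD)
  have only: "u = a" if "u < i" "norm (p - xs ! u) = norm (p - xs ! i)" for u
  proof -
    have "u \<in> Tie i" using that by (simp add: Tie_def)
    then show ?thesis by (simp add: Ti)
  qed
  obtain j b where j: "j < length xs" "b < j" "p \<in> front k xs j" "norm (p - xs ! b) = norm (p - xs ! j)"
    "cross2 (xs ! b - xs ! j) (xs ! a - xs ! i) \<noteq> 0"
    using vertex_other_bisector[OF d k i(2,1,3) a only] by blast
  have "(\<exists>j. (p, j) \<in> shallow_ties k xs \<and> norm (p - xs ! j) = norm (p - xs ! i)) \<or>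
     (\<exists>j b a. (p, j, b, i, a) \<in> shallow_crossings k xs)"
  \<comment> \<open>On a common circle \<open>a\<close> is the only site before \<open>i\<close>, so
    \<open>j\<close> comes later and has both \<open>i\<close> and \<open>a\<close> before it. On
    different circles the two bisectors form a crossing.\<close>
  proof (cases "norm (p - xs ! j) = norm (p - xs ! i)")
    case True
    have "j \<noteq> i"
    proof
      assume "j = i"
      then have "b = a" using only j by simp
      then show False using j(5) \<open>j = i\<close> by (simp add: cross2_def)
    qed
    moreover have "\<not> j < i"
    proof
      assume ji: "j < i"
      then have "j = a" using only True by simp
      moreover have "b = a" using only[of b] j(2,4) True ji by simp
      ultimately show False using j(2) by simp
    qed
    ultimately have ij: "i < j" by simp
    have "{i, a} \<subseteq> Tie j" using ij a True by (simp add: Tie_def)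
    from card_mono[OF fT this] have "card (Tie j) \<ge> 2" using a by simp
    then have "(p, j) \<in> shallow_ties k xs" using depth[OF j(1,3)] j(1) by (simp add: shallow_ties_def Tie_def)
    then show ?thesis using True by blast
  next
    case False
    have ni: "card {u. u < i \<and> u \<noteq> a \<and> norm (p - xs ! u) \<le> norm (p - xs ! i)} \<le> k"
    proof -
      have "{u. u < i \<and> u \<noteq> a \<and> norm (p - xs ! u) \<le> norm (p - xs ! i)} \<subseteq> {u. u < i \<and> norm (p - xs ! u) < norm (p - xs ! i)}"
        using only by (auto simp: order.order_iff_strict)
      from card_mono[OF _ this] show ?thesis using depth[OF i(1,3)] by simp
    qed
    have cr: "(p, m, c, i, a) \<in> shallow_crossings k xs"
      if m: "m < length xs" "c < m" "norm (p - xs ! c) = norm (p - xs ! m)" "norm (p - xs ! m) = norm (p - xs ! j)"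
        "cross2 (xs ! c - xs ! m) (xs ! a - xs ! i) \<noteq> 0" "card (Tie m) \<le> 2"
        "card {u. u < m \<and> norm (p - xs ! u) < norm (p - xs ! m)} < k" for m c
    proof -
      have "{u. u < m \<and> u \<noteq> c \<and> norm (p - xs ! u) \<le> norm (p - xs ! m)} \<subseteq>
        {u. u < m \<and> norm (p - xs ! u) < norm (p - xs ! m)} \<union> (Tie m - {c})" by (auto simp: Tie_def)
      from card_mono[OF _ this] have "card {u. u < m \<and> u \<noteq> c \<and> norm (p - xs ! u) \<le> norm (p - xs ! m)} \<le>
        card ({u. u < m \<and> norm (p - xs ! u) < norm (p - xs ! m)} \<union> (Tie m - {c}))" using fT by simp
      also have "\<dots> \<le> card {u. u < m \<and> norm (p - xs ! u) < norm (p - xs ! m)} + card (Tie m - {c})" by (rule card_Un_le)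
      also have "card (Tie m - {c}) = card (Tie m) - 1" using m fT by (simp add: Tie_def)
      finally have "card {u. u < m \<and> u \<noteq> c \<and> norm (p - xs ! u) \<le> norm (p - xs ! m)} \<le> k" using m(6,7) by linarith
      then show ?thesis
        unfolding shallow_crossings_def mem_Collect_eq prod.case using m i(1) a ni False by (metis (no_types, lifting))
    qed
    show ?thesis
    proof (cases "card (Tie j) \<le> 2")
      case True
      then show ?thesis using cr[OF j(1,2,4) refl j(5)] depth[OF j(1,3)] by blast
    next
      case False
      \<comment> \<open>With more ties the depth of the crossing could exceed \<open>k\<close>. The
        third site \<open>m\<close> of the circle has exactly two ties and is no deeper than
        \<open>j\<close>; its two bisectors are not parallel, so one of them crosses the bisector of
        \<open>a\<close> and \<open>i\<close>.\<close>
      then obtain m where m: "m \<in> Tie j" "card {u\<in>Tie j. u < m} = 2" using ex_third_element[OF fT, of j] by auto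
      have mj: "m < j" "norm (p - xs ! m) = norm (p - xs ! j)" using m(1) by (auto simp: Tie_def)
      have Tm: "Tie m = {u\<in>Tie j. u < m}" using mj by (auto simp: Tie_def)
      then have c2: "card (Tie m) = 2" using m by simp
      then obtain c e where ce: "Tie m = {c, e}" "c \<noteq> e" by (auto simp: card_2_iff)
      have cm: "c < m" "norm (p - xs ! c) = norm (p - xs ! m)" and em: "e < m" "norm (p - xs ! e) = norm (p - xs ! m)"
        using ce(1) by (auto simp: Tie_def)
      have mn: "m < length xs" using mj j by simp
      have "card {u. u < m \<and> norm (p - xs ! u) < norm (p - xs ! m)} \<le> card {u. u < j \<and> norm (p - xs ! u) < norm (p - xs ! j)}"
        using mj by (intro card_mono) auto
      then have dm: "card {u. u < m \<and> norm (p - xs ! u) < norm (p - xs ! m)} < k" using depth[OF j(1,3)] by simp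
      have "cross2 (xs ! c - xs ! m) (xs ! e - xs ! m) \<noteq> 0"
        by (rule cross2_cocircular[of p]) (use cm em ce(2) mn d in \<open>auto simp: nth_eq_iff_index_eq\<close>)
      moreover have n0: "xs ! a - xs ! i \<noteq> 0" using d i a by (simp add: nth_eq_iff_index_eq)
      have par: "cross2 A B = 0" if "cross2 A n = 0" "cross2 B n = 0" "n \<noteq> 0" for A B n
      proof -
        have "cross2 A B * n$1 = cross2 A n * B$1 - cross2 B n * A$1" "cross2 A B * n$2 = cross2 A n * B$2 - cross2 B n * A$2"
          by (simp_all add: cross2_def algebra_simps)
        then show ?thesis using that by (auto simp: eq2_iff)
      qed
      ultimately have "cross2 (xs ! c - xs ! m) (xs ! a - xs ! i) \<noteq> 0 \<or> cross2 (xs ! e - xs ! m) (xs ! a - xs ! i) \<noteq> 0"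
        using par n0 by blast
      then show ?thesis
        using cr[OF mn cm mj(2)] cr[OF mn em mj(2)] c2 dm by fastforce
    qed
  qed
  then show ?thesis using c by (simp add: Tie_def)
qed

text \<open>A crossing contains its incidence among its components. An incidence charged to a tie at
  another index has exactly one earlier site on its circle, so it is the second site there; the tie
  determines the circle, and a circle has only one second site.\<close>

lemma card_incidences_le:
  assumes d: "distinct xs" and k: "1 \<le> k"
  shows "finite (incidences k xs) \<and>
    card (incidences k xs) \<le> 2 * card (shallow_ties k xs) + card (shallow_crossings k xs)"
proof -
  let ?T1 = "shallow_ties k xs" and ?T2 = "shallow_crossings k xs" and ?I = "incidences k xs"
  note fin = finite_shallow(1,2)[OF d k]
  define A where "A = {(p, i) \<in> ?I - ?T1. \<exists>j b a. (p, j, b, i, a) \<in> ?T2}"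
  define B where "B = {(p, i) \<in> ?I - ?T1. \<exists>j. (p, j) \<in> ?T1 \<and> norm (p - xs ! j) = norm (p - xs ! i)}"
  have A: "finite A \<and> card A \<le> card ?T2"
  proof (rule card_le_witness[OF fin(2), where P = "\<lambda>x y. fst x = fst y \<and> snd x = fst (snd (snd (snd y)))"])
    fix x assume "x \<in> A"
    then obtain p i j b a where "x = (p, i)" "(p, j, b, i, a) \<in> ?T2" unfolding A_def by blast
    then show "\<exists>y\<in>?T2. fst x = fst y \<and> snd x = fst (snd (snd (snd y)))" by force
  qed (auto simp: prod_eq_iff)
  have B: "finite B \<and> card B \<le> card ?T1"
  proof (rule card_le_witness[OF fin(1), where P = "\<lambda>x y. fst x = fst y \<and> norm (fst x - xs ! snd y) = norm (fst x - xs ! snd x)"])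
    fix x assume "x \<in> B"
    then obtain p i j where "x = (p, i)" "(p, j) \<in> ?T1" "norm (p - xs ! j) = norm (p - xs ! i)" unfolding B_def by blast
    then show "\<exists>y\<in>?T1. fst x = fst y \<and> norm (fst x - xs ! snd y) = norm (fst x - xs ! snd x)" by force
  next
    fix x x' y assume xB: "x \<in> B" "x' \<in> B"
      and y: "fst x = fst y \<and> norm (fst x - xs ! snd y) = norm (fst x - xs ! snd x)"
        "fst x' = fst y \<and> norm (fst x' - xs ! snd y) = norm (fst x' - xs ! snd x')"
    obtain p i i' where x: "x = (p, i)" "x' = (p, i')" using y by (metis prod.collapse)
    have e: "norm (p - xs ! i) = norm (p - xs ! i')" using y unfolding x by auto
    let ?Tie = "\<lambda>i. {u. u < i \<and> norm (p - xs ! u) = norm (p - xs ! i)}"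
    have c: "card (?Tie i) = 1" "card (?Tie i') = 1"
      using xB incidence_cases[OF d k] unfolding x B_def by blast+
    have less: False if ij: "i < j" "norm (p - xs ! i) = norm (p - xs ! j)" "card (?Tie i) = 1" "card (?Tie j) = 1" for i j
    proof -
      have "?Tie i \<noteq> {}" using ij(3) by (metis card.empty zero_neq_one)
      then obtain a where a: "a < i" "norm (p - xs ! a) = norm (p - xs ! i)" by blast
      then have "{i, a} \<subseteq> ?Tie j" using ij by auto
      from card_mono[OF _ this] show False using a ij(4) by simp
    qed
    have "i = i'" using less[of i i'] less[of i' i] e c by (metis linorder_neqE_nat)
    then show "x = x'" by (simp add: x)
  qed
  have cov: "?I \<subseteq> ?T1 \<union> (A \<union> B)"
  proof
    fix x assume "x \<in> ?I"
    then obtain p i where x: "x = (p, i)" "(p, i) \<in> ?I" by (cases x) auto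
    show "x \<in> ?T1 \<union> (A \<union> B)"
      using incidence_cases[OF d k x(2)] x unfolding A_def B_def by blast
  qed
  have f: "finite (?T1 \<union> (A \<union> B))" using fin A B by simp
  have "card ?I \<le> card (?T1 \<union> (A \<union> B))" by (rule card_mono[OF f cov])
  also have "\<dots> \<le> card ?T1 + (card ?T2 + card ?T1)" using A B by (intro card_Un_le_add) auto
  finally show ?thesis using finite_subset[OF cov f] by simp
qed

section \<open>Edges and faces of the overlay\<close>

text \<open>Here \<open>G\<close> is the curve \<open>F\<close> without the vertices of the arrangement.\<close>

definition polar_curve :: "real^2 \<Rightarrow> (real^2) set \<Rightarrow> (real^2) set \<Rightarrow> bool" where
  "polar_curve s F G \<longleftrightarrow> closed F \<and> G \<subseteq> F \<and>
     (\<forall>l m z. 0 \<le> l \<longrightarrow> 0 \<le> m \<longrightarrow> s + l *\<^sub>R z \<in> F \<longrightarrow> s + m *\<^sub>R z \<in> F \<longrightarrow> l = m) \<and>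
     (\<forall>y\<in>G. \<exists>n r. n \<noteq> 0 \<and> r > 0 \<and> G \<inter> ball y r = {x. (x - y) \<bullet> n = 0} \<inter> ball y r \<and> (s - y) \<bullet> n \<noteq> 0)"

text \<open>Consider the first parameter at which the walk leaves \<open>G\<close>. The point there
  is a limit of points of \<open>G\<close>, hence in \<open>F\<close>. If it were in
  \<open>G\<close>, the local line at it would contain earlier points of the walk and thus have
  direction \<open>v\<close>, so the walk would continue.\<close>

lemma walk_straight:
  assumes pc: "polar_curve s F G" and y: "y \<in> G" and r: "r > 0" "G \<inter> ball y r = {x. (x - y) \<bullet> n = 0} \<inter> ball y r"
    and v: "v \<bullet> n = 0" "v \<noteq> 0"
  shows "(\<forall>t\<ge>0. y + t *\<^sub>R v \<in> G) \<or> (\<exists>T>0. y + T *\<^sub>R v \<in> F - G \<and> (\<forall>t. 0 \<le> t \<and> t < T \<longrightarrow> y + t *\<^sub>R v \<in> G))"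
proof (rule disjCI)
  assume "\<not> (\<exists>T>0. y + T *\<^sub>R v \<in> F - G \<and> (\<forall>t. 0 \<le> t \<and> t < T \<longrightarrow> y + t *\<^sub>R v \<in> G))"
  then have neg: False if "T > 0" "y + T *\<^sub>R v \<in> F - G" "\<And>t. 0 \<le> t \<Longrightarrow> t < T \<Longrightarrow> y + t *\<^sub>R v \<in> G" for T
    using that by blast
  have F: "closed F" "G \<subseteq> F" using pc by (auto simp: polar_curve_def)
  have nv: "norm v > 0" using v by simp
  show "\<forall>t\<ge>0. y + t *\<^sub>R v \<in> G"
  proof (rule ccontr)
    assume no: "\<not> ?thesis"
    define Z where "Z = {t. 0 \<le> t \<and> y + t *\<^sub>R v \<notin> G}"
    have Z: "Z \<noteq> {}" using no by (auto simp: Z_def)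
    have bdd: "bdd_below Z" by (rule bdd_belowI[of _ 0]) (auto simp: Z_def)
    define T where "T = Inf Z"
    have below: "y + t *\<^sub>R v \<in> G" if "0 \<le> t" "t < T" for t
    proof (rule ccontr)
      assume "y + t *\<^sub>R v \<notin> G"
      then have "t \<in> Z" using that by (simp add: Z_def)
      then have "T \<le> t" unfolding T_def by (rule cInf_lower[OF _ bdd])
      then show False using that by simp
    qed
    have "r / norm v \<le> T"
      unfolding T_def
    proof (rule cInf_greatest[OF Z], rule ccontr)
      fix t assume t: "t \<in> Z" "\<not> r / norm v \<le> t"
      then have "t * norm v < r" using nv by (simp add: field_simps)
      then have "y + t *\<^sub>R v \<in> ball y r" using t by (simp add: dist_norm Z_def)
      then have "y + t *\<^sub>R v \<in> {x. (x - y) \<bullet> n = 0} \<inter> ball y r" using v by simp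
      then have "y + t *\<^sub>R v \<in> G" unfolding r(2)[symmetric] by blast
      then show False using t by (simp add: Z_def)
    qed
    moreover have "r / norm v > 0" using r nv by simp
    ultimately have T0: "T > 0" by linarith
    have approach: "\<exists>t. 0 \<le> t \<and> t < T \<and> y + t *\<^sub>R v \<in> ball (y + T *\<^sub>R v) e" if e: "e > 0" for e
    proof -
      define d where "d = min T (e / (2 * norm v))"
      have d: "d > 0" "d \<le> T" "d * norm v < e" using T0 e nv by (auto simp: d_def min_def field_simps)
      have "(y + T *\<^sub>R v) - (y + (T - d) *\<^sub>R v) = d *\<^sub>R v" by (simp add: algebra_simps)
      then have "y + (T - d) *\<^sub>R v \<in> ball (y + T *\<^sub>R v) e" using d by (simp add: dist_norm)
      then show ?thesis using d by (intro exI[of _ "T - d"]) auto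
    qed
    have inF: "y + T *\<^sub>R v \<in> F"
    proof (rule ccontr)
      assume "y + T *\<^sub>R v \<notin> F"
      have "open (- F)" using F(1) by (simp add: open_Compl)
      then obtain e where e: "e > 0" "ball (y + T *\<^sub>R v) e \<subseteq> - F"
        using \<open>y + T *\<^sub>R v \<notin> F\<close> open_contains_ball by blast
      then show False using approach[OF e(1)] below F(2) by blast
    qed
    have inG: "y + T *\<^sub>R v \<in> G" using neg[OF T0] inF below by blast
    define w where "w = y + T *\<^sub>R v"
    obtain m q where m: "m \<noteq> 0" "q > 0" "G \<inter> ball w q = {x. (x - w) \<bullet> m = 0} \<inter> ball w q"
      using pc inG unfolding polar_curve_def w_def by blast
    obtain t where t: "0 \<le> t" "t < T" "y + t *\<^sub>R v \<in> ball w q" using approach[OF m(2)] unfolding w_def by blast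
    have "y + t *\<^sub>R v \<in> {x. (x - w) \<bullet> m = 0} \<inter> ball w q" using m(3) t below[OF t(1,2)] by blast
    then have "(y + t *\<^sub>R v - w) \<bullet> m = 0" by blast
    moreover have "y + t *\<^sub>R v - w = (t - T) *\<^sub>R v" by (simp add: w_def algebra_simps)
    ultimately have vm: "v \<bullet> m = 0" using t by simp
    have "T + q / norm v \<le> Inf Z"
    proof (rule cInf_greatest[OF Z], rule ccontr)
      fix t assume t: "t \<in> Z" "\<not> T + q / norm v \<le> t"
      have "T \<le> t" unfolding T_def by (rule cInf_lower[OF t(1) bdd])
      have e: "y + t *\<^sub>R v - w = (t - T) *\<^sub>R v" by (simp add: w_def algebra_simps)
      have "t - T < q / norm v" using t(2) by linarith
      then have "(t - T) * norm v < q" using nv by (simp add: field_simps)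
      then have "norm (y + t *\<^sub>R v - w) < q" unfolding e using \<open>T \<le> t\<close> by simp
      then have "y + t *\<^sub>R v \<in> ball w q" by (simp add: dist_norm norm_minus_commute)
      moreover have "(y + t *\<^sub>R v - w) \<bullet> m = 0" unfolding e using vm by simp
      ultimately have "y + t *\<^sub>R v \<in> G" using m(3) by blast
      then show False using t by (simp add: Z_def)
    qed
    moreover have "q / norm v > 0" using m nv by simp
    ultimately show False unfolding T_def by linarith
  qed
qed

lemma connected_ray_image:
  fixes y :: "'a::real_normed_vector"
  assumes "connected I"
  shows "connected ((\<lambda>t::real. y + t *\<^sub>R v) ` I)"
  by (rule connected_continuous_image[OF _ assms]) (intro continuous_intros)

lemma small_linear:
  fixes a c :: real
  assumes "c > 0"
  shows "\<exists>d>0. \<forall>x. 0 < x \<and> x \<le> d \<longrightarrow> a * x < c"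
proof (intro exI conjI allI impI)
  show p: "c / (2 * (\<bar>a\<bar> + 1)) > 0" using assms by simp
  fix x assume x: "0 < x \<and> x \<le> c / (2 * (\<bar>a\<bar> + 1))"
  have "a * x \<le> (\<bar>a\<bar> + 1) * x" using x by (intro mult_right_mono) auto
  also have "\<dots> \<le> (\<bar>a\<bar> + 1) * (c / (2 * (\<bar>a\<bar> + 1)))" using x by (intro mult_left_mono) auto
  also have "\<dots> = c / 2" by (simp add: field_simps add_pos_nonneg)
  finally show "a * x < c" using assms by linarith
qed

text \<open>Two segments arriving at \<open>p\<close> from the same side of the line through \<open>s\<close> and \<open>p\<close> are hit by
  a common ray from \<open>s\<close>, hence by uniqueness they share a point.\<close>

lemma polar_curve_arrive_unique:
  assumes pc: "polar_curve s F G" and e: "e = 1 \<or> e = -1"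
    and a: "T > 0" "\<And>t. 0 \<le> t \<Longrightarrow> t < T \<Longrightarrow> y + t *\<^sub>R v \<in> G" "e * cross2 (y - s) v > 0"
    and b: "T' > 0" "\<And>t. 0 \<le> t \<Longrightarrow> t < T' \<Longrightarrow> y' + t *\<^sub>R v' \<in> G" "e * cross2 (y' - s) v' > 0"
    and p: "y + T *\<^sub>R v = y' + T' *\<^sub>R v'"
  shows "\<exists>t t'. 0 \<le> t \<and> t < T \<and> 0 \<le> t' \<and> t' < T' \<and> y + t *\<^sub>R v = y' + t' *\<^sub>R v'"
proof -
  define w where "w = y + T *\<^sub>R v - s"
  have w': "w = y' + T' *\<^sub>R v' - s" unfolding w_def p ..
  have yw: "y = s + w - T *\<^sub>R v" "y' = s + w - T' *\<^sub>R v'" by (simp add: w_def, simp add: w')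
  have cr: "e * cross2 w v > 0" "e * cross2 w v' > 0"
    using a(3) b(3) unfolding yw by (simp_all add: cross2_def algebra_simps)
  then have w0: "w \<noteq> 0" by (auto simp: cross2_def)
  define W where "W = w \<bullet> w"
  have W: "W > 0" using w0 by (simp add: W_def)
  \<comment> \<open>\<open>al u\<close> and \<open>e * be u\<close> are the coordinates of
    \<open>u\<close> in the orthogonal basis \<open>w\<close>, \<open>perp w\<close>. The sign
    \<open>e\<close> makes \<open>be\<close> positive for both arriving directions.\<close>
  define al where "al u = (w \<bullet> u) / W" for u
  define be where "be u = e * cross2 w u / W" for u
  have be: "be v > 0" "be v' > 0" using cr W by (simp_all add: be_def)
  have dec: "u = al u *\<^sub>R w + (e * be u) *\<^sub>R perp w" for u
  proof -
    have ee: "e * e = 1" using e by auto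
    have "W *\<^sub>R u = (w \<bullet> u) *\<^sub>R w + cross2 w u *\<^sub>R perp w"
      by (simp add: W_def eq2_iff inner2 cross2_def algebra_simps)
    then have "(1 / W) *\<^sub>R (W *\<^sub>R u) = (1 / W) *\<^sub>R ((w \<bullet> u) *\<^sub>R w + cross2 w u *\<^sub>R perp w)" by simp
    moreover have "e * be u = cross2 w u / W" using ee by (simp add: be_def mult.assoc[symmetric])
    ultimately show ?thesis using W by (simp add: al_def scaleR_add_right)
  qed
  obtain d1 where d1: "d1 > 0" "\<forall>x. 0 < x \<and> x \<le> d1 \<longrightarrow> - al v * x < be v" using small_linear[OF be(1)] by blast
  obtain d2 where d2: "d2 > 0" "\<forall>x. 0 < x \<and> x \<le> d2 \<longrightarrow> - al v' * x < be v'" using small_linear[OF be(2)] by blast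
  have Tb: "T * be v > 0" "T' * be v' > 0" using a b be by simp_all
  obtain d3 where d3: "d3 > 0" "\<forall>x. 0 < x \<and> x \<le> d3 \<longrightarrow> (1 - T * al v) * x < T * be v" using small_linear[OF Tb(1)] by blast
  obtain d4 where d4: "d4 > 0" "\<forall>x. 0 < x \<and> x \<le> d4 \<longrightarrow> (1 - T' * al v') * x < T' * be v'" using small_linear[OF Tb(2)] by blast
  define x where "x = min (min d1 d2) (min d3 d4)"
  have x: "x > 0" "x \<le> d1" "x \<le> d2" "x \<le> d3" "x \<le> d4" using d1 d2 d3 d4 by (auto simp: x_def)
  \<comment> \<open>The ray from \<open>s\<close> in direction \<open>z\<close> is tilted slightly
    from \<open>w\<close> to the side from which both segments arrive. The bounds on
    \<open>x\<close> place the meeting points on the segments.\<close>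
  define z where "z = w - (e * x) *\<^sub>R perp w"
  have key: "\<exists>t l. 0 < t \<and> t \<le> T \<and> l > 0 \<and> w - t *\<^sub>R u = l *\<^sub>R z"
    if h: "be u > 0" "- al u * x < be u" "(1 - T * al u) * x < T * be u" for u T
  proof -
    define D where "D = be u + al u * x"
    have D: "D > 0" using h by (simp add: D_def)
    define t where "t = x / D"
    have t: "t > 0" "t \<le> T" using x D h by (simp_all add: t_def D_def field_simps)
    have l: "1 - al u * t = be u / D" using D by (simp add: t_def D_def field_simps)
    have tb: "be u * t = (be u / D) * x" by (simp add: t_def)
    have "w - t *\<^sub>R u = w - t *\<^sub>R (al u *\<^sub>R w + (e * be u) *\<^sub>R perp w)" using dec[of u] by simp
    also have "\<dots> = (1 - al u * t) *\<^sub>R w - (e * (be u * t)) *\<^sub>R perp w" by (simp add: algebra_simps)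
    also have "\<dots> = (be u / D) *\<^sub>R z" unfolding l tb z_def by (simp add: algebra_simps)
    finally show ?thesis using t D h by (intro exI[of _ t] exI[of _ "be u / D"]) simp
  qed
  obtain t l where t: "0 < t" "t \<le> T" "l > 0" "w - t *\<^sub>R v = l *\<^sub>R z"
    using key[OF be(1)] d1(2) d3(2) x by blast
  obtain t' l' where t': "0 < t'" "t' \<le> T'" "l' > 0" "w - t' *\<^sub>R v' = l' *\<^sub>R z"
    using key[OF be(2)] d2(2) d4(2) x by blast
  have 1: "y + (T - t) *\<^sub>R v = s + l *\<^sub>R z" unfolding t(4)[symmetric] yw(1) by (simp add: algebra_simps)
  have 2: "y' + (T' - t') *\<^sub>R v' = s + l' *\<^sub>R z" unfolding t'(4)[symmetric] yw(2) by (simp add: algebra_simps)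
  have "y + (T - t) *\<^sub>R v \<in> G" "y' + (T' - t') *\<^sub>R v' \<in> G" using a(2)[of "T - t"] b(2)[of "T' - t'"] t t' by auto
  then have "s + l *\<^sub>R z \<in> F" "s + l' *\<^sub>R z \<in> F" using pc unfolding 1 2 polar_curve_def by blast+
  then have "l = l'" using pc t(3) t'(3) unfolding polar_curve_def by (meson less_imp_le)
  then show ?thesis using 1 2 t t' by (intro exI[of _ "T - t"] exI[of _ "T' - t'"]) auto
qed

lemma same_component:
  assumes "h \<in> components X" "h' \<in> components X" "x \<in> h" "x \<in> h'"
  shows "h = h'"
  using components_eq[OF assms(1,2)] assms(3,4) by blast

text \<open>Walking along a component in either direction one arrives at a point of \<open>F - G\<close>, unless the
  component is a full line.  The sets \<open>A 1\<close>, \<open>A (- 1)\<close> and \<open>L\<close> below reflect these three cases.\<close>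

lemma card_components_polar_curve:
  assumes pc: "polar_curve s F G" and fin: "finite (F - G)"
  shows "finite (components G) \<and> card (components G) \<le> 2 * card (F - G) + 2"
proof -
  define A where "A e = {h \<in> components G. \<exists>y v T. y \<in> h \<and> T > 0 \<and> y + T *\<^sub>R v \<in> F - G \<and> e * cross2 (y - s) v > 0 \<and>
     (\<forall>t. 0 \<le> t \<and> t < T \<longrightarrow> y + t *\<^sub>R v \<in> h)}" for e :: real
  define L where "L = {h \<in> components G. \<exists>y n. y \<in> h \<and> (y - s) \<bullet> n > 0 \<and> {x. (x - y) \<bullet> n = 0} \<subseteq> h}"
  have hG: "h \<subseteq> G" if "h \<in> components G" for h using in_components_subset[OF that] .
  have GF: "G \<subseteq> F" using pc by (simp add: polar_curve_def)
  have A: "finite (A e) \<and> card (A e) \<le> card (F - G)" if e: "e = 1 \<or> e = -1" for e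
  proof (rule card_le_witness[OF fin, where P = "\<lambda>h p. \<exists>y v T. y \<in> h \<and> T > 0 \<and> p = y + T *\<^sub>R v \<and> e * cross2 (y - s) v > 0 \<and>
     (\<forall>t. 0 \<le> t \<and> t < T \<longrightarrow> y + t *\<^sub>R v \<in> h)"])
    fix h assume "h \<in> A e"
    then show "\<exists>p\<in>F - G. \<exists>y v T. y \<in> h \<and> T > 0 \<and> p = y + T *\<^sub>R v \<and> e * cross2 (y - s) v > 0 \<and>
       (\<forall>t. 0 \<le> t \<and> t < T \<longrightarrow> y + t *\<^sub>R v \<in> h)"
      unfolding A_def by blast
  next
    fix h h' p
    assume h: "h \<in> A e" "h' \<in> A e"
      and p: "\<exists>y v T. y \<in> h \<and> T > 0 \<and> p = y + T *\<^sub>R v \<and> e * cross2 (y - s) v > 0 \<and>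
       (\<forall>t. 0 \<le> t \<and> t < T \<longrightarrow> y + t *\<^sub>R v \<in> h)"
      "\<exists>y v T. y \<in> h' \<and> T > 0 \<and> p = y + T *\<^sub>R v \<and> e * cross2 (y - s) v > 0 \<and>
       (\<forall>t. 0 \<le> t \<and> t < T \<longrightarrow> y + t *\<^sub>R v \<in> h')"
    have hc: "h \<in> components G" "h' \<in> components G" using h by (auto simp: A_def)
    obtain y v T where y: "T > 0" "p = y + T *\<^sub>R v" "e * cross2 (y - s) v > 0" "\<And>t. 0 \<le> t \<Longrightarrow> t < T \<Longrightarrow> y + t *\<^sub>R v \<in> h"
      using p(1) by blast
    obtain y' v' T' where y': "T' > 0" "p = y' + T' *\<^sub>R v'" "e * cross2 (y' - s) v' > 0" "\<And>t. 0 \<le> t \<Longrightarrow> t < T' \<Longrightarrow> y' + t *\<^sub>R v' \<in> h'"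
      using p(2) by blast
    have "\<exists>t t'. 0 \<le> t \<and> t < T \<and> 0 \<le> t' \<and> t' < T' \<and> y + t *\<^sub>R v = y' + t' *\<^sub>R v'"
    proof (rule polar_curve_arrive_unique[OF pc e y(1) _ y(3) y'(1) _ y'(3)])
      show "y + T *\<^sub>R v = y' + T' *\<^sub>R v'" using y(2) y'(2) by simp
    qed (use y(4) y'(4) hG[OF hc(1)] hG[OF hc(2)] in blast)+
    then show "h = h'" using same_component[OF hc] y(4) y'(4) by metis
  qed
  have L: "finite L \<and> card L \<le> card (UNIV :: bool set)"
  proof (rule card_le_witness[where P = "\<lambda>h b. \<exists>y n. y \<in> h \<and> (y - s) \<bullet> n > 0 \<and> {x. (x - y) \<bullet> n = 0} \<subseteq> h \<and>
      (b \<longleftrightarrow> n$1 > 0 \<or> n$1 = 0 \<and> n$2 > 0)"])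
    fix h h' b assume h: "h \<in> L" "h' \<in> L"
      and "\<exists>y n. y \<in> h \<and> (y - s) \<bullet> n > 0 \<and> {x. (x - y) \<bullet> n = 0} \<subseteq> h \<and> (b \<longleftrightarrow> n$1 > 0 \<or> n$1 = 0 \<and> n$2 > 0)"
      "\<exists>y n. y \<in> h' \<and> (y - s) \<bullet> n > 0 \<and> {x. (x - y) \<bullet> n = 0} \<subseteq> h' \<and> (b \<longleftrightarrow> n$1 > 0 \<or> n$1 = 0 \<and> n$2 > 0)"
    then obtain y n y' n' where y: "(y - s) \<bullet> n > 0" "{x. (x - y) \<bullet> n = 0} \<subseteq> h" "b \<longleftrightarrow> n$1 > 0 \<or> n$1 = 0 \<and> n$2 > 0"
      and y': "(y' - s) \<bullet> n' > 0" "{x. (x - y') \<bullet> n' = 0} \<subseteq> h'" "b \<longleftrightarrow> n'$1 > 0 \<or> n'$1 = 0 \<and> n'$2 > 0" by blast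
    have hc: "h \<in> components G" "h' \<in> components G" using h by (auto simp: L_def)
    have n0: "n \<noteq> 0" "n' \<noteq> 0" using y y' by auto
    define e :: real where "e = (if b then 1 else -1)"
    \<comment> \<open>Both normals point away from \<open>s\<close> and have the same lexicographic
      sign, recorded by \<open>b\<close>. Once \<open>M\<close> dominates the slopes,
      \<open>d\<close> has positive inner product with both, so the ray from \<open>s\<close> along
      \<open>d\<close> meets both lines, and uniqueness on rays makes the two meeting points equal.
      Hence at most two components are full lines.\<close>
    define M where "M = 1 + \<bar>n$2\<bar> / \<bar>n$1\<bar> + \<bar>n'$2\<bar> / \<bar>n'$1\<bar>"
    define d :: "real^2" where "d = e *\<^sub>R vector [M, 1]"
    have dn: "d \<bullet> n > 0" if n: "n \<noteq> 0" "b \<longleftrightarrow> n$1 > 0 \<or> n$1 = 0 \<and> n$2 > 0" "M \<ge> 1 + \<bar>n$2\<bar> / \<bar>n$1\<bar>" for n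
    proof (cases "n$1 = 0")
      case True
      then have "n$2 \<noteq> 0" using n(1) by (auto simp: eq2_iff)
      then show ?thesis using True n(2) by (auto simp: d_def e_def inner2)
    next
      case False
      have "\<bar>n$1\<bar> * M \<ge> \<bar>n$1\<bar> * (1 + \<bar>n$2\<bar> / \<bar>n$1\<bar>)" using n(3) by (intro mult_left_mono) auto
      also have "\<bar>n$1\<bar> * (1 + \<bar>n$2\<bar> / \<bar>n$1\<bar>) = \<bar>n$1\<bar> + \<bar>n$2\<bar>" using False by (simp add: field_simps)
      finally have "\<bar>n$1\<bar> * M > \<bar>n$2\<bar>" using False by linarith
      then show ?thesis using False n(2) by (auto simp: d_def e_def inner2 abs_if algebra_simps split: if_splits)
    qed
    have d: "d \<bullet> n > 0" "d \<bullet> n' > 0" using dn[OF n0(1) y(3)] dn[OF n0(2) y'(3)] by (auto simp: M_def)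
    define l where "l = ((y - s) \<bullet> n) / (d \<bullet> n)"
    define l' where "l' = ((y' - s) \<bullet> n') / (d \<bullet> n')"
    have l: "l > 0" "l' > 0" using y y' d by (simp_all add: l_def l'_def)
    have "(s + l *\<^sub>R d - y) \<bullet> n = l * (d \<bullet> n) - (y - s) \<bullet> n" by (simp add: inner_diff_left inner_add_left)
    also have "\<dots> = 0" using d by (simp add: l_def)
    finally have i1: "s + l *\<^sub>R d \<in> h" using y(2) by blast
    have "(s + l' *\<^sub>R d - y') \<bullet> n' = l' * (d \<bullet> n') - (y' - s) \<bullet> n'" by (simp add: inner_diff_left inner_add_left)
    also have "\<dots> = 0" using d by (simp add: l'_def)
    finally have i2: "s + l' *\<^sub>R d \<in> h'" using y'(2) by blast
    have "s + l *\<^sub>R d \<in> F" "s + l' *\<^sub>R d \<in> F" using i1 i2 hG[OF hc(1)] hG[OF hc(2)] GF by blast+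
    then have "l = l'" using pc l unfolding polar_curve_def by (meson less_imp_le)
    then show "h = h'" using same_component[OF hc] i1 i2 by blast
  next
    fix h assume "h \<in> L"
    then obtain y n where "y \<in> h \<and> (y - s) \<bullet> n > 0 \<and> {x. (x - y) \<bullet> n = 0} \<subseteq> h" unfolding L_def by blast
    then show "\<exists>b\<in>UNIV. \<exists>y n. y \<in> h \<and> (y - s) \<bullet> n > 0 \<and> {x. (x - y) \<bullet> n = 0} \<subseteq> h \<and>
      (b \<longleftrightarrow> n$1 > 0 \<or> n$1 = 0 \<and> n$2 > 0)" by blast
  qed simp
  have cov: "components G \<subseteq> A 1 \<union> A (-1) \<union> L"
  proof
    fix h assume h: "h \<in> components G"
    obtain y where y: "y \<in> h" using in_components_nonempty[OF h] by blast
    then have yG: "y \<in> G" using hG[OF h] by blast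
    obtain n0 r where n0: "n0 \<noteq> 0" "r > 0" "G \<inter> ball y r = {x. (x - y) \<bullet> n0 = 0} \<inter> ball y r" "(s - y) \<bullet> n0 \<noteq> 0"
      using pc yG unfolding polar_curve_def by blast
    define n where "n = (if (y - s) \<bullet> n0 > 0 then n0 else - n0)"
    have n: "n \<noteq> 0" "G \<inter> ball y r = {x. (x - y) \<bullet> n = 0} \<inter> ball y r" "(y - s) \<bullet> n > 0"
      using n0 by (auto simp: n_def inner_diff_left)
    define v where "v = perp n"
    have v: "v \<bullet> n = 0" "v \<noteq> 0" "- v \<bullet> n = 0" "- v \<noteq> 0" using n(1) by (auto simp: v_def inner2 eq2_iff)
    have cv: "cross2 (y - s) v = (y - s) \<bullet> n" by (simp add: cross2_def inner2 v_def)
    then have cv': "cross2 (y - s) v > 0" "cross2 (y - s) (- v) < 0" using n(3) by (simp_all add: cross2_def)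
    have seg: "y + t *\<^sub>R u \<in> h" if u: "\<And>t. t \<in> I \<Longrightarrow> y + t *\<^sub>R u \<in> G" "connected I" "0 \<in> I" "t \<in> I" for u I t
    proof -
      have "(\<lambda>t. y + t *\<^sub>R u) ` I \<subseteq> h"
      proof (rule components_maximal[OF h connected_ray_image[OF u(2)]])
        have "y + 0 *\<^sub>R u \<in> (\<lambda>t. y + t *\<^sub>R u) ` I" using u(3) by (rule imageI)
        then show "h \<inter> (\<lambda>t. y + t *\<^sub>R u) ` I \<noteq> {}" using y by auto
      qed (use u(1) in auto)
      then show ?thesis using u(4) by blast
    qed
    have half: "(\<forall>t\<ge>0. y + t *\<^sub>R u \<in> h) \<or> h \<in> A e"
      if u: "u \<bullet> n = 0" "u \<noteq> 0" "e * cross2 (y - s) u > 0" for u e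
      using walk_straight[OF pc yG n0(2) n(2) u(1,2)]
    proof
      assume *: "\<forall>t\<ge>0. y + t *\<^sub>R u \<in> G"
      have "y + t *\<^sub>R u \<in> h" if "t \<ge> 0" for t
        by (rule seg[of "{0..}"]) (use * that in auto)
      then show ?thesis by blast
    next
      assume "\<exists>T>0. y + T *\<^sub>R u \<in> F - G \<and> (\<forall>t. 0 \<le> t \<and> t < T \<longrightarrow> y + t *\<^sub>R u \<in> G)"
      then obtain T where T: "T > 0" "y + T *\<^sub>R u \<in> F - G" "\<And>t. 0 \<le> t \<Longrightarrow> t < T \<Longrightarrow> y + t *\<^sub>R u \<in> G" by blast
      have "y + t *\<^sub>R u \<in> h" if "0 \<le> t \<and> t < T" for t
        by (rule seg[of "{0..<T}"]) (use T that in auto)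
      then have "h \<in> A e" unfolding A_def using h y T u(3) by blast
      then show ?thesis ..
    qed
    have "h \<in> L" if a: "\<forall>t\<ge>0. y + t *\<^sub>R v \<in> h" "\<forall>t\<ge>0. y + t *\<^sub>R (- v) \<in> h"
    proof -
      have "perp v = - n" by (simp add: v_def eq2_iff)
      then have rl: "{x. (x - y) \<bullet> n = 0} = range (\<lambda>t::real. y + t *\<^sub>R v)" unfolding range_line_eq[OF v(2)] by simp
      have "y + t *\<^sub>R v \<in> h" for t :: real
        using a(1)[rule_format, of t] a(2)[rule_format, of "- t"] by (cases "t \<ge> 0") auto
      then have "{x. (x - y) \<bullet> n = 0} \<subseteq> h" unfolding rl by blast
      then show ?thesis unfolding L_def using h y n(3) by blast
    qed
    moreover have "(\<forall>t\<ge>0. y + t *\<^sub>R v \<in> h) \<or> h \<in> A 1" using half[OF v(1,2), of 1] cv' by simp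
    moreover have "(\<forall>t\<ge>0. y + t *\<^sub>R (- v) \<in> h) \<or> h \<in> A (-1)" by (rule half[OF v(3,4)]) (use cv' in simp)
    ultimately show "h \<in> A 1 \<union> A (-1) \<union> L" by blast
  qed
  have f: "finite (A 1 \<union> A (-1) \<union> L)" using A L by simp
  have "card (components G) \<le> card (A 1 \<union> A (-1) \<union> L)" by (rule card_mono[OF f cov])
  also have "\<dots> \<le> card (F - G) + card (F - G) + 2" using A[of 1] A[of "-1"] L by (intro card_Un_le_add) auto
  finally show ?thesis using finite_subset[OF cov f] by simp
qed

text \<open>Away from the vertices all curves together form one line locally; a front confined to a
  line fills it, and that line misses the site.\<close>

lemma polar_curve_front:
  assumes d: "distinct xs" and k: "1 \<le> k" and j: "j < length xs" and V: "finite (arr_vertices (curves k xs))"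
  shows "polar_curve (xs ! j) (front k xs j) (front k xs j - arr_vertices (curves k xs))"
proof -
  let ?V = "arr_vertices (curves k xs)"
  have fin: "finite (nth xs ` {..<j})" by simp
  note nin = nth_notin_earlier[OF d j]
  have straight: "\<exists>n r. n \<noteq> 0 \<and> r > 0 \<and> (front k xs j - ?V) \<inter> ball y r = {x. (x - y) \<bullet> n = 0} \<inter> ball y r \<and> (xs ! j - y) \<bullet> n \<noteq> 0"
    if y: "y \<in> front k xs j - ?V" for y
  proof -
    have "y \<in> curves k xs" using y j by (auto simp: curves_def)
    then have "locally_straight (curves k xs) y" using y by (auto simp: arr_vertices_def)
    then obtain n r where n: "n \<noteq> 0" "r > 0" "curves k xs \<inter> ball y r = {x. (x - y) \<bullet> n = 0} \<inter> ball y r"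
      unfolding locally_straight_iff by blast
    have "open (- ?V)" using V by (simp add: open_Compl finite_imp_closed)
    then obtain r1 where r1: "r1 > 0" "ball y r1 \<subseteq> - ?V" using y open_contains_ball by blast
    define q where "q = min r r1"
    have q: "q > 0" "ball y q \<subseteq> ball y r" "ball y q \<subseteq> - ?V" using n(2) r1 by (auto simp: q_def)
    have "front k xs j \<subseteq> curves k xs" using j by (auto simp: curves_def)
    then have sub: "site_front k (nth xs ` {..<j}) (xs ! j) \<inter> ball y q \<subseteq> {x. (x - y) \<bullet> n = 0}"
      using n(3) q(2) unfolding front_def[symmetric] by blast
    have yF: "y \<in> site_front k (nth xs ` {..<j}) (xs ! j)" using y by (simp add: front_def)
    from site_front_locally_line[OF fin nin k yF q(1) sub n(1)] obtain r' where
      r': "(xs ! j - y) \<bullet> n \<noteq> 0" "r' > 0" "r' \<le> q" "front k xs j \<inter> ball y r' = {x. (x - y) \<bullet> n = 0} \<inter> ball y r'"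
      unfolding front_def by blast
    have "ball y r' \<subseteq> - ?V" using r'(3) q(3) by (auto simp: subset_iff)
    then have "(front k xs j - ?V) \<inter> ball y r' = {x. (x - y) \<bullet> n = 0} \<inter> ball y r'" using r'(4) by blast
    then show ?thesis using n(1) r' by blast
  qed
  show ?thesis
    unfolding polar_curve_def
  proof (intro conjI allI impI ballI)
    fix l m :: real and z
    assume "0 \<le> l" "0 \<le> m" "xs ! j + l *\<^sub>R z \<in> front k xs j" "xs ! j + m *\<^sub>R z \<in> front k xs j"
    then show "l = m" using site_front_ray_unique[OF fin nin] unfolding front_def by blast
  qed (use closed_front[OF d j k] straight in auto)
qed

text \<open>Every edge contains a component of a single boundary curve without the vertices.\<close>

lemma card_edges_le:
  assumes d: "distinct xs" and k: "1 \<le> k"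
  shows "finite (arr_edges (curves k xs)) \<and>
    card (arr_edges (curves k xs)) \<le> 2 * card (incidences k xs) + 2 * length xs" (is ?edges)
    and "finite (arr_vertices (curves k xs)) \<and> card (arr_vertices (curves k xs)) \<le> card (incidences k xs)" (is ?verts)
proof -
  let ?B = "curves k xs" and ?I = "incidences k xs" and ?n = "length xs"
  let ?V = "arr_vertices ?B"
  have fI: "finite ?I" using card_incidences_le[OF d k] by blast
  have Vsub: "?V \<subseteq> fst ` ?I"
  proof
    fix p assume p: "p \<in> ?V"
    then have "p \<in> ?B" by (simp add: arr_vertices_def)
    then obtain i where "i < ?n" "p \<in> front k xs i" by (auto simp: curves_def)
    then have "(p, i) \<in> ?I" using p by (simp add: incidences_def)
    then show "p \<in> fst ` ?I" by force
  qed
  have V: "finite ?V" by (rule finite_subset[OF Vsub finite_imageI[OF fI]])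
  have "card ?V \<le> card (fst ` ?I)" by (rule card_mono[OF finite_imageI[OF fI] Vsub])
  also have "\<dots> \<le> card ?I" by (rule card_image_le[OF fI])
  finally show ?verts using V by simp
  define G where "G j = front k xs j - ?V" for j
  have comp: "finite (components (G j)) \<and> card (components (G j)) \<le> 2 * card (front k xs j \<inter> ?V) + 2" if j: "j < ?n" for j
  proof -
    have e: "front k xs j - G j = front k xs j \<inter> ?V" by (auto simp: G_def)
    have "finite (front k xs j - G j)" unfolding e using V by simp
    from card_components_polar_curve[OF polar_curve_front[OF d k j V, folded G_def] this] show ?thesis unfolding e .
  qed
  define W where "W = Sigma {..<?n} (\<lambda>j. components (G j))"
  have fW: "finite W" unfolding W_def using comp by (intro finite_SigmaI) auto
  have "?I\<inverse> = Sigma {..<?n} (\<lambda>j. front k xs j \<inter> ?V)" by (auto simp: incidences_def)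
  moreover have "card (Sigma {..<?n} (\<lambda>j. front k xs j \<inter> ?V)) = (\<Sum>j<?n. card (front k xs j \<inter> ?V))"
    by (rule card_SigmaI) (use V in auto)
  ultimately have cI: "card ?I = (\<Sum>j<?n. card (front k xs j \<inter> ?V))" using card_inverse[of ?I] by simp
  have "card W = (\<Sum>j<?n. card (components (G j)))" unfolding W_def by (rule card_SigmaI) (use comp in auto)
  also have "\<dots> \<le> (\<Sum>j<?n. 2 * card (front k xs j \<inter> ?V) + 2)" by (rule sum_mono) (use comp in auto)
  also have "\<dots> = 2 * card ?I + 2 * ?n" unfolding cI sum.distrib sum_distrib_left by simp
  finally have cW: "card W \<le> 2 * card ?I + 2 * ?n" .
  have "finite (arr_edges ?B) \<and> card (arr_edges ?B) \<le> card W"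
  proof (rule card_le_witness[OF fW, where P = "\<lambda>g y. snd y \<subseteq> g \<and> snd y \<noteq> {}"])
    fix g assume g: "g \<in> arr_edges ?B"
    then have gc: "g \<in> components (?B - ?V)" by (simp add: arr_edges_def)
    obtain x where x: "x \<in> g" using in_components_nonempty[OF gc] by blast
    then have "x \<in> ?B - ?V" using in_components_subset[OF gc] by blast
    then obtain j where j: "j < ?n" "x \<in> G j" by (auto simp: curves_def G_def)
    define h where "h = connected_component_set (G j) x"
    have h: "h \<in> components (G j)" unfolding h_def by (rule componentsI[OF j(2)])
    have xh: "x \<in> h" unfolding h_def using j(2) by simp
    have "h \<subseteq> G j" by (rule in_components_subset[OF h])
    also have "\<dots> \<subseteq> ?B - ?V" using j(1) by (auto simp: G_def curves_def)
    finally have "h \<subseteq> ?B - ?V" .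
    then have "h \<subseteq> g" using components_maximal[OF gc in_components_connected[OF h]] x xh by blast
    then show "\<exists>y\<in>W. snd y \<subseteq> g \<and> snd y \<noteq> {}"
      using j(1) h xh by (intro bexI[of _ "(j, h)"]) (auto simp: W_def)
  next
    fix g g' y assume "g \<in> arr_edges ?B" "g' \<in> arr_edges ?B" "snd y \<subseteq> g \<and> snd y \<noteq> {}" "snd y \<subseteq> g' \<and> snd y \<noteq> {}"
    then show "g = g'" unfolding arr_edges_def by (metis same_component ex_in_conv subsetD)
  qed
  then show ?edges using cW by linarith
qed

section \<open>Faces of the overlay and its total complexity\<close>

definition adjacent_faces :: "(real^2) set \<Rightarrow> real^2 \<Rightarrow> (real^2) set set" where
  "adjacent_faces B y = {f \<in> arr_faces B. y \<in> closure f}"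

text \<open>A straight point cuts its disk into two half-disks, each connected and hence inside one
  face. These two faces, which may coincide, are the ones adjacent to every nearby point of
  \<open>B\<close>.\<close>

lemma adjacent_faces_locally_constant:
  assumes y: "y \<in> B" "locally_straight B y"
  shows "\<exists>r>0. (\<forall>x\<in>B \<inter> ball y r. adjacent_faces B x = adjacent_faces B y) \<and>
    finite (adjacent_faces B y) \<and> card (adjacent_faces B y) \<le> 2"
proof -
  obtain n r where n: "n \<noteq> 0" "r > 0" "B \<inter> ball y r = {x. (x - y) \<bullet> n = 0} \<inter> ball y r"
    using y(2) unfolding locally_straight_iff by blast
  define H where "H e = {x. e * ((x - y) \<bullet> n) > 0} \<inter> ball y r" for e :: real
  have Hc: "connected (H e)" for e
  proof -
    have "{x. e * ((x - y) \<bullet> n) > 0} = {x. (e *\<^sub>R n) \<bullet> x > e * (y \<bullet> n)}"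
      by (auto simp: inner_diff_left algebra_simps inner_commute)
    then have "convex (H e)"
      unfolding H_def by (simp only:) (intro convex_Int convex_halfspace_gt convex_ball)
    then show ?thesis by (rule convex_connected)
  qed
  have HB: "H e \<subseteq> - B" for e using n(3) by (force simp: H_def)
  have clos: "x \<in> closure (H e)" if x: "x \<in> B \<inter> ball y r" and e: "e \<noteq> 0" for x e
    unfolding closure_approachable
  proof (intro allI impI)
    fix d :: real assume d: "d > 0"
    have xl: "(x - y) \<bullet> n = 0" using x n(3) by blast
    have "open (ball y r \<inter> ball x d)" "x \<in> ball y r \<inter> ball x d" using x d by auto
    from ex_move_in_open[OF this, of "e *\<^sub>R n"] obtain t where t: "t > 0" "x + t *\<^sub>R e *\<^sub>R n \<in> ball y r \<inter> ball x d" by blast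
    have "(x + t *\<^sub>R e *\<^sub>R n - y) \<bullet> n = (x - y) \<bullet> n + t * (e * (n \<bullet> n))"
      by (simp add: inner_diff_left inner_add_left)
    then have ev: "e * ((x + t *\<^sub>R e *\<^sub>R n - y) \<bullet> n) = t * ((e * e) * (n \<bullet> n))" using xl by simp
    have "e * e > 0" using e by (cases "e > 0") (auto simp: mult_neg_neg)
    then have "t * ((e * e) * (n \<bullet> n)) > 0" using t(1) n(1) by simp
    then have "e * ((x + t *\<^sub>R e *\<^sub>R n - y) \<bullet> n) > 0" by (simp only: ev)
    then have "x + t *\<^sub>R e *\<^sub>R n \<in> H e" unfolding H_def using t(2) by blast
    then show "\<exists>z\<in>H e. dist z x < d" using t(2) by (intro bexI) (auto simp: dist_commute)
  qed
  have Hne: "H e \<noteq> {}" if "e \<noteq> 0" for e using clos[of y e] that y(1) n(2) by auto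
  define C where "C e = connected_component_set (- B) (SOME x. x \<in> H e)" for e
  have C: "C e \<in> arr_faces B" "H e \<subseteq> C e" if e: "e \<noteq> 0" for e
  proof -
    have s: "(SOME x. x \<in> H e) \<in> H e" using Hne[OF e] by (simp add: some_in_eq)
    then show c: "C e \<in> arr_faces B" unfolding C_def arr_faces_def using HB by (intro componentsI) blast
    show "H e \<subseteq> C e" unfolding C_def by (rule connected_component_maximal[OF s Hc HB])
  qed
  have adj: "adjacent_faces B x = {C 1, C (-1)}" if x: "x \<in> B \<inter> ball y r" for x
  proof
    have "x \<in> closure (C e)" if "e \<noteq> 0" for e
      using clos[OF x that] closure_mono[OF C(2)[OF that]] by blast
    then show "{C 1, C (-1)} \<subseteq> adjacent_faces B x" using C(1)[of 1] C(1)[of "-1"] by (simp add: adjacent_faces_def)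
    show "adjacent_faces B x \<subseteq> {C 1, C (-1)}"
    proof
      fix f assume "f \<in> adjacent_faces B x"
      then have f: "f \<in> arr_faces B" "x \<in> closure f" by (auto simp: adjacent_faces_def)
      have "f \<inter> ball y r \<noteq> {}" using f(2) x open_Int_closure_eq_empty[of "ball y r" f] by (auto simp: Int_commute)
      then obtain z where z: "z \<in> f" "z \<in> ball y r" by blast
      have "z \<notin> B" using z(1) f(1) in_components_subset unfolding arr_faces_def by blast
      then have "(z - y) \<bullet> n \<noteq> 0" using n(3) z(2) by blast
      then have "z \<in> H 1 \<or> z \<in> H (-1)" using z(2) by (auto simp: H_def)
      then have "z \<in> C 1 \<or> z \<in> C (-1)" using C(2)[of 1] C(2)[of "-1"] by auto
      moreover have "C 1 \<in> components (- B)" "C (-1) \<in> components (- B)" "f \<in> components (- B)"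
        using C(1)[of 1] C(1)[of "-1"] f(1) by (auto simp: arr_faces_def)
      ultimately show "f \<in> {C 1, C (-1)}" using same_component z(1) by blast
    qed
  qed
  have yy: "y \<in> B \<inter> ball y r" using y(1) n(2) by simp
  have "card {C 1, C (-1)} \<le> 2" by (simp add: card_insert_le_m1)
  then show ?thesis using adj adj[OF yy] n(2) by (intro exI[of _ r]) auto
qed

text \<open>A face with a boundary point outside the vertices is adjacent to an edge, and by local
  constancy an edge has at most two adjacent faces. If some face has only vertices on its boundary,
  it contains the connected complement of this finite set and is the only face; this accounts for
  the summand 1.\<close>

lemma card_faces_le:
  assumes B: "closed B" and V: "finite (arr_vertices B)" and E: "finite (arr_edges B)"
  shows "finite (arr_faces B) \<and> card (arr_faces B) \<le> 2 * card (arr_edges B) + 1"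
proof (cases "\<exists>f\<in>arr_faces B. frontier f \<subseteq> arr_vertices B")
  case True
  then obtain f where f: "f \<in> arr_faces B" "frontier f \<subseteq> arr_vertices B" by blast
  let ?V = "arr_vertices B"
  have fc: "f \<in> components (- B)" using f by (simp add: arr_faces_def)
  have VB: "?V \<subseteq> B" by (auto simp: arr_vertices_def)
  have "connected (UNIV - ?V)" by (rule connected_open_delete_finite[OF _ _ _ V]) auto
  moreover have "f \<noteq> {}" "f \<subseteq> - B" using in_components_nonempty[OF fc] in_components_subset[OF fc] by auto
  then have "(UNIV - ?V) \<inter> f \<noteq> {}" using VB by blast
  moreover have "(UNIV - ?V) \<inter> frontier f = {}" using f(2) by blast
  ultimately have sub: "UNIV - ?V \<subseteq> f" using connected_Int_frontier[of "UNIV - ?V" f] by blast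
  have "arr_faces B \<subseteq> {f}"
  proof
    fix g assume "g \<in> arr_faces B"
    then have gc: "g \<in> components (- B)" by (simp add: arr_faces_def)
    obtain x where x: "x \<in> g" using in_components_nonempty[OF gc] by blast
    then have "x \<in> f" using in_components_subset[OF gc] VB sub by blast
    then show "g \<in> {f}" using same_component[OF gc fc x] by simp
  qed
  then show ?thesis using card_mono[of "{f}" "arr_faces B"] finite_subset[of "arr_faces B" "{f}"] by simp
next
  case False
  define pt where "pt g = (SOME x. x \<in> g)" for g :: "(real^2) set"
  have g0: "pt g \<in> g \<and> g \<subseteq> B - arr_vertices B \<and> connected g" if "g \<in> arr_edges B" for g
    using that in_components_nonempty[of g] in_components_subset[of g] in_components_connected[of g]
    unfolding arr_edges_def pt_def by (auto simp: some_in_eq)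
  have ls: "locally_straight B y" if "y \<in> B - arr_vertices B" for y using that by (auto simp: arr_vertices_def)
  have const: "adjacent_faces B y = adjacent_faces B (pt g)" if g: "g \<in> arr_edges B" "y \<in> g" for g y
  proof -
    have "adjacent_faces B constant_on g"
    proof (rule locally_constant_imp_constant)
      show "connected g" using g0[OF g(1)] by blast
      fix a assume a: "a \<in> g"
      then have aB: "a \<in> B - arr_vertices B" using g0[OF g(1)] by blast
      obtain r where r: "r > 0" "\<forall>x\<in>B \<inter> ball a r. adjacent_faces B x = adjacent_faces B a"
        using adjacent_faces_locally_constant[OF _ ls[OF aB]] aB by blast
      show "\<exists>T. openin (top_of_set g) T \<and> a \<in> T \<and> (\<forall>x\<in>T. adjacent_faces B x = adjacent_faces B a)"
        using r a g0[OF g(1)] by (intro exI[of _ "g \<inter> ball a r"]) (auto simp: openin_open_Int)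
    qed
    then show ?thesis using g g0[OF g(1)] unfolding constant_on_def by metis
  qed
  have c2: "finite (adjacent_faces B (pt g)) \<and> card (adjacent_faces B (pt g)) \<le> 2" if g: "g \<in> arr_edges B" for g
    using adjacent_faces_locally_constant[of "pt g" B] g0[OF g] ls[of "pt g"] by blast
  have cov: "arr_faces B \<subseteq> (\<Union>g\<in>arr_edges B. adjacent_faces B (pt g))"
  proof
    fix f assume f: "f \<in> arr_faces B"
    then have fc: "f \<in> components (- B)" by (simp add: arr_faces_def)
    obtain y where y: "y \<in> frontier f" "y \<notin> arr_vertices B" using False f by blast
    have "frontier f \<subseteq> frontier (- B)" by (rule frontier_of_components_subset[OF fc])
    then have "y \<in> frontier B" using y by (auto simp: frontier_complement)
    then have "y \<in> B" using B by (simp add: frontier_def)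
    then have yG: "y \<in> B - arr_vertices B" using y by blast
    define g where "g = connected_component_set (B - arr_vertices B) y"
    have g: "g \<in> arr_edges B" "y \<in> g" unfolding g_def arr_edges_def using yG by (auto intro: componentsI)
    have "f \<in> adjacent_faces B y" using f y by (simp add: adjacent_faces_def frontier_def)
    then show "f \<in> (\<Union>g\<in>arr_edges B. adjacent_faces B (pt g))" using const[OF g] g(1) by blast
  qed
  have fU: "finite (\<Union>g\<in>arr_edges B. adjacent_faces B (pt g))" using E c2 by blast
  have "card (arr_faces B) \<le> card (\<Union>g\<in>arr_edges B. adjacent_faces B (pt g))" by (rule card_mono[OF fU cov])
  also have "\<dots> \<le> (\<Sum>g\<in>arr_edges B. card (adjacent_faces B (pt g)))" by (rule card_UN_le[OF E])
  also have "\<dots> \<le> (\<Sum>g\<in>arr_edges B. 2)" by (rule sum_mono) (use c2 in blast)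
  finally show ?thesis using finite_subset[OF cov fU] by simp
qed

text \<open>With \<open>I\<close> incidences and \<open>n\<close> sites there are at most
  \<open>I\<close> vertices, \<open>2 * I + 2 * n\<close> edges, and twice as many faces as edges
  plus one.\<close>

lemma arr_complexity_curves_le:
  assumes d: "distinct xs" and k: "1 \<le> k"
  shows "arr_complexity (curves k xs) \<le> of_nat (7 * card (incidences k xs) + 6 * length xs + 1)"
proof -
  note E = card_edges_le(1)[OF d k] and V = card_edges_le(2)[OF d k]
  have "closed (curves k xs)" unfolding curves_def using closed_front[OF d _ k] by (intro closed_UN) auto
  from card_faces_le[OF this] E V have F: "finite (arr_faces (curves k xs))"
    "card (arr_faces (curves k xs)) \<le> 2 * card (arr_edges (curves k xs)) + 1" by auto
  have "arr_complexity (curves k xs) = of_nat (card (arr_vertices (curves k xs)) + card (arr_edges (curves k xs)) + card (arr_faces (curves k xs)))"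
    unfolding arr_complexity_def using E V F by (simp add: emeasure_count_space_finite)
  also have "\<dots> \<le> of_nat (7 * card (incidences k xs) + 6 * length xs + 1)"
    using E V F by (intro of_nat_mono) linarith
  finally show ?thesis .
qed

section \<open>The overlay and the proxy diagram have the same curves\<close>

lemma set_take_Suc:
  assumes "j < length xs"
  shows "set (take (Suc j) xs) = insert (xs ! j) (nth xs ` {..<j})"
  using assms nth_image[of j xs] by (simp add: take_Suc_conv_app_nth atLeast0LessThan)

definition senv :: "nat \<Rightarrow> (real^2) list \<Rightarrow> nat \<Rightarrow> (real^2) set" where
  "senv k xs j = site_env k (nth xs ` {..<j}) (xs ! j)"

lemma env_Suc_eq:
  assumes "distinct xs" "j < length xs" "1 \<le> k"
  shows "env k xs (Suc j) = senv k xs j"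
  using environment_eq[of "nth xs ` {..<j}" k "xs ! j"] nth_notin_earlier[OF assms(1,2)] assms
  by (simp add: env_def senv_def set_take_Suc)

lemma frontier_senv:
  assumes "distinct xs" "j < length xs" "1 \<le> k"
  shows "frontier (senv k xs j) = front k xs j" and "closed (senv k xs j)"
  using frontier_site_env[of "nth xs ` {..<j}" "xs ! j" k] closed_site_env[of "nth xs ` {..<j}" "xs ! j" k]
    nth_notin_earlier[OF assms(1,2)] assms(3)
  by (simp_all add: senv_def front_def)

lemma overlay_curves_eq:
  assumes "distinct xs" "1 \<le> k"
  shows "(\<Union>i\<in>{1..length xs}. frontier (env k xs i)) = curves k xs"
proof -
  have "{1..length xs} = Suc ` {..<length xs}" by (simp add: image_Suc_lessThan)
  then have "(\<Union>i\<in>{1..length xs}. frontier (env k xs i)) = (\<Union>j<length xs. frontier (env k xs (Suc j)))" by simp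
  also have "\<dots> = curves k xs"
    unfolding curves_def by (rule SUP_cong[OF refl])
      (simp add: env_Suc_eq[OF assms(1) _ assms(2)] frontier_senv(1)[OF assms(1) _ assms(2)])
  finally show ?thesis .
qed

text \<open>A site that is among the \<open>k\<close> nearest in some longer prefix is so in the
  prefix that it ends, where it has fewer competitors. Hence its own environment decides whether it
  is a proxy.\<close>

lemma proxy_set_eq:
  assumes d: "distinct xs" and k: "1 \<le> k"
  shows "proxy_set k x xs = nth xs ` {j. j < length xs \<and> x \<in> senv k xs j}"
proof
  show "proxy_set k x xs \<subseteq> nth xs ` {j. j < length xs \<and> x \<in> senv k xs j}"
  proof
    fix s assume "s \<in> proxy_set k x xs"
    then obtain i where i: "i \<in> {1..length xs}" "s \<in> nearest k x (set (take i xs))" unfolding proxy_set_def by blast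
    have si: "s \<in> set (take i xs)" "card (closer_set (set (take i xs)) s x) < k"
      using i(2) nearest_iff[OF _ k, of "set (take i xs)" s x] by simp_all
    obtain j where j: "j < i" "j < length xs" "s = xs ! j" using si(1) by (auto simp: in_set_conv_nth)
    have "nth xs ` {..<j} = set (take j xs)" using nth_image[of j xs] j(2) by (simp add: atLeast0LessThan)
    also have "\<dots> \<subseteq> set (take i xs)" using j(1) by (intro set_take_subset_set_take) simp
    finally have "nth xs ` {..<j} \<subseteq> set (take i xs)" .
    then have "closer_set (nth xs ` {..<j}) (xs ! j) x \<subseteq> closer_set (set (take i xs)) s x"
      unfolding closer_set_def j(3) by blast
    from card_mono[OF _ this] have "card (closer_set (nth xs ` {..<j}) (xs ! j) x) < k" using si(2) by simp
    then have "x \<in> senv k xs j" by (simp add: senv_def site_env_def)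
    then show "s \<in> nth xs ` {j. j < length xs \<and> x \<in> senv k xs j}" using j by blast
  qed
  show "nth xs ` {j. j < length xs \<and> x \<in> senv k xs j} \<subseteq> proxy_set k x xs"
  proof clarify
    fix j assume j: "j < length xs" "x \<in> senv k xs j"
    then have "x \<in> environment k (xs ! j) (set (take (Suc j) xs))"
      using env_Suc_eq[OF d j(1) k] by (simp add: env_def)
    then have "xs ! j \<in> nearest k x (set (take (Suc j) xs))" by (simp add: environment_def)
    then show "xs ! j \<in> proxy_set k x xs" unfolding proxy_set_def using j(1) by (intro UN_I[of "Suc j"]) auto
  qed
qed

text \<open>Off all frontiers, membership in each \<open>E j\<close> is locally constant, and so is
  the class. A frontier point of a closed \<open>E j\<close> belongs to it but has arbitrarily near
  points outside, which are in other classes.\<close>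

lemma Union_frontier_classes:
  fixes E :: "nat \<Rightarrow> 'a::metric_space set"
  assumes c: "\<And>j. j < n \<Longrightarrow> closed (E j)"
    and P: "\<And>x y. P x = P y \<longleftrightarrow> (\<forall>j<n. x \<in> E j \<longleftrightarrow> y \<in> E j)"
  shows "(\<Union>A. frontier {x. P x = A}) = (\<Union>j<n. frontier (E j))"
proof
  show "(\<Union>A. frontier {x. P x = A}) \<subseteq> (\<Union>j<n. frontier (E j))"
  proof
    fix p assume "p \<in> (\<Union>A. frontier {x. P x = A})"
    then obtain A where A: "p \<in> frontier {x. P x = A}" by blast
    show "p \<in> (\<Union>j<n. frontier (E j))"
    proof (rule ccontr)
      assume no: "p \<notin> (\<Union>j<n. frontier (E j))"
      have "\<exists>r>0. \<forall>y. dist p y < r \<longrightarrow> (y \<in> E j \<longleftrightarrow> p \<in> E j)" if "j < n" for j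
      proof -
        have "p \<notin> frontier (E j)" using no that by blast
        then show ?thesis unfolding frontier_straddle by (metis dist_self)
      qed
      then obtain R where R: "\<And>j. j < n \<Longrightarrow> R j > 0 \<and> (\<forall>y. dist p y < R j \<longrightarrow> (y \<in> E j \<longleftrightarrow> p \<in> E j))" by metis
      define r where "r = Min (insert 1 (R ` {..<n}))"
      have r0: "r > 0" unfolding r_def using R by (subst Min_gr_iff) auto
      have "r \<le> R j" if "j < n" for j unfolding r_def using that by (intro Min_le) auto
      then have same: "P y = P p" if "dist p y < r" for y
        unfolding P using R that by (meson less_le_trans)
      obtain x y where xy: "P x = A" "dist p x < r" "P y \<noteq> A" "dist p y < r"
        using A r0 unfolding frontier_straddle by blast
      then show False using same[of x] same[of y] by simp
    qed
  qed
  show "(\<Union>j<n. frontier (E j)) \<subseteq> (\<Union>A. frontier {x. P x = A})"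
  proof
    fix p assume "p \<in> (\<Union>j<n. frontier (E j))"
    then obtain j where j: "j < n" "p \<in> frontier (E j)" by blast
    then have pE: "p \<in> E j" using c[OF j(1)] by (simp add: frontier_def)
    have "p \<in> frontier {x. P x = P p}"
      unfolding frontier_straddle
    proof (intro allI impI conjI)
      fix e :: real assume e: "e > 0"
      show "\<exists>x\<in>{x. P x = P p}. dist p x < e" using e by (intro bexI[of _ p]) auto
      obtain y where y: "y \<notin> E j" "dist p y < e" using j(2) e unfolding frontier_straddle by blast
      then have "P y \<noteq> P p" using P pE j(1) by blast
      then show "\<exists>x. x \<notin> {x. P x = P p} \<and> dist p x < e" using y(2) by blast
    qed
    then show "p \<in> (\<Union>A. frontier {x. P x = A})" by blast
  qed
qed

lemma proxy_curves_eq: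
  assumes d: "distinct xs" and k: "1 \<le> k"
  shows "(\<Union>A. frontier {x. proxy_set k x xs = A}) = curves k xs"
proof -
  have "(\<Union>A. frontier {x. proxy_set k x xs = A}) = (\<Union>j<length xs. frontier (senv k xs j))"
  proof (rule Union_frontier_classes)
    fix x y
    have "inj_on (nth xs) {..<length xs}" using d by (intro inj_on_nth) auto
    then have "proxy_set k x xs = proxy_set k y xs \<longleftrightarrow>
      {j. j < length xs \<and> x \<in> senv k xs j} = {j. j < length xs \<and> y \<in> senv k xs j}"
      unfolding proxy_set_eq[OF d k] by (rule inj_on_image_eq_iff) auto
    then show "proxy_set k x xs = proxy_set k y xs \<longleftrightarrow> (\<forall>j<length xs. x \<in> senv k xs j \<longleftrightarrow> y \<in> senv k xs j)" by blast
  qed (rule frontier_senv(2)[OF d _ k])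
  also have "\<dots> = curves k xs"
    unfolding curves_def by (rule SUP_cong[OF refl]) (simp add: frontier_senv(1)[OF d _ k])
  finally show ?thesis .
qed

section \<open>The random ordering\<close>

lemma measurable_point_volume:
  assumes "\<And>j. j \<in> {1..d} \<Longrightarrow> sets (D j) = sets borel"
  shows "point_volume d \<in> borel_measurable (PiM {1..d} D)"
proof -
  have "(\<lambda>q. q j) \<in> borel_measurable (PiM {1..d} D)" if "j \<in> {1..d}" for j
    using measurable_component_singleton[OF that, of D] assms[OF that] measurable_cong_sets by blast
  then have "(\<lambda>q. \<Prod>j=1..d. q j) \<in> borel_measurable (PiM {1..d} D)"
    by (intro borel_measurable_prod) auto
  then show ?thesis unfolding point_volume_def[abs_def] .
qed

text \<open>Fix all coordinates but the first. They are almost surely nonzero with product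
  \<open>R\<close>, so the volume equals \<open>c\<close> only if the first coordinate is
  \<open>c / R\<close>, which has probability 0.\<close>

lemma AE_point_volume_neq:
  assumes d: "1 \<le> d" and D: "\<And>j. continuous_distribution_01 (D j)"
  shows "AE q in PiM {1..d} D. point_volume d q \<noteq> c"
proof -
  have real: "real_distribution (D j)" and atom: "emeasure (D j) {x} = 0" for j x
    using D[of j] by (auto simp: continuous_distribution_01_def)
  have setsD: "sets (D j) = sets borel" for j
    using real_distribution.events_eq_borel[OF real] .
  have prob: "prob_space (D j)" for j using real by (simp add: real_distribution_def)
  interpret product_sigma_finite D
    unfolding product_sigma_finite_def using prob by (auto intro: prob_space_imp_sigma_finite)
  have I: "{1..d} = insert 1 {2..d}" using d by auto
  let ?V = "point_volume d"
  have V: "?V \<in> borel_measurable (PiM (insert 1 {2..d}) D)"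
    using measurable_point_volume[of d D] setsD unfolding I by simp
  have single: "AE x in D j. x \<noteq> 0" for j
  proof (rule AE_I[where N = "{0}"])
    show "{0} \<in> sets (D j)" using setsD by simp
  qed (use atom in auto)
  have "AE x in PiM {2..d} D. x j \<noteq> 0" if "j \<in> {2..d}" for j
    by (rule AE_PiM_component[OF prob that single])
  then have "AE x in PiM {2..d} D. \<forall>j\<in>{2..d}. x j \<noteq> 0" by (intro AE_finite_allI) auto
  then have AE0: "AE x in PiM {2..d} D. (\<integral>\<^sup>+ y. indicator {c} (?V (x(1 := y))) \<partial>D 1) = (0::ennreal)"
  proof (rule AE_mp, intro AE_I2 impI)
    fix x :: "nat \<Rightarrow> real" assume x: "\<forall>j\<in>{2..d}. x j \<noteq> 0"
    define R where "R = (\<Prod>j=2..d. x j)"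
    have R: "R \<noteq> 0" unfolding R_def using x by simp
    have "?V (x(1 := y)) = y * R" for y
    proof -
      have "?V (x(1 := y)) = (\<Prod>j\<in>insert 1 {2..d}. (x(1 := y)) j)" unfolding point_volume_def I ..
      also have "\<dots> = y * (\<Prod>j\<in>{2..d}. (x(1 := y)) j)" by (subst prod.insert) auto
      also have "(\<Prod>j\<in>{2..d}. (x(1 := y)) j) = R" unfolding R_def by (intro prod.cong) auto
      finally show ?thesis .
    qed
    then have "indicator {c} (?V (x(1 := y))) = (indicator {c / R} y :: ennreal)" for y
      using R by (auto simp: indicator_def field_simps)
    then have "(\<integral>\<^sup>+ y. indicator {c} (?V (x(1 := y))) \<partial>D 1) = (\<integral>\<^sup>+ y. indicator {c / R} y \<partial>D 1)" by simp
    also have "\<dots> = emeasure (D 1) {c / R}" by (rule nn_integral_indicator) (simp add: setsD)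
    finally show "(\<integral>\<^sup>+ y. indicator {c} (?V (x(1 := y))) \<partial>D 1) = (0::ennreal)" using atom by simp
  qed
  have mf: "(\<lambda>q. indicator {c} (?V q) :: ennreal) \<in> borel_measurable (PiM (insert 1 {2..d}) D)"
    using V by measurable
  have "(\<integral>\<^sup>+ q. indicator {c} (?V q) \<partial>PiM (insert 1 {2..d}) D) =
     (\<integral>\<^sup>+ x. (\<integral>\<^sup>+ y. indicator {c} (?V (x(1 := y))) \<partial>D 1) \<partial>PiM {2..d} D)"
    by (rule product_nn_integral_insert[OF _ _ mf]) auto
  also have "\<dots> = 0"
    using nn_integral_cong_AE[OF AE0] by simp
  finally have "AE q in PiM (insert 1 {2..d}) D. indicator {c} (?V q) = (0::ennreal)"
    using nn_integral_0_iff_AE[OF mf] by simp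
  then show ?thesis unfolding I by (rule AE_mp) (auto simp: indicator_def)
qed

text \<open>By Fubini the component \<open>s\<close> is integrated with all others fixed, and then
  \<open>f (p t)\<close> is a constant.\<close>

lemma AE_values_neq:
  assumes S: "finite S" "s \<in> S" "t \<in> S" "s \<noteq> t" and N: "prob_space N" and f: "f \<in> borel_measurable N"
    and ae: "\<And>c::real. AE q in N. f q \<noteq> c"
  shows "AE p in PiM S (\<lambda>_. N). f (p s) \<noteq> f (p t)"
proof -
  interpret product_sigma_finite "\<lambda>_. N"
    unfolding product_sigma_finite_def using N by (auto intro: prob_space_imp_sigma_finite)
  define I where "I = S - {s}"
  have I: "S = insert s I" "finite I" "s \<notin> I" "t \<in> I" using S by (auto simp: I_def)
  have comp: "(\<lambda>p. f (p u)) \<in> borel_measurable (PiM (insert s I) (\<lambda>_. N))" if "u \<in> insert s I" for u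
    by (rule measurable_compose[OF measurable_component_singleton[OF that] f])
  have mf: "(\<lambda>p. indicator {0} (f (p s) - f (p t)) :: ennreal) \<in> borel_measurable (PiM (insert s I) (\<lambda>_. N))"
    by (rule measurable_compose[OF borel_measurable_diff[OF comp comp]]) (use I in auto)
  have "(\<integral>\<^sup>+ p. indicator {0} (f (p s) - f (p t)) \<partial>PiM (insert s I) (\<lambda>_. N)) =
     (\<integral>\<^sup>+ x. (\<integral>\<^sup>+ y. indicator {0} (f ((x(s := y)) s) - f ((x(s := y)) t)) \<partial>N) \<partial>PiM I (\<lambda>_. N))"
    by (rule product_nn_integral_insert[OF I(2,3) mf])
  also have "\<dots> = (\<integral>\<^sup>+ x. 0 \<partial>PiM I (\<lambda>_. N))"
  proof (rule nn_integral_cong)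
    fix x
    have "(\<integral>\<^sup>+ y. indicator {0} (f ((x(s := y)) s) - f ((x(s := y)) t)) \<partial>N) = (\<integral>\<^sup>+ y. 0 \<partial>N)"
      by (rule nn_integral_cong_AE, rule AE_mp[OF ae[of "f (x t)"]]) (use S in \<open>auto simp: indicator_def\<close>)
    then show "(\<integral>\<^sup>+ y. indicator {0} (f ((x(s := y)) s) - f ((x(s := y)) t)) \<partial>N) = 0" by simp
  qed
  finally have "AE p in PiM (insert s I) (\<lambda>_. N). indicator {0} (f (p s) - f (p t)) = (0::ennreal)"
    using nn_integral_0_iff_AE[OF mf] by simp
  then show ?thesis unfolding I(1)[symmetric] by (rule AE_mp) (auto simp: indicator_def)
qed

lemma sorted_wrt_less_unique:
  fixes g :: "'a \<Rightarrow> 'b::linorder"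
  assumes "set xs = set ys" "sorted_wrt (\<lambda>s t. g s < g t) xs" "sorted_wrt (\<lambda>s t. g s < g t) ys"
  shows "xs = ys"
proof -
  have s: "sorted_wrt (<) (map g xs)" "sorted_wrt (<) (map g ys)" using assms by (auto simp: sorted_wrt_map)
  have m: "map g xs = map g ys" using s assms(1) by (intro strict_sorted_equal) auto
  have "distinct (map g xs)" using s strict_sorted_iff by blast
  then have "inj_on g (set xs \<union> set ys)" using assms(1) by (simp add: distinct_map)
  then show ?thesis using m map_inj_on by blast
qed

lemma sorted_wrt_less_distinct:
  fixes g :: "'a \<Rightarrow> 'b::linorder"
  assumes "sorted_wrt (\<lambda>s t. g s < g t) xs"
  shows "distinct xs"
  using assms by (induction xs) auto

text \<open>By exchangeability all orderings are equally likely, and ties have probability 0.\<close>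

lemma nn_integral_ordering_le:
  fixes f :: "'b \<Rightarrow> real" and G :: "'a list \<Rightarrow> ennreal"
  assumes S: "finite S" and N: "prob_space N" and f: "f \<in> borel_measurable N"
    and ae: "\<And>c::real. AE q in N. f q \<noteq> c"
  defines "M \<equiv> PiM S (\<lambda>_. N)"
  defines "ord \<equiv> \<lambda>p. THE xs. set xs = S \<and> sorted_wrt (\<lambda>s t. f (p s) < f (p t)) xs"
  shows "(\<lambda>p. G (ord p)) \<in> borel_measurable M \<and>
    (\<integral>\<^sup>+ p. G (ord p) \<partial>M) \<le> (\<Sum>xs\<in>permutations_of_set S. G xs) / fact (card S)"
proof -
  interpret M: prob_space M unfolding M_def by (rule prob_space_PiM) (rule N)
  let ?Pm = "permutations_of_set S"
  define Ev where "Ev xs = {p \<in> space M. sorted_wrt (\<lambda>s t. f (p s) < f (p t)) xs}" for xs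
  have comp: "(\<lambda>p. f (p s)) \<in> borel_measurable M" if "s \<in> S" for s
    unfolding M_def by (rule measurable_compose[OF measurable_component_singleton[OF that] f])
  have EvM: "Ev xs \<in> sets M" if xs: "set xs \<subseteq> S" for xs
    using xs
  proof (induction xs)
    case Nil
    then show ?case by (simp add: Ev_def)
  next
    case (Cons s xs)
    have "{p \<in> space M. \<forall>t\<in>set xs. f (p s) < f (p t)} \<in> sets M"
      using Cons.prems by (intro sets.sets_Collect_finite_All borel_measurable_less comp) auto
    moreover have "Ev (s # xs) = {p \<in> space M. \<forall>t\<in>set xs. f (p s) < f (p t)} \<inter> Ev xs" by (auto simp: Ev_def)
    ultimately show ?case using Cons by auto
  qed
  have EvM': "Ev xs \<in> sets M" if "xs \<in> ?Pm" for xs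
    using EvM permutations_of_setD(1)[OF that] by simp
  have disj: "xs = ys" if "p \<in> Ev xs" "p \<in> Ev ys" "xs \<in> ?Pm" "ys \<in> ?Pm" for p xs ys
    using that permutations_of_setD(1) by (intro sorted_wrt_less_unique[where g = "\<lambda>s. f (p s)"]) (auto simp: Ev_def)
  have ordE: "ord p = xs" if "p \<in> Ev xs" "xs \<in> ?Pm" for p xs
    unfolding ord_def
  proof (rule the_equality)
    show "set xs = S \<and> sorted_wrt (\<lambda>s t. f (p s) < f (p t)) xs"
      using that permutations_of_setD(1) by (auto simp: Ev_def)
    fix ys assume "set ys = S \<and> sorted_wrt (\<lambda>s t. f (p s) < f (p t)) ys"
    then show "ys = xs"
      using that permutations_of_setD(1)[OF that(2)]
      by (intro sorted_wrt_less_unique[where g = "\<lambda>s. f (p s)"]) (auto simp: Ev_def)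
  qed
  \<comment> \<open>On the event of ties no list qualifies, and the description operator returns one
    unspecified but fixed list. So \<open>G (ord p)\<close> is constant there and measurability is
    not lost.\<close>
  define c0 where "c0 = (THE xs :: 'a list. False)"
  define Rest where "Rest = space M - (\<Union>xs\<in>?Pm. Ev xs)"
  have RestM: "Rest \<in> sets M" unfolding Rest_def using EvM' S by (intro sets.Diff sets.finite_UN) auto
  have ordR: "ord p = c0" if "p \<in> Rest" for p
  proof -
    have "\<not> (set xs = S \<and> sorted_wrt (\<lambda>s t. f (p s) < f (p t)) xs)" for xs
    proof
      assume h: "set xs = S \<and> sorted_wrt (\<lambda>s t. f (p s) < f (p t)) xs"
      then have "distinct xs" using sorted_wrt_less_distinct[of "\<lambda>s. f (p s)" xs] by blast
      then have "xs \<in> ?Pm" using h by auto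
      moreover have "p \<in> Ev xs" using h that by (auto simp: Ev_def Rest_def)
      ultimately show False using that by (auto simp: Rest_def)
    qed
    then have "(\<lambda>xs. set xs = S \<and> sorted_wrt (\<lambda>s t. f (p s) < f (p t)) xs) = (\<lambda>xs. False)" by blast
    then show ?thesis unfolding ord_def c0_def by simp
  qed
  have eq: "G (ord p) = (\<Sum>xs\<in>?Pm. G xs * indicator (Ev xs) p) + G c0 * indicator Rest p" if p: "p \<in> space M" for p
  proof (cases "p \<in> Rest")
    case True
    then have "p \<notin> Ev xs" if "xs \<in> ?Pm" for xs using that by (auto simp: Rest_def)
    then show ?thesis using True ordR by simp
  next
    case False
    then obtain xs where xs: "xs \<in> ?Pm" "p \<in> Ev xs" using p by (auto simp: Rest_def)
    have "(\<Sum>ys\<in>?Pm. G ys * indicator (Ev ys) p) = (\<Sum>ys\<in>?Pm. if ys = xs then G xs else 0)"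
      by (rule sum.cong[OF refl]) (use xs disj in \<open>auto simp: indicator_def\<close>)
    also have "\<dots> = G xs" using xs S by simp
    finally show ?thesis using False ordE[OF xs(2,1)] by simp
  qed
  have m1: "(\<lambda>p. G xs * indicator (Ev xs) p) \<in> borel_measurable M" if "xs \<in> ?Pm" for xs
    by (intro borel_measurable_times_ennreal borel_measurable_const borel_measurable_indicator EvM'[OF that])
  have m2: "(\<lambda>p. \<Sum>xs\<in>?Pm. G xs * indicator (Ev xs) p) \<in> borel_measurable M"
    by (rule borel_measurable_sum[OF m1])
  have m3: "(\<lambda>p. G c0 * indicator Rest p) \<in> borel_measurable M"
    by (intro borel_measurable_times_ennreal borel_measurable_const borel_measurable_indicator RestM)
  have meas: "(\<lambda>p. (\<Sum>xs\<in>?Pm. G xs * indicator (Ev xs) p) + G c0 * indicator Rest p) \<in> borel_measurable M"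
    by (rule borel_measurable_add[OF m2 m3])
  have "AE p in M. f (p (fst st)) \<noteq> f (p (snd st))" if "st \<in> S \<times> S - Id" for st
    unfolding M_def by (rule AE_values_neq[OF S _ _ _ N f ae]) (use that in auto)
  then have "AE p in M. \<forall>st\<in>S \<times> S - Id. f (p (fst st)) \<noteq> f (p (snd st))"
    using S by (intro AE_finite_allI) auto
  then have "AE p in M. p \<notin> Rest"
  proof (rule AE_mp, intro AE_I2 impI)
    fix p assume p: "p \<in> space M" and ne: "\<forall>st\<in>S \<times> S - Id. f (p (fst st)) \<noteq> f (p (snd st))"
    define g where "g s = f (p s)" for s
    have inj: "inj_on g S" using ne by (force simp: inj_on_def g_def)
    obtain ys where ys: "set ys = S" "distinct ys" using finite_distinct_list[OF S] by blast
    define xs where "xs = sort_key g ys"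
    have xs: "set xs = S" "distinct xs" "sorted (map g xs)" using ys by (simp_all add: xs_def)
    then have "sorted_wrt (<) (map g xs)" using inj by (simp add: strict_sorted_iff distinct_map)
    then have "p \<in> Ev xs" using p by (simp add: Ev_def sorted_wrt_map g_def)
    moreover have "xs \<in> ?Pm" using xs by auto
    ultimately show "p \<notin> Rest" by (auto simp: Rest_def)
  qed
  then have Rest0: "emeasure M Rest = 0" using AE_iff_measurable[OF RestM] sets.sets_into_space[OF RestM]
    by (metis (mono_tags, lifting) AE_iff_null_sets RestM null_setsD1)
  have same: "emeasure M (Ev xs) = emeasure M (Ev ys)" if xy: "xs \<in> ?Pm" "ys \<in> ?Pm" for xs ys
  proof -
    have xs: "set xs = S" "distinct xs" and ys: "set ys = S" "distinct ys"
      using xy permutations_of_setD by blast+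
    have len: "length xs = length ys" using xs ys by (metis distinct_card)
    \<comment> \<open>\<open>h\<close> relabels the sites so that \<open>xs\<close> becomes
      \<open>ys\<close>. Permuting the identical factors by \<open>h\<close> preserves the product
      measure and carries one event to the other.\<close>
    define h where "h s = ys ! (THE i. i < length xs \<and> xs ! i = s)" for s
    have h: "h (xs ! i) = ys ! i" if "i < length xs" for i
    proof -
      have "(THE j. j < length xs \<and> xs ! j = xs ! i) = i"
        using that xs(2) by (intro the_equality) (auto simp: nth_eq_iff_index_eq)
      then show ?thesis by (simp add: h_def)
    qed
    have mh: "map h xs = ys" using h len by (intro nth_equalityI) auto
    have hS: "h ` S = S" using mh xs ys by (metis set_map)
    have hinj: "inj_on h S" using mh xs ys by (metis distinct_map)
    have hfun: "h \<in> S \<rightarrow> S" using hS by auto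
    define T where "T = (\<lambda>\<omega>. \<lambda>n\<in>S. (\<omega> (h n) :: 'b))"
    have dM: "distr M M T = M"
      unfolding M_def T_def using distr_PiM_reindex[of S "\<lambda>_. N" h S, OF N hinj hfun] by simp
    have TM: "T \<in> measurable M M"
      unfolding M_def T_def using hfun by (intro measurable_restrict measurable_component_singleton) auto
    have "emeasure M (Ev xs) = emeasure (distr M M T) (Ev xs)" unfolding dM ..
    also have "\<dots> = emeasure M (T -` Ev xs \<inter> space M)" by (rule emeasure_distr[OF TM EvM'[OF xy(1)]])
    also have "T -` Ev xs \<inter> space M = Ev ys"
    proof -
      have "T p \<in> Ev xs \<longleftrightarrow> p \<in> Ev ys" if p: "p \<in> space M" for p
      proof -
        have "sorted_wrt (\<lambda>s t. f (T p s) < f (T p t)) xs \<longleftrightarrow> sorted_wrt (\<lambda>s t. f (p (h s)) < f (p (h t))) xs"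
        proof -
          have "T p (xs ! i) = p (h (xs ! i))" if "i < length xs" for i
            using that xs(1) by (auto simp: T_def)
          then show ?thesis unfolding sorted_wrt_iff_nth_less by auto
        qed
        also have "\<dots> \<longleftrightarrow> sorted_wrt (\<lambda>s t. f (p s) < f (p t)) ys"
          unfolding mh[symmetric] sorted_wrt_map ..
        finally show ?thesis using p measurable_space[OF TM p] by (simp add: Ev_def)
      qed
      then show ?thesis by (auto simp: Ev_def)
    qed
    finally show ?thesis .
  qed
  have prob: "emeasure M (Ev xs) \<le> 1 / fact (card S)" if xs: "xs \<in> ?Pm" for xs
  proof -
    have "(\<Sum>ys\<in>?Pm. emeasure M (Ev ys)) = emeasure M (\<Union>ys\<in>?Pm. Ev ys)"
      using EvM' S disj by (intro sum_emeasure) (auto simp: disjoint_family_on_def)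
    also have "\<dots> \<le> 1" by (rule M.emeasure_le_1)
    finally have "(\<Sum>ys\<in>?Pm. emeasure M (Ev xs)) \<le> 1" using same[OF xs] by (simp cong: sum.cong)
    then have "of_nat (fact (card S)) * emeasure M (Ev xs) \<le> 1" using S by simp
    then have "ennreal (real (fact (card S)) * measure M (Ev xs)) \<le> ennreal 1"
      by (simp add: M.emeasure_eq_measure ennreal_mult ennreal_of_nat_eq_real_of_nat del: of_nat_fact)
    then have "real (fact (card S)) * measure M (Ev xs) \<le> 1" by (subst (asm) ennreal_le_iff) auto
    then have "measure M (Ev xs) \<le> 1 / real (fact (card S))" by (simp add: field_simps)
    then have "emeasure M (Ev xs) \<le> ennreal (1 / real (fact (card S)))"
      by (simp add: M.emeasure_eq_measure ennreal_leI)
    also have "\<dots> = ennreal 1 / ennreal (real (fact (card S)))" by (rule divide_ennreal[symmetric]) auto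
    also have "\<dots> = 1 / of_nat (fact (card S))" by (simp only: ennreal_of_nat_eq_real_of_nat ennreal_1)
    finally show ?thesis by simp
  qed
  have "(\<integral>\<^sup>+ p. G (ord p) \<partial>M) = (\<integral>\<^sup>+ p. (\<Sum>xs\<in>?Pm. G xs * indicator (Ev xs) p) + G c0 * indicator Rest p \<partial>M)"
    by (rule nn_integral_cong) (rule eq)
  also have "\<dots> = (\<integral>\<^sup>+ p. (\<Sum>xs\<in>?Pm. G xs * indicator (Ev xs) p) \<partial>M) + (\<integral>\<^sup>+ p. G c0 * indicator Rest p \<partial>M)"
    by (rule nn_integral_add[OF m2 m3])
  also have "(\<integral>\<^sup>+ p. (\<Sum>xs\<in>?Pm. G xs * indicator (Ev xs) p) \<partial>M) = (\<Sum>xs\<in>?Pm. \<integral>\<^sup>+ p. G xs * indicator (Ev xs) p \<partial>M)"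
    by (rule nn_integral_sum[OF m1])
  also have "\<dots> = (\<Sum>xs\<in>?Pm. G xs * emeasure M (Ev xs))"
    by (rule sum.cong[OF refl], rule nn_integral_cmult_indicator[OF EvM'])
  also have "(\<integral>\<^sup>+ p. G c0 * indicator Rest p \<partial>M) = G c0 * emeasure M Rest"
    by (rule nn_integral_cmult_indicator[OF RestM])
  also have "(\<Sum>xs\<in>?Pm. G xs * emeasure M (Ev xs)) + G c0 * emeasure M Rest = (\<Sum>xs\<in>?Pm. G xs * emeasure M (Ev xs))"
    using Rest0 by simp
  also have "\<dots> \<le> (\<Sum>xs\<in>?Pm. G xs * (1 / fact (card S)))" by (intro sum_mono mult_left_mono prob) auto
  also have "\<dots> = (\<Sum>xs\<in>?Pm. G xs) / fact (card S)"
    by (simp add: divide_ennreal_def sum_distrib_right)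
  finally have "(\<integral>\<^sup>+ p. G (ord p) \<partial>M) \<le> (\<Sum>xs\<in>?Pm. G xs) / fact (card S)" .
  moreover have "(\<lambda>p. G (ord p)) \<in> borel_measurable M"
    using meas eq by (simp cong: measurable_cong)
  ultimately show ?thesis by blast
qed

section \<open>Assembling the expected complexity\<close>

lemma sum_incidences_le:
  assumes S: "finite S" "card S = n" and n: "2 \<le> n" and k: "1 \<le> k"
  shows "real (\<Sum>xs\<in>permutations_of_set S. 7 * card (incidences k xs) + 6 * n + 1) \<le>
    fact n * (20000000 * real k ^ 4 * real n * ln (real n))"
proof -
  let ?Pm = "permutations_of_set S"
  define L where "L = ln (real n)"
  define X where "X = real k ^ 4 * real n * L"
  \<comment> \<open>The assumption \<open>n \<ge> 2\<close> bounds the logarithm below, so that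
    lower-order terms can be absorbed: \<open>1 \<le> 3 / 2 * L\<close>, and hence
    \<open>harm n \<le> 1 + L \<le> 5 / 2 * L\<close>.\<close>
  have "2 / 3 \<le> ln (2::real)" by (rule ln2_ge_two_thirds)
  also have "ln 2 \<le> L" unfolding L_def using n by simp
  finally have L: "2 / 3 \<le> L" .
  have k3: "real k ^ 3 \<le> real k ^ 4" "1 \<le> real k ^ 4" using k by (auto intro: power_increasing)
  have "harm n - ln (real n) \<le> harm 1 - ln (real 1)"
    using decseqD[OF decseq_harm_diff_ln, of 0 "n - 1"] n by simp
  moreover have "harm 1 = (1::real)" by (simp add: harm_def)
  ultimately have H: "harm n \<le> 5 / 2 * L" using L by (simp add: L_def)
  have X1: "real k ^ 4 * real n \<le> 3 / 2 * X"
    using mult_left_mono[OF L, of "real k ^ 4 * real n"] by (simp add: X_def mult_ac)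
  have X3: "real k ^ 3 * real n \<le> 3 / 2 * X"
    using mult_right_mono[OF k3(1), of "real n"] X1 by linarith
  have XH: "real k ^ 4 * real n * harm n \<le> 5 / 2 * X"
    using mult_left_mono[OF H, of "real k ^ 4 * real n"] by (simp add: X_def mult_ac)
  have "6 * real n + 1 \<le> 7 * real n" using n by simp
  also have "\<dots> \<le> 7 * (real k ^ 4 * real n)" using mult_right_mono[OF k3(2), of "real n"] by simp
  finally have Xn: "6 * real n + 1 \<le> 21 / 2 * X" using X1 by linarith
  have "(\<Sum>xs\<in>?Pm. card (incidences k xs)) \<le> (\<Sum>xs\<in>?Pm. 2 * card (shallow_ties k xs) + card (shallow_crossings k xs))"
    by (rule sum_mono, rule conjunct2[OF card_incidences_le[OF permutations_of_setD(2) k]])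
  also have "\<dots> = 2 * (\<Sum>xs\<in>?Pm. card (shallow_ties k xs)) + (\<Sum>xs\<in>?Pm. card (shallow_crossings k xs))"
    by (simp only: sum.distrib sum_distrib_left)
  also have "\<dots> \<le> 2 * (12 * (8 * k) ^ 3 * n * fact n) + (\<Sum>xs\<in>?Pm. card (shallow_crossings k xs))"
    using sum_shallow_ties_le[OF S(1) k] unfolding S(2) by (intro add_right_mono mult_le_mono2)
  finally have "real (\<Sum>xs\<in>?Pm. card (incidences k xs)) \<le>
      real (2 * (12 * (8 * k) ^ 3 * n * fact n) + (\<Sum>xs\<in>?Pm. card (shallow_crossings k xs)))" by (simp only: of_nat_le_iff)
  also have "\<dots> = 12288 * (real k ^ 3 * real n) * fact n + real (\<Sum>xs\<in>?Pm. card (shallow_crossings k xs))"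
    by (simp add: power_mult_distrib)
  also have "\<dots> \<le> 12288 * (real k ^ 3 * real n) * fact n + 224 * (8 * real k) ^ 4 * real n * harm n * fact n"
    using sum_shallow_crossings_le[OF S(1) k] unfolding S(2) by (rule add_left_mono)
  \<comment> \<open>The constants are \<open>12288 = 2 * 12 * 8 ^ 3\<close> and
    \<open>917504 = 224 * 8 ^ 4\<close>.\<close>
  also have "\<dots> = fact n * (12288 * (real k ^ 3 * real n) + 917504 * (real k ^ 4 * real n * harm n))"
    by (simp add: power_mult_distrib algebra_simps)
  also have "\<dots> \<le> fact n * (12288 * (3 / 2 * X) + 917504 * (5 / 2 * X))"
    using X3 XH by (intro mult_left_mono add_mono) auto
  finally have I: "real (\<Sum>xs\<in>?Pm. card (incidences k xs)) \<le> fact n * (2312192 * X)" by simp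
  have "real (\<Sum>xs\<in>?Pm. 7 * card (incidences k xs) + 6 * n + 1) =
    7 * real (\<Sum>xs\<in>?Pm. card (incidences k xs)) + fact n * (6 * real n + 1)"
  proof -
    have "(\<Sum>xs\<in>?Pm. 7 * card (incidences k xs) + 6 * n + 1) = 7 * (\<Sum>xs\<in>?Pm. card (incidences k xs)) + fact n * (6 * n + 1)"
      unfolding sum.distrib sum_distrib_left[symmetric] using S by (simp add: algebra_simps)
    then have "real (\<Sum>xs\<in>?Pm. 7 * card (incidences k xs) + 6 * n + 1) =
      real (7 * (\<Sum>xs\<in>?Pm. card (incidences k xs)) + fact n * (6 * n + 1))" by (rule arg_cong)
    also have "\<dots> = 7 * real (\<Sum>xs\<in>?Pm. card (incidences k xs)) + fact n * (6 * real n + 1)"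
      by (simp only: of_nat_add of_nat_mult of_nat_fact of_nat_numeral of_nat_1)
    finally show ?thesis .
  qed
  also have "\<dots> \<le> 7 * (fact n * (2312192 * X)) + fact n * (21 / 2 * X)"
    using I Xn by (intro add_mono mult_left_mono) auto
  also have "\<dots> = fact n * (16185354.5 * X)" by (simp add: algebra_simps)
  also have "\<dots> \<le> fact n * (20000000 * X)"
    using L by (intro mult_left_mono mult_right_mono) (auto simp: X_def)
  finally show ?thesis by (simp add: X_def L_def mult_ac)
qed

lemma ennreal_average_le:
  assumes "\<And>x. x \<in> A \<Longrightarrow> G x \<le> of_nat (m x)" "real (\<Sum>x\<in>A. m x) \<le> fact n * b"
  shows "(\<Sum>x\<in>A. G x) / fact n \<le> ennreal b"
proof -
  have f: "(fact n :: ennreal) = ennreal (fact n)"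
    by (metis ennreal_of_nat_eq_real_of_nat of_nat_fact)
  have "(\<Sum>x\<in>A. G x) \<le> (\<Sum>x\<in>A. of_nat (m x))" by (rule sum_mono) (rule assms)
  also have "\<dots> = ennreal (real (\<Sum>x\<in>A. m x))"
    unfolding ennreal_of_nat_eq_real_of_nat[symmetric] by (rule of_nat_sum[symmetric])
  also have "\<dots> \<le> ennreal (fact n * b)" using assms(2) by (rule ennreal_leI)
  finally have "(\<Sum>x\<in>A. G x) / fact n \<le> ennreal (fact n * b) / ennreal (fact n)"
    unfolding f by (rule divide_right_mono_ennreal)
  also have "\<dots> = ennreal b"
  proof (cases "b \<ge> 0")
    case True
    then show ?thesis by (subst divide_ennreal) auto
  next
    case False
    then have "fact n * b \<le> 0" by (simp add: mult_nonneg_nonpos)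
    then show ?thesis using False by (simp add: ennreal_neg)
  qed
  finally show ?thesis .
qed

lemma sampling_bound:
  assumes d: "d \<ge> 1" and S: "finite S" "card S = n" and n: "n \<ge> 2" and k: "k \<ge> 1"
    and D: "\<forall>j\<in>{1..d}. continuous_distribution_01 (D j)"
    and G: "\<And>xs. distinct xs \<Longrightarrow> G xs = arr_complexity (curves k xs)"
  shows "(\<lambda>p. G (volume_ordering d p S)) \<in> borel_measurable (sampling_model d D S) \<and>
    (\<integral>\<^sup>+ p. G (volume_ordering d p S) \<partial>sampling_model d D S)
      \<le> ennreal (20000000 * real k ^ 4 * real n * ln (real n))"
proof -
  \<comment> \<open>Outside \<open>{1..d}\<close> the family \<open>D\<close> is arbitrary. Filling
    these indices with \<open>D 1\<close> makes every member a probability measure, as the product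
    measure theorems require, and leaves the product over \<open>{1..d}\<close> unchanged.\<close>
  define D' where "D' j = (if j \<in> {1..d} then D j else D 1)" for j
  define N where "N = PiM {1..d} D'"
  have D': "continuous_distribution_01 (D' j)" for j using D d by (simp add: D'_def)
  have M: "sampling_model d D S = PiM S (\<lambda>_. N)"
    unfolding sampling_model_def N_def by (intro PiM_cong refl) (simp add: D'_def)
  have real: "real_distribution (D' j)" for j using D'[of j] by (simp add: continuous_distribution_01_def)
  have N: "prob_space N" unfolding N_def by (rule prob_space_PiM) (use real in \<open>simp add: real_distribution_def\<close>)
  have f: "point_volume d \<in> borel_measurable N"
    unfolding N_def by (rule measurable_point_volume) (rule real_distribution.events_eq_borel[OF real])
  have ae: "AE q in N. point_volume d q \<noteq> c" for c unfolding N_def by (rule AE_point_volume_neq[OF d D'])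
  have avg: "(\<Sum>xs\<in>permutations_of_set S. G xs) / fact n \<le> ennreal (20000000 * real k ^ 4 * real n * ln (real n))"
  proof (rule ennreal_average_le)
    fix xs assume xs: "xs \<in> permutations_of_set S"
    then have "distinct xs" "length xs = n" using S length_finite_permutations_of_set[OF xs] by (auto dest: permutations_of_setD)
    then show "G xs \<le> of_nat (7 * card (incidences k xs) + 6 * n + 1)"
      using arr_complexity_curves_le[OF _ k, of xs] G by simp
  qed (rule sum_incidences_le[OF S n k])
  from nn_integral_ordering_le[OF S(1) N f ae, of G, folded volume_ordering_def M] avg S(2) show ?thesis
    by (auto intro: order.trans)
qed

theorem lemma5p8:
  fixes d :: nat
  assumes "d \<ge> 1"
  shows "\<exists>C::real. \<forall>(n::nat) (k::nat) (S::(real^2) set) (D::nat \<Rightarrow> real measure).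
    n \<ge> 2 \<longrightarrow> k \<ge> 1 \<longrightarrow> finite S \<longrightarrow> card S = n \<longrightarrow>
    (\<forall>j\<in>{1..d}. continuous_distribution_01 (D j)) \<longrightarrow>
      (\<lambda>p. overlay_complexity k (volume_ordering d p S))
        \<in> borel_measurable (sampling_model d D S) \<and>
      (\<integral>\<^sup>+ p. overlay_complexity k (volume_ordering d p S) \<partial>sampling_model d D S)
        \<le> ennreal (C * real k ^ 4 * real n * ln (real n)) \<and>
      (\<lambda>p. proxy_diagram_complexity k (volume_ordering d p S))
        \<in> borel_measurable (sampling_model d D S) \<and>
      (\<integral>\<^sup>+ p. proxy_diagram_complexity k (volume_ordering d p S) \<partial>sampling_model d D S)
        \<le> ennreal (C * real k ^ 4 * real n * ln (real n))"
proof (intro exI allI impI)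
  fix n k :: nat and S :: "(real^2) set" and D :: "nat \<Rightarrow> real measure"
  assume n: "n \<ge> 2" and k: "k \<ge> 1" and S: "finite S" "card S = n"
    and D: "\<forall>j\<in>{1..d}. continuous_distribution_01 (D j)"
  note bound = sampling_bound[OF assms S n k D]
  have "overlay_complexity k xs = arr_complexity (curves k xs)"
    "proxy_diagram_complexity k xs = arr_complexity (curves k xs)" if "distinct xs" for xs
    using that k by (simp_all only: overlay_complexity_def overlay_curves_eq proxy_diagram_complexity_def proxy_curves_eq)
  \<comment> \<open>The witness for \<open>C\<close> has been left open so far; the final
    \<open>show\<close> instantiates it.\<close>
  from bound[OF this(1)] bound[OF this(2)]
  show "(\<lambda>p. overlay_complexity k (volume_ordering d p S)) \<in> borel_measurable (sampling_model d D S) \<and>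
      (\<integral>\<^sup>+ p. overlay_complexity k (volume_ordering d p S) \<partial>sampling_model d D S)
        \<le> ennreal (20000000 * real k ^ 4 * real n * ln (real n)) \<and>
      (\<lambda>p. proxy_diagram_complexity k (volume_ordering d p S)) \<in> borel_measurable (sampling_model d D S) \<and>
      (\<integral>\<^sup>+ p. proxy_diagram_complexity k (volume_ordering d p S) \<partial>sampling_model d D S)
        \<le> ennreal (20000000 * real k ^ 4 * real n * ln (real n))"
    by blast
qed

end
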